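(* Let $\mathfrak{A}$ and $\mathfrak{B}$ be irreducible $C^*$-algebras acting on complex Hilbert spaces $\mathcal{H}$ and $\mathcal{K}$, respectively. Suppose that either (i) $U$ and $V$ are linear bijections from $\mathcal{H}$ onto $\mathcal{K}$, or (ii) $U$ and $V$ are conjugate-linear bijections from $\mathcal{H}$ onto $\mathcal{K}$. Define $\Phi:\mathfrak{S}_n(\mathfrak{A})\to\mathfrak{S}_n(\mathfrak{B})$ by $$\Phi(\ker\omega_{x,y}\cap\mathfrak{A})=\ker\omega_{Ux,Vy}\cap\mathfrak{B}\qquad(x,y\in\mathcal{H}\setminus\{0\}).$$ Then $\Phi$ is a finite-homeomorphism. Moreover, provided that $U$ and $V$ are bounded, $\Phi$ is continuous if and only if $V^*\mathfrak{B}U\subset\mathfrak{A}$, and $\Phi$ is a homeomorphism if and only if $V^*\mathfrak{B}U=\mathfrak{A}$.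
   Context: A closure space is a pair $(K,c)$ with $K$ a set and $c:2^K\to2^K$ satisfying $c(\emptyset)=\emptyset$, $S\subset c(S)$, $c(c(S))=c(S)$, and $c(S_1)\subset c(S_2)$ whenever $S_1\subset S_2$. A map $f:(K,c)\to(L,d)$ is continuous (resp. finitely continuous) if $f(c(S))\subset d(f(S))$ for all (resp. all finite) $S\subset K$; a homeomorphism (resp. finite-homeomorphism) is a bijection $f$ with $f$ and $f^{-1}$ continuous (resp. finitely continuous). A subset $A\subset K$ is a closure space (subspace) with $c_A(S)=c(S)\cap A$. For a nonzero $C^*$-algebra $\mathfrak{A}$, the geometric structure space is $\mathfrak{S}(\mathfrak{A})=\{\ker\rho:\rho\in\mathrm{ext}(B_{\mathfrak{A}^*})\}$ with closure operator $S^{=}=\{I\in\mathfrak{S}(\mathfrak{A}):\bigcap_{I'\in S}I'\subset I\}$ (empty intersection is $\mathfrak{A}$). (This agrees with the general Banach-space definition of geometric structure space in terms of maximal faces of the unit ball.) An irreducible $C^*$-algebra acting on $\mathcal{H}$ is a (nonzero) $C^*$-subalgebra of $B(\mathcal{H})$ with no nontrivial invariant subspace. $\omega_{x,y}(A)=\langle Ax,y\rangle$ for $A\in B(\mathcal{H})$. For irreducible $\mathfrak{A}$ on $\mathcal{H}$, the normal part is $\mathfrak{S}_n(\mathfrak{A})=\{\ker\omega_{x,y}\cap\mathfrak{A}:x,y\in\mathcal{H}\setminus\{0\}\}\subset\mathfrak{S}(\mathfrak{A})$, regarded as a subspace of $\mathfrak{S}(\mathfrak{A})$. The adjoint $V^*:\mathcal{K}\to\mathcal{H}$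 of a bounded conjugate-linear $V:\mathcal{H}\to\mathcal{K}$ is the bounded conjugate-linear operator with $\langle V^*w,y\rangle=\langle Vy,w\rangle$. $V^*\mathfrak{B}U=\{V^*BU:B\in\mathfrak{B}\}$. *)

theory Defs
  imports "HOL-Analysis.Analysis" "HOL-Library.Function_Algebras"
begin

section \<open>Complex Hilbert spaces\<close>

class scaleC =
  fixes scaleC :: "complex \<Rightarrow> 'a \<Rightarrow> 'a" (infixr \<open>*\<^sub>C\<close> 75)

class complex_vector = scaleC + real_vector +
  assumes scaleC_add_right: "a *\<^sub>C (x + y) = a *\<^sub>C x + a *\<^sub>C y"
    and scaleC_add_left: "(a + b) *\<^sub>C x = a *\<^sub>C x + b *\<^sub>C x"
    and scaleC_scaleC: "a *\<^sub>C b *\<^sub>C x = (a * b) *\<^sub>C x"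
    and scaleC_one: "1 *\<^sub>C x = x"
    and scaleR_scaleC: "r *\<^sub>R x = complex_of_real r *\<^sub>C x"

interpretation complex_vector:
  vector_space "scaleC :: complex \<Rightarrow> 'a \<Rightarrow> 'a :: complex_vector"
  by unfold_locales
    (simp_all add: scaleC_add_right scaleC_add_left scaleC_scaleC scaleC_one)

text \<open>The inner product is linear in the first argument. Positive definiteness, and the fact that
  the norm is \<open>sqrt \<langle>x, x\<rangle>\<close>, are inherited from the class \<^class>\<open>real_inner\<close>, because
  \<open>\<langle>x, x\<rangle>\<close> is real by conjugate symmetry and hence equal to \<open>inner x x\<close>.\<close>

class complex_inner = complex_vector + real_inner +
  fixes cinner :: "'a \<Rightarrow> 'a \<Rightarrow> complex" (\<open>(\<open>notation=\<open>mixfix cinner\<close>\<close>\<langle>_, _\<rangle>)\<close>)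
  assumes cinner_commute: "\<langle>x, y\<rangle> = cnj \<langle>y, x\<rangle>"
    and cinner_add_left: "\<langle>x + y, z\<rangle> = \<langle>x, z\<rangle> + \<langle>y, z\<rangle>"
    and cinner_scaleC_left: "\<langle>c *\<^sub>C x, y\<rangle> = c * \<langle>x, y\<rangle>"
    and inner_eq_Re_cinner: "inner x y = Re \<langle>x, y\<rangle>"

class complex_hilbert_space = complex_inner + complete_space

lemma cinner_self: "\<langle>x, x\<rangle> = complex_of_real ((norm x)\<^sup>2)" for x :: "'a :: complex_inner"
proof -
  have "Im \<langle>x, x\<rangle> = 0"
    using arg_cong[OF cinner_commute[of x x], of Im] by simp
  moreover have "Re \<langle>x, x\<rangle> = (norm x)\<^sup>2"
    by (simp add: power2_norm_eq_inner inner_eq_Re_cinner)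
  ultimately show ?thesis by (simp add: complex_eq_iff)
qed

lemma cinner_scaleC_right: "\<langle>x, c *\<^sub>C y\<rangle> = cnj c * \<langle>x, y\<rangle>" for x :: "'a :: complex_inner"
  by (metis cinner_commute cinner_scaleC_left complex_cnj_mult)

lemma norm_scaleC: "norm (c *\<^sub>C x) = cmod c * norm x" for x :: "'a :: complex_inner"
proof -
  have "\<langle>c *\<^sub>C x, c *\<^sub>C x\<rangle> = (c * cnj c) * \<langle>x, x\<rangle>"
    by (simp add: cinner_scaleC_left cinner_scaleC_right)
  also have "\<dots> = complex_of_real ((cmod c * norm x)\<^sup>2)"
    by (simp add: cinner_self power_mult_distrib flip: complex_norm_square)
  finally have "(norm (c *\<^sub>C x))\<^sup>2 = (cmod c * norm x)\<^sup>2"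
    unfolding cinner_self of_real_eq_iff .
  then show ?thesis by simp
qed

abbreviation clinear :: "('a :: complex_vector \<Rightarrow> 'b :: complex_vector) \<Rightarrow> bool" where
  "clinear \<equiv> Vector_Spaces.linear scaleC scaleC"

text \<open>Linear and conjugate-linear maps are in particular real-linear, so for either kind the
  library's \<^const>\<open>bounded_linear\<close> says exactly that the map is bounded.\<close>

definition antilinear :: "('a :: complex_vector \<Rightarrow> 'b :: complex_vector) \<Rightarrow> bool" where
  "antilinear f \<longleftrightarrow> (\<forall>x y. f (x + y) = f x + f y) \<and> (\<forall>c x. f (c *\<^sub>C x) = cnj c *\<^sub>C f x)"

text \<open>For a bounded map between Hilbert spaces exactly one adjoint satisfies the defining identity,
  so the descriptions below are proper. The adjoint of a linear map is characterised by
  \<open>\<langle>V\<^sup>*w, y\<rangle> = \<langle>w, V y\<rangle>\<close>, that of a conjugate-linear one by \<open>\<langle>V\<^sup>*w, y\<rangle> = \<langle>V y, w\<rangle>\<close>; the only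
  map of both kinds is \<open>0\<close>, whose adjoint is \<open>0\<close> either way.\<close>

definition adjoint_linear ::
    "('a :: complex_hilbert_space \<Rightarrow> 'b :: complex_hilbert_space) \<Rightarrow> 'b \<Rightarrow> 'a" where
  "adjoint_linear V = (THE W. \<forall>w y. \<langle>W w, y\<rangle> = \<langle>w, V y\<rangle>)"

definition adjoint_antilinear ::
    "('a :: complex_hilbert_space \<Rightarrow> 'b :: complex_hilbert_space) \<Rightarrow> 'b \<Rightarrow> 'a" where
  "adjoint_antilinear V = (THE W. \<forall>w y. \<langle>W w, y\<rangle> = \<langle>V y, w\<rangle>)"

definition hadjoint ::
    "('a :: complex_hilbert_space \<Rightarrow> 'b :: complex_hilbert_space) \<Rightarrow> 'b \<Rightarrow> 'a" where
  "hadjoint V = (if clinear V then adjoint_linear V else adjoint_antilinear V)"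


section \<open>Irreducible C*-algebras\<close>

text \<open>Elements of \<^typ>\<open>'a \<Rightarrow>\<^sub>L 'b\<close> are bounded real-linear maps; the bounded operators of the
  theory are the complex-linear ones among them. On these the norm of \<^typ>\<open>'a \<Rightarrow>\<^sub>L 'b\<close>
  is the usual operator norm.\<close>

instantiation blinfun :: (real_normed_vector, complex_inner) complex_vector
begin

lift_definition scaleC_blinfun :: "complex \<Rightarrow> ('a \<Rightarrow>\<^sub>L 'b) \<Rightarrow> ('a \<Rightarrow>\<^sub>L 'b)"
  is "\<lambda>c f x. c *\<^sub>C f x"
proof -
  fix c and f :: "'a \<Rightarrow> 'b"
  assume "bounded_linear f"
  then interpret f: bounded_linear f .
  show "bounded_linear (\<lambda>x. c *\<^sub>C f x)"
  proof (rule bounded_linear_intro)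
    show "norm (c *\<^sub>C f x) \<le> norm x * (onorm f * cmod c)" for x
      using mult_right_mono[OF onorm[OF \<open>bounded_linear f\<close>, of x], of "cmod c"]
      by (simp add: norm_scaleC mult_ac)
  qed (simp_all add: f.add f.scaleR scaleC_add_right scaleR_scaleC mult.commute)
qed

instance
  by standard
    (transfer, simp add: scaleC_add_right scaleC_add_left scaleR_scaleC)+

end

definition cstar_subalgebra :: "('a :: complex_hilbert_space \<Rightarrow>\<^sub>L 'a) set \<Rightarrow> bool" where
  "cstar_subalgebra A \<longleftrightarrow>
     (\<forall>T\<in>A. clinear (blinfun_apply T)) \<and>
     complex_vector.subspace A \<and>
     (\<forall>S\<in>A. \<forall>T\<in>A. S o\<^sub>L T \<in> A) \<and>
     (\<forall>T\<in>A. Blinfun (hadjoint (blinfun_apply T)) \<in> A) \<and>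
     closed A"

text \<open>Invariant subspaces are closed, as usual in operator theory.\<close>

definition irreducible_cstar :: "('a :: complex_hilbert_space \<Rightarrow>\<^sub>L 'a) set \<Rightarrow> bool" where
  "irreducible_cstar A \<longleftrightarrow>
     cstar_subalgebra A \<and> A \<noteq> {0} \<and>
     (\<forall>M. complex_vector.subspace M \<and> closed M \<and> (\<forall>T\<in>A. blinfun_apply T ` M \<subseteq> M)
        \<longrightarrow> M = {0} \<or> M = UNIV)"

definition sandwich ::
    "('a :: complex_hilbert_space \<Rightarrow> 'b :: complex_hilbert_space) \<Rightarrow> ('a \<Rightarrow> 'b) \<Rightarrow>
       ('b \<Rightarrow>\<^sub>L 'b) set \<Rightarrow> ('a \<Rightarrow>\<^sub>L 'a) set" where
  "sandwich V U B = (\<lambda>T. Blinfun (hadjoint V \<circ> blinfun_apply T \<circ> U)) ` B"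


section \<open>Closure spaces\<close>

definition closure_space :: "'k set \<Rightarrow> ('k set \<Rightarrow> 'k set) \<Rightarrow> bool" where
  "closure_space K c \<longleftrightarrow>
     (\<forall>S\<subseteq>K. c S \<subseteq> K) \<and> c {} = {} \<and> (\<forall>S\<subseteq>K. S \<subseteq> c S) \<and> (\<forall>S\<subseteq>K. c (c S) = c S) \<and>
     (\<forall>S1 S2. S1 \<subseteq> S2 \<and> S2 \<subseteq> K \<longrightarrow> c S1 \<subseteq> c S2)"

definition subspace_closure :: "('k set \<Rightarrow> 'k set) \<Rightarrow> 'k set \<Rightarrow> 'k set \<Rightarrow> 'k set" where
  "subspace_closure c A = (\<lambda>S. c S \<inter> A)"

lemma closure_space_subspace:
  assumes "closure_space K c" and "A \<subseteq> K"
  shows "closure_space A (subspace_closure c A)"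
proof -
  have empty: "c {} = {}" and inK: "\<And>S. S \<subseteq> K \<Longrightarrow> c S \<subseteq> K"
    and ext: "\<And>S. S \<subseteq> K \<Longrightarrow> S \<subseteq> c S" and idem: "\<And>S. S \<subseteq> K \<Longrightarrow> c (c S) = c S"
    and mono: "\<And>S1 S2. S1 \<subseteq> S2 \<Longrightarrow> S2 \<subseteq> K \<Longrightarrow> c S1 \<subseteq> c S2"
    using assms(1) by (simp_all add: closure_space_def)
  have sub: "S \<subseteq> K" if "S \<subseteq> A" for S
    using that assms(2) by (rule subset_trans)
  have "c (c S \<inter> A) \<inter> A = c S \<inter> A" if "S \<subseteq> A" for S
  proof
    have "c (c S \<inter> A) \<subseteq> c (c S)"
      using inK[OF sub[OF that]] by (intro mono) simp_all
    then show "c (c S \<inter> A) \<inter> A \<subseteq> c S \<inter> A"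
      using idem[OF sub[OF that]] by auto
    show "c S \<inter> A \<subseteq> c (c S \<inter> A) \<inter> A"
      using ext[OF sub[of "c S \<inter> A"]] by simp
  qed
  moreover have "S \<subseteq> c S \<inter> A" if "S \<subseteq> A" for S
    using that ext[OF sub[OF that]] by simp
  moreover have "c S1 \<inter> A \<subseteq> c S2 \<inter> A" if "S1 \<subseteq> S2" "S2 \<subseteq> A" for S1 S2
    using mono[OF that(1) sub[OF that(2)]] by auto
  ultimately show ?thesis
    by (simp add: closure_space_def subspace_closure_def empty)
qed

definition closure_continuous ::
    "'k set \<Rightarrow> ('k set \<Rightarrow> 'k set) \<Rightarrow> 'l set \<Rightarrow> ('l set \<Rightarrow> 'l set) \<Rightarrow> ('k \<Rightarrow> 'l) \<Rightarrow> bool" where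
  "closure_continuous K c L d f \<longleftrightarrow>
     f \<in> K \<rightarrow> L \<and> (\<forall>S\<subseteq>K. f ` c S \<subseteq> d (f ` S))"

definition finitely_continuous ::
    "'k set \<Rightarrow> ('k set \<Rightarrow> 'k set) \<Rightarrow> 'l set \<Rightarrow> ('l set \<Rightarrow> 'l set) \<Rightarrow> ('k \<Rightarrow> 'l) \<Rightarrow> bool" where
  "finitely_continuous K c L d f \<longleftrightarrow>
     f \<in> K \<rightarrow> L \<and> (\<forall>S\<subseteq>K. finite S \<longrightarrow> f ` c S \<subseteq> d (f ` S))"

definition closure_homeomorphism ::
    "'k set \<Rightarrow> ('k set \<Rightarrow> 'k set) \<Rightarrow> 'l set \<Rightarrow> ('l set \<Rightarrow> 'l set) \<Rightarrow> ('k \<Rightarrow> 'l) \<Rightarrow> bool" where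
  "closure_homeomorphism K c L d f \<longleftrightarrow>
     bij_betw f K L \<and> closure_continuous K c L d f \<and> closure_continuous L d K c (inv_into K f)"

definition finite_homeomorphism ::
    "'k set \<Rightarrow> ('k set \<Rightarrow> 'k set) \<Rightarrow> 'l set \<Rightarrow> ('l set \<Rightarrow> 'l set) \<Rightarrow> ('k \<Rightarrow> 'l) \<Rightarrow> bool" where
  "finite_homeomorphism K c L d f \<longleftrightarrow>
     bij_betw f K L \<and> finitely_continuous K c L d f \<and> finitely_continuous L d K c (inv_into K f)"


section \<open>The geometric structure space\<close>

text \<open>Real vector space structure on functions, to have \<^const>\<open>extreme_point_of\<close> available.\<close>

instantiation "fun" :: (type, real_vector) real_vector
begin

definition scaleR_fun :: "real \<Rightarrow> ('a \<Rightarrow> 'b) \<Rightarrow> 'a \<Rightarrow> 'b" where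
  "r *\<^sub>R f = (\<lambda>x. r *\<^sub>R f x)"

instance
  by standard (simp_all add: scaleR_fun_def fun_eq_iff scaleR_add_right scaleR_add_left)

end

text \<open>A functional on the subset \<open>A\<close> is represented by the function extending it by \<open>0\<close> outside
  \<open>A\<close>, so that equality of functions is equality of functionals.\<close>

definition dual_ball :: "('a :: complex_hilbert_space \<Rightarrow>\<^sub>L 'a) set \<Rightarrow> (('a \<Rightarrow>\<^sub>L 'a) \<Rightarrow> complex) set" where
  "dual_ball A = {\<rho>.
     (\<forall>S\<in>A. \<forall>T\<in>A. \<rho> (S + T) = \<rho> S + \<rho> T) \<and>
     (\<forall>c. \<forall>T\<in>A. \<rho> (c *\<^sub>C T) = c * \<rho> T) \<and>
     (\<forall>T\<in>A. cmod (\<rho> T) \<le> norm T) \<and>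
     (\<forall>T. T \<notin> A \<longrightarrow> \<rho> T = 0)}"

definition ker_on :: "('a \<Rightarrow>\<^sub>L 'a) set \<Rightarrow> (('a \<Rightarrow>\<^sub>L 'a) \<Rightarrow> complex) \<Rightarrow> ('a :: complex_hilbert_space \<Rightarrow>\<^sub>L 'a) set" where
  "ker_on A \<rho> = {T\<in>A. \<rho> T = 0}"

definition structure_space :: "('a :: complex_hilbert_space \<Rightarrow>\<^sub>L 'a) set \<Rightarrow> ('a \<Rightarrow>\<^sub>L 'a) set set" where
  "structure_space A = {ker_on A \<rho> |\<rho>. \<rho> extreme_point_of dual_ball A}"

text \<open>Intersecting with \<open>A\<close> makes the empty intersection equal to \<open>A\<close>.\<close>

definition structure_closure ::
    "('a :: complex_hilbert_space \<Rightarrow>\<^sub>L 'a) set \<Rightarrow> ('a \<Rightarrow>\<^sub>L 'a) set set \<Rightarrow> ('a \<Rightarrow>\<^sub>L 'a) set set" where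
  "structure_closure A S = {I \<in> structure_space A. A \<inter> \<Inter>S \<subseteq> I}"

definition vector_functional :: "'a \<Rightarrow> 'a \<Rightarrow> ('a :: complex_hilbert_space \<Rightarrow>\<^sub>L 'a) \<Rightarrow> complex" (\<open>\<omega>\<close>) where
  "\<omega> x y T = \<langle>blinfun_apply T x, y\<rangle>"

definition normal_part :: "('a :: complex_hilbert_space \<Rightarrow>\<^sub>L 'a) set \<Rightarrow> ('a \<Rightarrow>\<^sub>L 'a) set set" where
  "normal_part A = {ker_on A (\<omega> x y) |x y. x \<noteq> 0 \<and> y \<noteq> 0}"

definition normal_closure ::
    "('a :: complex_hilbert_space \<Rightarrow>\<^sub>L 'a) set \<Rightarrow> ('a \<Rightarrow>\<^sub>L 'a) set set \<Rightarrow> ('a \<Rightarrow>\<^sub>L 'a) set set" where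
  "normal_closure A = subspace_closure (structure_closure A) (normal_part A)"

lemma zero_not_extreme_point:
  assumes "cstar_subalgebra A" and "A \<noteq> {0}"
  shows "\<not> (\<lambda>_. 0) extreme_point_of dual_ball A"
proof
  assume ext: "(\<lambda>_. 0) extreme_point_of dual_ball A"
  have sub: "complex_vector.subspace A"
    using assms(1) by (simp add: cstar_subalgebra_def)
  obtain T where T: "T \<in> A" "T \<noteq> 0"
    using assms(2) complex_vector.subspace_0[OF sub] by auto
  then obtain x where Tx: "blinfun_apply T x \<noteq> 0"
    by (metis blinfun_eqI zero_blinfun.rep_eq)
  define k where "k = norm x * norm (T x)"
  have "x \<noteq> 0" using Tx by auto
  then have k: "k > 0" using Tx by (simp add: k_def)
  define \<rho> where "\<rho> = (\<lambda>R. if R \<in> A then \<omega> x (T x) R / of_real k else 0)"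
  have cauchy: "cmod \<langle>u, v\<rangle> \<le> norm u * norm v" for u v :: 'a
  proof (cases "\<langle>u, v\<rangle> = 0")
    case False
    define c where "c = cnj \<langle>u, v\<rangle> / of_real (cmod \<langle>u, v\<rangle>)"
    have c: "cmod c = 1" "c * \<langle>u, v\<rangle> = of_real (cmod \<langle>u, v\<rangle>)"
      using False complex_norm_square[of "\<langle>u, v\<rangle>"]
      by (simp_all add: c_def norm_divide field_simps power2_eq_square)
    have "cmod \<langle>u, v\<rangle> = inner (c *\<^sub>C u) v"
      by (simp add: inner_eq_Re_cinner cinner_scaleC_left c(2))
    also have "\<dots> \<le> norm u * norm v"
      using norm_cauchy_schwarz[of "c *\<^sub>C u" v] by (simp add: norm_scaleC c(1))
    finally show ?thesis .
  qed simp
  have "cmod (\<omega> x (T x) R) / k \<le> norm R" for R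
  proof -
    have "cmod (\<omega> x (T x) R) \<le> norm (R x) * norm (T x)"
      unfolding vector_functional_def by (rule cauchy)
    also have "\<dots> \<le> norm R * norm x * norm (T x)"
      by (intro mult_right_mono norm_blinfun) simp
    finally show ?thesis using k by (simp add: k_def field_simps)
  qed
  then have bnd: "cmod (\<rho> R) \<le> norm R" for R
    using k by (simp add: \<rho>_def norm_divide)
  have add: "\<rho> (R + S) = \<rho> R + \<rho> S" if "R \<in> A" "S \<in> A" for R S
    using that complex_vector.subspace_add[OF sub that]
    by (simp add: \<rho>_def vector_functional_def blinfun.add_left cinner_add_left add_divide_distrib)
  have scale: "\<rho> (c *\<^sub>C R) = c * \<rho> R" if "R \<in> A" for c R
    using that complex_vector.subspace_scale[OF sub that]
    by (simp add: \<rho>_def vector_functional_def scaleC_blinfun.rep_eq cinner_scaleC_left)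
  have off: "\<rho> R = 0" if "R \<notin> A" for R
    using that by (simp add: \<rho>_def)
  have \<rho>: "\<rho> \<in> dual_ball A" and m\<rho>: "- \<rho> \<in> dual_ball A"
    using add scale bnd off by (auto simp: dual_ball_def)
  have "\<rho> T \<noteq> 0"
    using T Tx k by (simp add: \<rho>_def vector_functional_def cinner_self)
  then have "\<rho> \<noteq> - \<rho>" by (auto simp: fun_eq_iff)
  moreover have "(\<lambda>_. 0) = (1 - 1 / 2) *\<^sub>R \<rho> + (1 / 2 :: real) *\<^sub>R (- \<rho>)"
    by (simp add: fun_eq_iff scaleR_fun_def)
  ultimately have "(\<lambda>_. 0) \<in> open_segment \<rho> (- \<rho>)"
    unfolding in_segment by (intro conjI exI[of _ "1 / 2"]) auto
  with ext \<rho> m\<rho> show False unfolding extreme_point_of_def by blast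
qed

lemma closure_space_structure_space:
  assumes "cstar_subalgebra A" and "A \<noteq> {0}"
  shows "closure_space (structure_space A) (structure_closure A)"
proof -
  have "I \<noteq> A" if "I \<in> structure_space A" for I
  proof
    assume "I = A"
    with that obtain \<rho> where \<rho>: "\<rho> extreme_point_of dual_ball A" "ker_on A \<rho> = A"
      by (auto simp: structure_space_def)
    have "\<rho> T = 0" for T
      using \<rho> by (cases "T \<in> A") (auto simp: extreme_point_of_def dual_ball_def ker_on_def)
    then have "\<rho> = (\<lambda>_. 0)" by (rule ext)
    with \<rho> zero_not_extreme_point[OF assms] show False by simp
  qed
  moreover have "I \<subseteq> A" if "I \<in> structure_space A" for I
    using that by (auto simp: structure_space_def ker_on_def)
  ultimately have "structure_closure A {} = {}"
    unfolding structure_closure_def by (simp add: subset_antisym) (metis subset_antisym)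
  moreover have "structure_closure A S \<subseteq> structure_space A" for S
    by (simp add: structure_closure_def)
  moreover have "S \<subseteq> structure_closure A S" if "S \<subseteq> structure_space A" for S
    using that by (auto simp: structure_closure_def)
  moreover have "structure_closure A S1 \<subseteq> structure_closure A S2" if "S1 \<subseteq> S2" for S1 S2
    using Inter_anti_mono[OF that] by (auto simp: structure_closure_def)
  moreover have "structure_closure A (structure_closure A S) \<subseteq> structure_closure A S" for S
  proof -
    have "A \<inter> \<Inter>S \<subseteq> A \<inter> \<Inter>(structure_closure A S)"
      by (auto simp: structure_closure_def)
    moreover have "structure_closure A R \<subseteq> structure_closure A S"
      if "A \<inter> \<Inter>S \<subseteq> A \<inter> \<Inter>R" for R
      using that by (auto simp: structure_closure_def)
    ultimately show ?thesis by blast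
  qed
  ultimately show ?thesis
    unfolding closure_space_def by (simp add: subset_antisym)
qed

end

theory Submission
  imports Defs
begin

text \<open>
  On an irreducible algebra \<open>A\<close> a finite relation \<open>\<Sum>i. \<omega> (x i) (y i) = 0\<close> forces
  \<open>\<Sum>i. x i \<otimes> y i = 0\<close> in the algebraic tensor product (double commutant and Schur), and this
  is preserved by \<open>U \<otimes> V\<close> without any boundedness; hence the finite part. Closures in the normal
  part can be computed with kernels alone once vector functionals are known to be extreme points of
  the dual ball. For this, Kaplansky density shows that a functional \<open>f\<close> with
  \<open>1 - Re f \<le> C (1 - Re \<omega> x y)\<close> on the unit ball of \<open>A\<close> is small on contractions \<open>b\<close> with \<open>b x\<close> or
  \<open>b\<^sup>* y\<close> small, so that it vanishes on the kernel of \<open>\<omega> x y\<close>.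

  For the last part, continuity of \<open>\<Phi>\<close>, tested on the family of all normal kernels whose images
  contain a given \<open>T \<in> B\<close>, yields a nonzero \<open>a \<in> A\<close> such that \<open>\<langle>a x, y\<rangle> = 0\<close> whenever
  \<open>\<langle>V\<^sup>* T U x, y\<rangle> = 0\<close>. Two sesquilinear forms so related are proportional, so \<open>V\<^sup>* T U\<close> lies in
  \<open>A\<close>. The same argument for the inverse map gives the homeomorphism criterion.
\<close>

section \<open>Inner products\<close>

text \<open>Finite families of kernels are special because a functional vanishing on a finite
  intersection of kernels is a linear combination of the functionals involved. This turns an
  inclusion of kernels into a tensor relation, to which the density statement applies. For infinite
  families there need be no such combination, and an element of the algebra has to carry the
  information.

  All comparisons use zero sets of forms only. This lets the conjugate-linear case run along with
  the linear one: there the complex conjugate of \<open>\<langle>T (U x), V y\<rangle>\<close> is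
  sesquilinear and has the same zeros.

  Since \<open>A\<close> need not contain the identity, operators such as
  \<open>(1 + S^2)^-1\<close> or the powers of \<open>1 - adj b b\<close> are formed among all
  bounded operators, and only their products with elements of \<open>A\<close> are shown to lie in
  \<open>A\<close>. Two further devices stand in for the identity: a vector killed by all of
  \<open>A\<close> is zero, and contractions in \<open>A\<close> move a unit vector arbitrarily
  close to any other.\<close>

lemma cinner_add_right: "\<langle>x, y + z\<rangle> = \<langle>x, y\<rangle> + \<langle>x, z\<rangle>" for x :: "'a :: complex_inner"
  by (metis cinner_add_left cinner_commute complex_cnj_add)

lemma cinner_scaleR_left: "\<langle>r *\<^sub>R x, y\<rangle> = of_real r * \<langle>x, y\<rangle>" for x :: "'a :: complex_inner"
  by (simp add: scaleR_scaleC cinner_scaleC_left)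

lemma cinner_scaleR_right: "\<langle>x, r *\<^sub>R y\<rangle> = of_real r * \<langle>x, y\<rangle>" for x :: "'a :: complex_inner"
  by (simp add: scaleR_scaleC cinner_scaleC_right)

lemma cinner_cauchy_schwarz: "cmod \<langle>u, v\<rangle> \<le> norm u * norm v" for u :: "'a :: complex_inner"
proof (cases "\<langle>u, v\<rangle> = 0")
  case False
  define c where "c = cnj \<langle>u, v\<rangle> / of_real (cmod \<langle>u, v\<rangle>)"
  have c: "cmod c = 1" "c * \<langle>u, v\<rangle> = of_real (cmod \<langle>u, v\<rangle>)"
    using False complex_norm_square[of "\<langle>u, v\<rangle>"]
    by (simp_all add: c_def norm_divide field_simps power2_eq_square)
  have "cmod \<langle>u, v\<rangle> = inner (c *\<^sub>C u) v"
    by (simp add: inner_eq_Re_cinner cinner_scaleC_left c(2))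
  also have "\<dots> \<le> norm u * norm v"
    using norm_cauchy_schwarz[of "c *\<^sub>C u" v] by (simp add: norm_scaleC c(1))
  finally show ?thesis .
qed simp

interpretation cinner: bounded_bilinear "cinner :: 'a :: complex_inner \<Rightarrow> 'a \<Rightarrow> complex"
proof
  show "\<exists>K. \<forall>a b :: 'a. norm \<langle>a, b\<rangle> \<le> norm a * norm b * K"
    by (intro exI[of _ 1]) (simp add: cinner_cauchy_schwarz)
qed (simp_all add: cinner_add_left cinner_add_right cinner_scaleR_left cinner_scaleR_right
       scaleR_conv_of_real)

lemma cinner_self_eq_0: "\<langle>x, x\<rangle> = 0 \<longleftrightarrow> x = 0" for x :: "'a :: complex_inner"
  by (simp add: cinner_self)

lemma cinner_ext_right: "(\<And>z. \<langle>x, z\<rangle> = \<langle>y, z\<rangle>) \<Longrightarrow> x = y" for x :: "'a :: complex_inner"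
  by (metis cinner.diff_left cinner_self_eq_0 eq_iff_diff_eq_0)

lemma cinner_ext_left: "(\<And>z. \<langle>z, x\<rangle> = \<langle>z, y\<rangle>) \<Longrightarrow> x = y" for x :: "'a :: complex_inner"
  by (metis cinner_commute cinner_ext_right)

lemma clinear_iff: "clinear f \<longleftrightarrow> (\<forall>x y. f (x + y) = f x + f y) \<and> (\<forall>c x. f (c *\<^sub>C x) = c *\<^sub>C f x)"
  by (simp add: Vector_Spaces.linear_iff complex_vector.vector_space_axioms)

lemma clinear_scaleC: "clinear f \<Longrightarrow> f (c *\<^sub>C x) = c *\<^sub>C f x"
  by (simp add: clinear_iff)

section \<open>Orthogonal projection in finite powers of a Hilbert space\<close>

lemma sum_norm_parallelogram:
  fixes f g :: "'i \<Rightarrow> 'a :: real_inner"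
  shows "(\<Sum>i\<in>I. (norm (f i + g i))\<^sup>2) + (\<Sum>i\<in>I. (norm (f i - g i))\<^sup>2) =
    2 * (\<Sum>i\<in>I. (norm (f i))\<^sup>2) + 2 * (\<Sum>i\<in>I. (norm (g i))\<^sup>2)"
  by (simp add: power2_norm_eq_inner inner_add inner_diff inner_commute sum_distrib_left algebra_simps
      flip: sum.distrib sum_subtractf)

text \<open>A minimising sequence for the squared distance to \<open>t\<close> is Cauchy by the
  parallelogram law, since the midpoint of two of its members stays in \<open>W\<close>. Only the
  coordinates in \<open>I\<close> are measured and \<open>W\<close> need not be closed, so
  \<open>p\<close> is described by approximation on \<open>I\<close> and not by membership.\<close>

lemma exists_projection:
  fixes W :: "('i \<Rightarrow> 'a :: {real_inner, complete_space}) set"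
  assumes "finite I" and W: "subspace W"
  obtains p where "\<And>e. e > 0 \<Longrightarrow> \<exists>w\<in>W. \<forall>i\<in>I. norm (p i - w i) < e"
    and "\<And>w. w \<in> W \<Longrightarrow> (\<Sum>i\<in>I. inner (w i) (t i - p i)) = 0"
proof -
  define Q :: "('i \<Rightarrow> 'a) \<Rightarrow> real" where "Q f = (\<Sum>i\<in>I. (norm (f i))\<^sup>2)" for f
  have Q0: "Q f \<ge> 0" for f by (simp add: Q_def sum_nonneg)
  define d where "d = Inf ((\<lambda>w. Q (t - w)) ` W)"
  have W0: "0 \<in> W" using W by (rule subspace_0)
  have bdd: "bdd_below ((\<lambda>w. Q (t - w)) ` W)" using Q0 by (auto intro!: bdd_belowI)
  have d_le: "d \<le> Q (t - w)" if "w \<in> W" for w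
    unfolding d_def by (rule cInf_lower) (use bdd that in auto)
  have "\<exists>w\<in>W. Q (t - w) < d + 1 / real (Suc n)" for n
    using cInf_lessD[of "(\<lambda>w. Q (t - w)) ` W" "d + 1 / real (Suc n)"] W0 by (auto simp: d_def)
  then obtain w where w: "\<And>n. w n \<in> W" "\<And>n. Q (t - w n) < d + 1 / real (Suc n)" by metis
  have Qdiff: "Q (w m - w n) \<le> 2 / real (Suc m) + 2 / real (Suc n)" for m n
  proof -
    have "Q (w m - w n) + Q (2 *\<^sub>R (t - (1/2) *\<^sub>R (w m + w n))) = 2 * Q (t - w m) + 2 * Q (t - w n)"
      using sum_norm_parallelogram[of "t - w n" "t - w m" I]
      by (simp add: Q_def scaleR_fun_def algebra_simps scaleR_2)
    moreover have "Q (2 *\<^sub>R f) = 4 * Q f" for f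
      by (simp add: Q_def scaleR_fun_def power_mult_distrib sum_distrib_left)
    moreover have "d \<le> Q (t - (1/2) *\<^sub>R (w m + w n))"
      by (intro d_le subspace_scale subspace_add W w)
    ultimately show ?thesis using w(2)[of m] w(2)[of n] by simp
  qed
  have comp: "norm (f i) \<le> sqrt (Q f)" if "i \<in> I" for f i
    using member_le_sum[of i I "\<lambda>i. (norm (f i))\<^sup>2"] that assms(1)
    by (auto simp: Q_def intro: real_le_rsqrt)
  have "convergent (\<lambda>n. w n i)" if "i \<in> I" for i
  proof (rule Cauchy_convergent, rule CauchyI')
    fix e :: real assume "e > 0"
    obtain N where N: "1 / real (Suc N) < e\<^sup>2 / 4"
      using nat_approx_posE[of "e\<^sup>2 / 4"] \<open>e > 0\<close> by auto
    show "\<exists>M. \<forall>m\<ge>M. \<forall>n>m. dist (w m i) (w n i) < e"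
    proof (intro exI allI impI)
      fix m n assume mn: "m \<ge> N" "n > m"
      have "2 / real (Suc m) \<le> 2 / real (Suc N)" "2 / real (Suc n) \<le> 2 / real (Suc N)"
        using mn by (auto intro!: divide_left_mono)
      then have "Q (w m - w n) < e\<^sup>2"
        using Qdiff[of m n] N by simp
      then have "sqrt (Q (w m - w n)) < e"
        using \<open>e > 0\<close> real_less_lsqrt by force
      then show "dist (w m i) (w n i) < e"
        using comp[OF that, of "w m - w n"] by (simp add: dist_norm)
    qed
  qed
  then obtain p where p: "\<And>i. i \<in> I \<Longrightarrow> (\<lambda>n. w n i) \<longlonglongrightarrow> p i"
    unfolding convergent_def by metis
  have "\<exists>v\<in>W. \<forall>i\<in>I. norm (p i - v i) < e" if "e > 0" for e
  proof -
    have "\<forall>\<^sub>F n in sequentially. \<forall>i\<in>I. dist (w n i) (p i) < e"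
      using assms(1) p that by (intro eventually_ball_finite) (auto dest: tendstoD)
    then obtain n where "\<forall>i\<in>I. dist (w n i) (p i) < e"
      using eventually_happens'[OF sequentially_bot] by blast
    then show ?thesis using w(1)[of n] by (intro bexI[of _ "w n"]) (auto simp: dist_norm norm_minus_commute)
  qed
  moreover have "(\<Sum>i\<in>I. inner (v i) (t i - p i)) = 0" if v: "v \<in> W" for v
  proof -
    define k where "k = (\<Sum>i\<in>I. inner (v i) (t i - p i))"
    have lim: "(\<lambda>n. Q (t - (w n + s *\<^sub>R v))) \<longlonglongrightarrow> Q (t - (p + s *\<^sub>R v))" for s
      unfolding Q_def by (auto intro!: tendsto_intros p)
    have "(\<lambda>n. d + 1 / real (Suc n)) \<longlonglongrightarrow> d + 0"
      by (intro tendsto_intros LIMSEQ_Suc lim_1_over_n)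
    then have up: "Q (t - p) \<le> d"
      using LIMSEQ_le[OF lim[of 0], of "\<lambda>n. d + 1 / real (Suc n)" d] w(2) less_imp_le by auto
    have ineq: "0 \<le> - 2 * s * k + s\<^sup>2 * Q v" for s
    proof -
      have "d \<le> Q (t - (p + s *\<^sub>R v))"
        by (rule LIMSEQ_le_const[OF lim])
          (auto intro!: d_le subspace_add subspace_scale W w v)
      also have "\<dots> = Q (t - p) - 2 * s * k + s\<^sup>2 * Q v"
      proof -
        have "(norm (t i - (p i + s *\<^sub>R v i)))\<^sup>2
            = (norm (t i - p i))\<^sup>2 - 2 * s * inner (v i) (t i - p i) + s\<^sup>2 * (norm (v i))\<^sup>2" for i
          unfolding power2_norm_eq_inner
          by (simp add: inner_diff inner_add inner_commute algebra_simps) (simp add: power2_eq_square)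
        then show ?thesis
          by (simp add: Q_def k_def scaleR_fun_def sum.distrib sum_subtractf sum_distrib_left)
      qed
      finally show ?thesis using up by simp
    qed
    have "k = 0"
    proof (rule ccontr)
      assume "k \<noteq> 0"
      \<comment> \<open>The quadratic in \<open>s\<close> is smallest near \<open>k / Q v\<close>;
        the \<open>+ 1\<close> guards against \<open>Q v = 0\<close> and still yields a negative
        value.\<close>
      define s where "s = k / (Q v + 1)"
      have pos: "Q v + 1 > 0" using Q0[of v] by simp
      have "s * (Q v + 1) = k" using pos by (simp add: s_def)
      then have "s * (s * (Q v + 1)) = s * k" by simp
      then have "s\<^sup>2 * Q v = s * k - s\<^sup>2" by (simp add: power2_eq_square algebra_simps)
      then have "s * k + s\<^sup>2 \<le> 0" using ineq[of s] by (simp add: algebra_simps)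
      moreover have "s * k > 0" using \<open>k \<noteq> 0\<close> pos by (simp add: s_def flip: power2_eq_square)
      ultimately show False using zero_le_power2[of s] by linarith
    qed
    then show ?thesis by (simp add: k_def)
  qed
  ultimately show ?thesis using that by blast
qed

instance complex_hilbert_space \<subseteq> banach ..

section \<open>Riesz representation and adjoints\<close>

lemma Re_cinner_imp_cinner_eq_0:
  assumes "\<And>c. Re \<langle>c *\<^sub>C w, z\<rangle> = 0" shows "\<langle>w, z\<rangle> = 0"
  using assms[of 1] assms[of \<i>] by (simp add: cinner_scaleC_left complex_eq_iff)

lemma riesz_representation:
  fixes f :: "'a :: complex_hilbert_space \<Rightarrow> complex"
  assumes "bounded_linear f" and scale: "\<And>c x. f (c *\<^sub>C x) = c * f x"
  obtains z where "\<And>v. f v = \<langle>v, z\<rangle>"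
proof (cases "\<exists>t. f t \<noteq> 0")
  case False
  then show ?thesis using that[of 0] by (simp add: cinner.zero_right)
next
  case True
  interpret f: bounded_linear f by fact
  obtain t where t: "f t \<noteq> 0" using True by blast
  \<comment> \<open>With \<open>unit\<close> as index type the finite power is the space itself, and
    \<open>W\<close> is the kernel of \<open>f\<close>.\<close>
  define W where "W = {w :: unit \<Rightarrow> 'a. f (w ()) = 0}"
  have "subspace W"
    by (auto simp: W_def subspace_def f.add f.scaleR scaleR_fun_def)
  from exists_projection[OF finite this, of UNIV "\<lambda>_. t"]
  obtain p where p: "\<And>e. e > 0 \<Longrightarrow> \<exists>w\<in>W. norm (p () - w ()) < e"
    and orth: "\<And>w. w \<in> W \<Longrightarrow> inner (w ()) (t - p ()) = 0"
    by (auto simp: UNIV_unit)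
  obtain K where K: "K > 0" "\<And>x. norm (f x) \<le> norm x * K" using f.pos_bounded by blast
  have "norm (f (p ())) \<le> e" if "e > 0" for e
  proof -
    obtain w where w: "w \<in> W" "norm (p () - w ()) < e / K" using p[of "e / K"] \<open>e > 0\<close> K by auto
    have "f (p ()) = f (p () - w ())" using w by (simp add: W_def f.diff)
    then show ?thesis using K(2)[of "p () - w ()"] w(2) K(1) by (simp add: field_simps)
  qed
  then have fp: "f (p ()) = 0" using field_le_epsilon[of "norm (f (p ()))" 0] by auto
  define z where "z = t - p ()"
  have fz: "f z \<noteq> 0" using t fp by (simp add: z_def f.diff)
  have "\<langle>w, z\<rangle> = 0" if "f w = 0" for w
    by (rule Re_cinner_imp_cinner_eq_0)
      (use orth[of "\<lambda>_. _ *\<^sub>C w"] that in \<open>simp add: W_def scale z_def inner_eq_Re_cinner\<close>)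
  then have "\<langle>f z *\<^sub>C v - f v *\<^sub>C z, z\<rangle> = 0" for v
    by (simp add: f.diff scale)
  then have *: "f z * \<langle>v, z\<rangle> = f v * \<langle>z, z\<rangle>" for v
    by (simp add: cinner.diff_left cinner_scaleC_left)
  have "z \<noteq> 0" using fz f.zero by auto
  then have "f v = \<langle>v, cnj (f z / \<langle>z, z\<rangle>) *\<^sub>C z\<rangle>" for v
    using *[of v] by (simp add: cinner_scaleC_right cinner_self_eq_0 field_simps)
  then show ?thesis by (rule that)
qed

lemma hadjoint_linear:
  fixes V :: "'a :: complex_hilbert_space \<Rightarrow> 'b :: complex_hilbert_space"
  assumes "clinear V" "bounded_linear V"
  shows "\<langle>hadjoint V w, y\<rangle> = \<langle>w, V y\<rangle>"
proof -
  interpret V: bounded_linear V by fact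
  have "\<exists>z. \<forall>y. \<langle>z, y\<rangle> = \<langle>w, V y\<rangle>" for w
  proof -
    have "bounded_linear (\<lambda>y. \<langle>V y, w\<rangle>)"
      by (rule bounded_linear_compose[OF cinner.bounded_linear_left assms(2)])
    then obtain z where "\<And>v. \<langle>V v, w\<rangle> = \<langle>v, z\<rangle>"
      by (rule riesz_representation) (simp_all add: clinear_scaleC[OF assms(1)] cinner_scaleC_left)
    then show ?thesis by (metis cinner_commute)
  qed
  then obtain W where W: "\<forall>w y. \<langle>W w, y\<rangle> = \<langle>w, V y\<rangle>" by metis
  have "adjoint_linear V = W"
    unfolding adjoint_linear_def
    by (rule the_equality, rule W) (use W in \<open>metis cinner_ext_right ext\<close>)
  then show ?thesis using W assms(1) by (simp add: hadjoint_def)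
qed

text \<open>\<open>hadjoint\<close> tests for linearity first, so a map of both kinds gets the
  linear adjoint; such a map is zero, and the identity holds for it as well.\<close>

lemma hadjoint_antilinear:
  fixes V :: "'a :: complex_hilbert_space \<Rightarrow> 'b :: complex_hilbert_space"
  assumes "antilinear V" "bounded_linear V"
  shows "\<langle>hadjoint V w, y\<rangle> = \<langle>V y, w\<rangle>"
proof (cases "clinear V")
  case True
  have "\<i> *\<^sub>C V x = cnj \<i> *\<^sub>C V x" for x
    using clinear_scaleC[OF True, of \<i> x] assms(1) by (simp add: antilinear_def)
  then have "(\<i> - cnj \<i>) *\<^sub>C V x = 0" for x
    by (simp only: complex_vector.scale_left_diff_distrib) simp
  then have "V x = 0" for x by (simp add: complex_vector.scale_eq_0_iff complex_eq_iff)
  then show ?thesis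
    using hadjoint_linear[OF True assms(2)] by (simp add: cinner.zero_left cinner.zero_right)
next
  case False
  interpret V: bounded_linear V by fact
  have "\<exists>z. \<forall>y. \<langle>z, y\<rangle> = \<langle>V y, w\<rangle>" for w
  proof -
    have "bounded_linear (\<lambda>y. \<langle>w, V y\<rangle>)"
      by (rule bounded_linear_compose[OF cinner.bounded_linear_right assms(2)])
    then obtain z where "\<And>v. \<langle>w, V v\<rangle> = \<langle>v, z\<rangle>"
      by (rule riesz_representation) (use assms(1) in \<open>simp_all add: antilinear_def cinner_scaleC_right\<close>)
    then show ?thesis by (metis cinner_commute)
  qed
  then obtain W where W: "\<forall>w y. \<langle>W w, y\<rangle> = \<langle>V y, w\<rangle>" by metis
  have "adjoint_antilinear V = W"
    unfolding adjoint_antilinear_def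
    by (rule the_equality, rule W) (use W in \<open>metis cinner_ext_right ext\<close>)
  then show ?thesis using W False by (simp add: hadjoint_def)
qed

text \<open>In the real inner product the defining identities of the linear and the conjugate-linear
  adjoint coincide, so one bound serves both.\<close>

lemma bounded_linear_adjoint:
  fixes V :: "'a :: real_inner \<Rightarrow> 'b :: real_inner"
  assumes "bounded_linear V" and W: "\<And>w y. inner (W w) y = inner w (V y)"
  shows "bounded_linear W"
proof -
  obtain K where K: "K > 0" "\<And>x. norm (V x) \<le> norm x * K"
    using bounded_linear.pos_bounded[OF assms(1)] by blast
  show ?thesis
  proof (rule bounded_linear_intro)
    fix x y r
    show "W (x + y) = W x + W y" "W (r *\<^sub>R x) = r *\<^sub>R W x"
      by (rule vector_eq_rdot[THEN iffD1]; simp add: W inner_add_left)+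
    have "(norm (W x))\<^sup>2 = inner x (V (W x))" by (simp add: power2_norm_eq_inner W)
    also have "\<dots> \<le> norm x * (norm (W x) * K)"
      by (rule order_trans[OF norm_cauchy_schwarz]) (intro mult_left_mono K norm_ge_zero)
    finally show "norm (W x) \<le> norm x * K"
      by (cases "norm (W x) = 0") (use K in \<open>simp_all add: power2_eq_square\<close>)
  qed
qed

lemma bounded_linear_hadjoint:
  assumes "clinear V \<or> antilinear V" "bounded_linear V"
  shows "bounded_linear (hadjoint V)"
proof (rule bounded_linear_adjoint[OF assms(2)])
  show "inner (hadjoint V w) y = inner w (V y)" for w y
    using assms hadjoint_linear[of V w y] hadjoint_antilinear[of V w y]
    by (metis inner_commute inner_eq_Re_cinner)
qed

section \<open>Irreducible algebras\<close>

locale irreducible_algebra =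
  fixes A :: "('a :: complex_hilbert_space \<Rightarrow>\<^sub>L 'a) set"
  assumes irreducible: "irreducible_cstar A"
begin

lemma cstar: "cstar_subalgebra A" and nontrivial: "A \<noteq> {0}"
  using irreducible by (simp_all add: irreducible_cstar_def)

lemma subsp: "complex_vector.subspace A" and closed_A: "closed A"
  and comp: "\<lbrakk>S \<in> A; T \<in> A\<rbrakk> \<Longrightarrow> S o\<^sub>L T \<in> A"
  and clinear_A: "T \<in> A \<Longrightarrow> clinear (blinfun_apply T)"
  using cstar by (simp_all add: cstar_subalgebra_def)

lemma zero: "0 \<in> A" and add: "\<lbrakk>S \<in> A; T \<in> A\<rbrakk> \<Longrightarrow> S + T \<in> A"
  and diff: "\<lbrakk>S \<in> A; T \<in> A\<rbrakk> \<Longrightarrow> S - T \<in> A" and scaleC: "T \<in> A \<Longrightarrow> c *\<^sub>C T \<in> A"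
  using subsp complex_vector.subspace_0 complex_vector.subspace_add complex_vector.subspace_diff
    complex_vector.subspace_scale by blast+

lemma scaleR: "T \<in> A \<Longrightarrow> r *\<^sub>R T \<in> A"
  by (simp add: scaleR_scaleC scaleC)

lemma apply_scaleC: "T \<in> A \<Longrightarrow> T (c *\<^sub>C x) = c *\<^sub>C T x"
  using clinear_A clinear_scaleC by blast

lemma adjoint:
  assumes "T \<in> A"
  obtains T' where "T' \<in> A" "\<And>u v. \<langle>T u, v\<rangle> = \<langle>u, T' v\<rangle>" "\<And>u v. \<langle>T' u, v\<rangle> = \<langle>u, T v\<rangle>"
proof
  have lin: "clinear (blinfun_apply T)" "bounded_linear (blinfun_apply T)"
    using assms clinear_A blinfun.bounded_linear_right by auto
  show "Blinfun (hadjoint T) \<in> A" using assms cstar by (simp add: cstar_subalgebra_def)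
  show *: "\<langle>Blinfun (hadjoint T) u, v\<rangle> = \<langle>u, T v\<rangle>" for u v
    using bounded_linear_hadjoint[of T] lin
    by (simp add: bounded_linear_Blinfun_apply hadjoint_linear)
  show "\<langle>T u, v\<rangle> = \<langle>u, Blinfun (hadjoint T) v\<rangle>" for u v
    using *[of v u] by (metis cinner_commute)
qed

lemma invariant_subspace:
  assumes "complex_vector.subspace M" "closed M" "\<And>T x. \<lbrakk>T \<in> A; x \<in> M\<rbrakk> \<Longrightarrow> T x \<in> M"
  shows "M = {0} \<or> M = UNIV"
  using irreducible assms by (auto simp: irreducible_cstar_def image_subset_iff)

text \<open>The common null space is closed and invariant, and it is proper because \<open>A\<close>
  contains a nonzero operator. This takes over the role of a unit in \<open>density\<close>.\<close>

lemma nondegenerate: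
  assumes "\<And>T. T \<in> A \<Longrightarrow> T x = 0" shows "x = 0"
proof -
  define M where "M = {x. \<forall>T\<in>A. T x = 0}"
  have "M = (\<Inter>T\<in>A. {x. blinfun_apply T x = 0})" by (auto simp: M_def)
  moreover have "closed {x. T x = 0}" for T :: "'a \<Rightarrow>\<^sub>L 'a"
    by (intro closed_Collect_eq continuous_intros)
  ultimately have "closed M" by auto
  moreover have "complex_vector.subspace M"
    by (auto simp: M_def complex_vector.subspace_def blinfun.zero_right blinfun.add_right apply_scaleC)
  ultimately have "M = {0} \<or> M = UNIV"
    using invariant_subspace[of M] by (auto simp: M_def blinfun.zero_right)
  moreover have "M \<noteq> UNIV"
  proof
    assume "M = UNIV"
    then have "T = 0" if "T \<in> A" for T
      using that by (intro blinfun_eqI) (auto simp: M_def)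
    then show False using nontrivial zero by auto
  qed
  ultimately show ?thesis using assms by (auto simp: M_def)
qed

end

section \<open>Square roots and Schur's lemma\<close>

interpretation blinfun_compose: bounded_bilinear
  "(o\<^sub>L) :: ('b :: real_normed_vector \<Rightarrow>\<^sub>L 'c :: real_normed_vector) \<Rightarrow> ('a :: real_normed_vector \<Rightarrow>\<^sub>L 'b) \<Rightarrow> _"
  by (rule bounded_bilinear_blinfun_compose)

lemma blinfun_compose_assoc: "(R o\<^sub>L S) o\<^sub>L T = R o\<^sub>L (S o\<^sub>L T)"
  by (rule blinfun_eqI) simp

lemma norm_blinfun_square_diff:
  fixes P Q :: "'a :: real_normed_vector \<Rightarrow>\<^sub>L 'a"
  shows "norm ((P o\<^sub>L P) - (Q o\<^sub>L Q)) \<le> (norm P + norm Q) * norm (P - Q)"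
proof -
  have "(P o\<^sub>L P) - (Q o\<^sub>L Q) = (P o\<^sub>L (P - Q)) + ((P - Q) o\<^sub>L Q)"
    by (rule blinfun_eqI) (simp add: blinfun.diff_left blinfun.diff_right blinfun.add_left)
  also have "norm \<dots> \<le> norm P * norm (P - Q) + norm (P - Q) * norm Q"
    by (intro order_trans[OF norm_triangle_ineq] add_mono norm_blinfun_compose)
  finally show ?thesis by (simp add: algebra_simps)
qed

text \<open>The operator \<open>id - Y\<close> is a square root of \<open>id - X\<close>. The iteration for \<open>Y\<close> is dominated in
  norm by the same iteration for the number \<open>1\<close>, which increases to \<open>1\<close>.\<close>

lemma exists_sqrt:
  fixes X :: "'a :: banach \<Rightarrow>\<^sub>L 'a"
  assumes X: "norm X \<le> 1"
  obtains Y where "norm Y \<le> 1" "Y + Y = X + (Y o\<^sub>L Y)"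
    "\<And>T. T o\<^sub>L X = X o\<^sub>L T \<Longrightarrow> T o\<^sub>L Y = Y o\<^sub>L T"
proof -
  \<comment> \<open>\<open>(id - Y)^2 = id - X\<close> is the same as
    \<open>Y = (X + Y^2) / 2\<close>, which is iterated from \<open>0\<close>. The iterates are
    polynomials in \<open>X\<close>, so the limit inherits the commutation relations of
    \<open>X\<close>.\<close>
  define Y where "Y = rec_nat 0 (\<lambda>_ Z. (1/2) *\<^sub>R (X + (Z o\<^sub>L Z)))"
  have Y: "Y 0 = 0" "Y (Suc n) = (1/2) *\<^sub>R (X + (Y n o\<^sub>L Y n))" for n by (simp_all add: Y_def)
  define y where "y = rec_nat 0 (\<lambda>_ z. (1 + z\<^sup>2) / 2 :: real)"
  have y: "y 0 = 0" "y (Suc n) = (1 + (y n)\<^sup>2) / 2" for n by (simp_all add: y_def)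
  have y01: "0 \<le> y n \<and> y n \<le> 1" for n
    by (induction n) (auto simp: y power_le_one)
  have nY: "norm (Y n) \<le> y n" for n
  proof (induction n)
    case (Suc n)
    have "norm (X + (Y n o\<^sub>L Y n)) \<le> norm X + norm (Y n) * norm (Y n)"
      by (intro order_trans[OF norm_triangle_ineq] add_mono norm_blinfun_compose order_refl)
    also have "\<dots> \<le> 1 + y n * y n" using X Suc y01[of n] by (intro add_mono mult_mono) auto
    finally show ?case by (simp add: Y y power2_eq_square)
  qed (simp add: Y y)
  have step: "norm (Y (Suc n) - Y n) \<le> y (Suc n) - y n" for n
  proof (induction n)
    case 0 show ?case using X by (simp add: Y y)
  next
    case (Suc n)
    have "Y (Suc (Suc n)) - Y (Suc n) = (1/2) *\<^sub>R ((Y (Suc n) o\<^sub>L Y (Suc n)) - (Y n o\<^sub>L Y n))"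
      using Y(2)[of "Suc n"] Y(2)[of n] by (simp add: algebra_simps)
    then have "norm (Y (Suc (Suc n)) - Y (Suc n)) \<le>
        (norm (Y (Suc n)) + norm (Y n)) * norm (Y (Suc n) - Y n) / 2"
      using norm_blinfun_square_diff[of "Y (Suc n)" "Y n"] by simp
    also have "\<dots> \<le> (y (Suc n) + y n) * (y (Suc n) - y n) / 2"
      using Suc nY y01 by (intro divide_right_mono mult_mono add_mono) (auto intro: add_nonneg_nonneg)
    also have "\<dots> = y (Suc (Suc n)) - y (Suc n)"
      by (simp only: y(2)[of "Suc n"]) (simp add: y(2)[of n] power2_eq_square field_simps)
    finally show ?case .
  qed
  have dist_le: "norm (Y (n + k) - Y n) \<le> y (n + k) - y n" for n k
  proof (induction k)
    case (Suc k)
    have "norm (Y (n + Suc k) - Y n) \<le> norm (Y (Suc (n + k)) - Y (n + k)) + norm (Y (n + k) - Y n)"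
      using norm_triangle_ineq[of "Y (Suc (n + k)) - Y (n + k)" "Y (n + k) - Y n"] by simp
    then show ?case using step[of "n + k"] Suc by simp
  qed simp
  have "y n \<le> y (Suc n)" for n using step[of n] norm_ge_zero[of "Y (Suc n) - Y n"] by linarith
  then have "incseq y" by (rule incseq_SucI)
  then have "convergent y"
    using y01 by (metis incseq_convergent convergent_def)
  then have Cauchy_y: "Cauchy y" by (rule convergent_Cauchy)
  have "Cauchy Y"
  proof (rule CauchyI')
    fix e :: real assume "e > 0"
    then obtain M where M: "\<And>m n. m \<ge> M \<Longrightarrow> n \<ge> M \<Longrightarrow> norm (y m - y n) < e"
      using CauchyD[OF Cauchy_y] by blast
    have "dist (Y m) (Y n) < e" if "m \<ge> M" "n > m" for m n
      using dist_le[of m "n - m"] M[of n m] that by (simp add: dist_norm norm_minus_commute)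
    then show "\<exists>M. \<forall>m\<ge>M. \<forall>n>m. dist (Y m) (Y n) < e" by blast
  qed
  then obtain Z where Z: "Y \<longlonglongrightarrow> Z" using Cauchy_convergent by (auto simp: convergent_def)
  show ?thesis
  proof
    have "norm (Y n) \<le> 1" for n using nY[of n] y01[of n] by linarith
    then show "norm Z \<le> 1" by (intro LIMSEQ_le_const2[OF tendsto_norm[OF Z]]) blast
    have "(\<lambda>n. 2 *\<^sub>R Y (Suc n)) \<longlonglongrightarrow> 2 *\<^sub>R Z"
      by (intro tendsto_intros LIMSEQ_Suc Z)
    moreover have "(\<lambda>n. 2 *\<^sub>R Y (Suc n)) \<longlonglongrightarrow> X + (Z o\<^sub>L Z)"
      unfolding Y(2) by (simp, intro tendsto_intros blinfun_compose.tendsto Z)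
    ultimately show "Z + Z = X + (Z o\<^sub>L Z)" by (simp add: LIMSEQ_unique flip: scaleR_2)
    fix T assume T: "T o\<^sub>L X = X o\<^sub>L T"
    have "T o\<^sub>L Y n = Y n o\<^sub>L T" for n
    proof (induction n)
      case (Suc n)
      have "T o\<^sub>L (Y n o\<^sub>L Y n) = (Y n o\<^sub>L Y n) o\<^sub>L T"
        using Suc by (metis blinfun_compose_assoc)
      then show ?case using T
        by (simp add: Y blinfun_compose.add_left blinfun_compose.add_right
            blinfun_compose.scaleR_left blinfun_compose.scaleR_right)
    qed (simp add: Y)
    moreover have "(\<lambda>n. T o\<^sub>L Y n) \<longlonglongrightarrow> (T o\<^sub>L Z)" "(\<lambda>n. Y n o\<^sub>L T) \<longlonglongrightarrow> (Z o\<^sub>L T)"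
      by (intro blinfun_compose.tendsto Z tendsto_const)+
    ultimately show "T o\<^sub>L Z = Z o\<^sub>L T" using LIMSEQ_unique by simp
  qed
qed

context irreducible_algebra
begin

text \<open>With \<open>N\<close> the square root of \<open>S\<^sup>2\<close>, the operators \<open>N + S\<close> and \<open>N - S\<close> have product \<open>0\<close>
  and lie in the commutant, so irreducibility makes one of them vanish.\<close>

lemma commutant_definite:
  assumes lin: "clinear (blinfun_apply S)" and sym: "\<And>x y. inner (S x) y = inner x (S y)"
    and comm: "\<And>T x. T \<in> A \<Longrightarrow> S (T x) = T (S x)"
  shows "(\<forall>x. inner (S x) x \<ge> 0) \<or> (\<forall>x. inner (S x) x \<le> 0)"
proof -
  \<comment> \<open>The scaling makes \<open>S1\<close> a contraction, hence also
    \<open>id - S1^2\<close>, and keeps the sign of the quadratic form.\<close>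
  define S1 where "S1 = (1 / (1 + norm S)) *\<^sub>R S"
  have pos: "1 + norm S > 0" by (simp add: add_pos_nonneg)
  have nS1: "norm (S1 x) \<le> norm x" for x
  proof -
    have "norm S1 \<le> 1" using pos by (simp add: S1_def field_simps)
    then have "norm S1 * norm x \<le> norm x" by (simp add: mult_left_le_one_le)
    then show ?thesis using norm_blinfun[of S1 x] by linarith
  qed
  have S1: "S1 x = (1 / (1 + norm S)) *\<^sub>R S x" for x by (simp add: S1_def blinfun.scaleR_left)
  have sym1: "inner (S1 x) y = inner x (S1 y)" for x y by (simp add: S1 sym)
  \<comment> \<open>Operators of this type are only real-linear. Commutation with multiplication by
    \<open>\<i>\<close> makes the square root complex-linear, so that \<open>M\<close> below is a
    complex subspace.\<close>
  define J :: "'a \<Rightarrow>\<^sub>L 'a" where "J = \<i> *\<^sub>C id_blinfun"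
  have J: "J x = \<i> *\<^sub>C x" for x by (simp add: J_def scaleC_blinfun.rep_eq)
  define X where "X = id_blinfun - (S1 o\<^sub>L S1)"
  have X: "X x = x - S1 (S1 x)" for x by (simp add: X_def blinfun.diff_left)
  have "norm X \<le> 1"
  proof (rule norm_blinfun_bound)
    fix x
    have "(norm (X x))\<^sup>2 = (norm x)\<^sup>2 - 2 * (norm (S1 x))\<^sup>2 + (norm (S1 (S1 x)))\<^sup>2"
      by (simp add: X power2_norm_eq_inner inner_diff inner_commute sym1[of x "S1 x", symmetric])
    also have "\<dots> \<le> (norm x)\<^sup>2"
      using power_mono[OF nS1[of "S1 x"] norm_ge_zero, of 2] zero_le_power2[of "norm (S1 x)"] by linarith
    finally show "norm (X x) \<le> 1 * norm x" by (simp add: power2_le_iff_abs_le)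
  qed simp
  then obtain Y where Y: "norm Y \<le> 1" "Y + Y = X + (Y o\<^sub>L Y)"
    and commY: "\<And>T. T o\<^sub>L X = X o\<^sub>L T \<Longrightarrow> T o\<^sub>L Y = Y o\<^sub>L T"
    by (rule exists_sqrt) blast
  have commY': "T (Y x) = Y (T x)" if "\<And>x. S1 (T x) = T (S1 x)" for T :: "'a \<Rightarrow>\<^sub>L 'a" and x
  proof -
    have "T o\<^sub>L X = X o\<^sub>L T" by (rule blinfun_eqI) (simp add: X blinfun.diff_right that)
    from arg_cong[OF commY[OF this], of "\<lambda>R. R x"] show ?thesis by simp
  qed
  define N where "N = id_blinfun - Y"
  have N: "N x = x - Y x" for x by (simp add: N_def blinfun.diff_left)
  have NN: "N (N x) = S1 (S1 x)" for x
    using arg_cong[OF Y(2), of "\<lambda>R. R x"]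
    by (simp add: N X blinfun.add_left blinfun.diff_right algebra_simps)
  have N_nonneg: "inner (N x) x \<ge> 0" for x
  proof -
    have "inner (Y x) x \<le> norm (Y x) * norm x" by (rule norm_cauchy_schwarz)
    also have "\<dots> \<le> norm Y * norm x * norm x" by (intro mult_right_mono norm_blinfun norm_ge_zero)
    also have "\<dots> \<le> norm x * norm x" by (intro mult_right_mono mult_left_le_one_le Y norm_ge_zero)
    finally show ?thesis by (simp add: N inner_diff power2_norm_eq_inner flip: power2_eq_square)
  qed
  have NS: "S1 (N x) = N (S1 x)" for x
    by (simp add: N commY' blinfun.diff_right)
  have NJ: "N (\<i> *\<^sub>C x) = \<i> *\<^sub>C N x" for x
  proof -
    have "J (Y x) = Y (J x)"
      by (rule commY') (simp add: J S1 clinear_scaleC[OF lin] scaleR_scaleC mult.commute)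
    then show ?thesis by (simp add: N J complex_vector.scale_right_diff_distrib)
  qed
  have Nc: "N (c *\<^sub>C x) = c *\<^sub>C N x" for c x
  proof -
    have c: "c *\<^sub>C z = Re c *\<^sub>R z + Im c *\<^sub>R \<i> *\<^sub>C z" for z :: 'a
      by (simp add: scaleR_scaleC complex_eq mult.commute flip: scaleC_add_left)
    show ?thesis unfolding c[of x] c[of "N x"] blinfun.add_right blinfun.scaleR_right NJ ..
  qed
  define M where "M = {x. N x + S1 x = 0}"
  have "closed M" unfolding M_def by (intro closed_Collect_eq continuous_intros)
  moreover have "complex_vector.subspace M"
  proof -
    have "S1 (c *\<^sub>C x) = c *\<^sub>C S1 x" for c x
      by (simp add: S1 clinear_scaleC[OF lin] scaleR_scaleC mult.commute)
    then have "N (c *\<^sub>C x) + S1 (c *\<^sub>C x) = c *\<^sub>C (N x + S1 x)" for c x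
      by (simp add: Nc scaleC_add_right)
    moreover have "N (x + y) + S1 (x + y) = (N x + S1 x) + (N y + S1 y)" for x y
      by (simp add: blinfun.add_right)
    ultimately show ?thesis
      by (simp add: M_def complex_vector.subspace_def blinfun.zero_right)
  qed
  moreover have "T x \<in> M" if "T \<in> A" "x \<in> M" for T x
  proof -
    have TS: "S1 (T y) = T (S1 y)" for y using that by (simp add: S1 comm blinfun.scaleR_right)
    have "T (Y x) = Y (T x)" by (rule commY') (rule TS)
    then have "N (T x) + S1 (T x) = T (N x + S1 x)"
      by (simp add: N TS blinfun.add_right blinfun.diff_right)
    then show ?thesis using that by (simp add: M_def blinfun.zero_right)
  qed
  ultimately consider "M = UNIV" | "M = {0}" using invariant_subspace[of M] by blast
  then have "(\<forall>x. inner (S1 x) x \<le> 0) \<or> (\<forall>x. inner (S1 x) x \<ge> 0)"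
  proof cases
    case 1
    then have "S1 x = - N x" for x by (auto simp: M_def eq_neg_iff_add_eq_0 add.commute)
    then show ?thesis using N_nonneg by simp
  next
    case 2
    have "N x - S1 x \<in> M" for x by (simp add: M_def blinfun.diff_right NN NS)
    then have "N x = S1 x" for x using 2 by auto
    then show ?thesis using N_nonneg by auto
  qed
  moreover have "inner (S x) x = (1 + norm S) * inner (S1 x) x" for x
    using pos by (simp add: S1)
  ultimately show ?thesis using pos by (auto simp: zero_le_mult_iff mult_le_0_iff)
qed

text \<open>Every \<open>S - r\<close> is again symmetric and in the commutant, hence semidefinite,
  so the quadratic form of \<open>S\<close> lies on one side of each multiple of the squared norm.
  At the supremum of the lower bounds it equals that multiple, and polarisation gives
  \<open>S\<close> itself.\<close>

lemma commutant_symmetric_scalar: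
  assumes lin: "clinear (blinfun_apply S)" and sym: "\<And>x y. inner (S x) y = inner x (S y)"
    and comm: "\<And>T x. T \<in> A \<Longrightarrow> S (T x) = T (S x)"
  obtains r where "\<And>x. S x = r *\<^sub>R x"
proof (cases "\<exists>x :: 'a. x \<noteq> 0")
  case False
  then show ?thesis using that[of 0] by (metis scale_zero_left)
next
  case True
  then obtain x0 :: 'a where "x0 \<noteq> 0" by blast
  have bound: "\<bar>inner (S x) x\<bar> \<le> norm S * (norm x)\<^sup>2" for x
    using order_trans[OF Cauchy_Schwarz_ineq2 mult_right_mono[OF norm_blinfun norm_ge_zero]]
    by (simp add: power2_eq_square mult.assoc)
  have split: "(\<forall>x. inner (S x) x \<ge> r * (norm x)\<^sup>2) \<or> (\<forall>x. inner (S x) x \<le> r * (norm x)\<^sup>2)" for r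
  proof -
    define D where "D = S - r *\<^sub>R id_blinfun"
    have D: "D x = S x - r *\<^sub>R x" for x by (simp add: D_def blinfun.diff_left blinfun.scaleR_left)
    have "clinear (blinfun_apply D)"
      using lin by (simp add: clinear_iff D scaleR_scaleC scaleC_add_right mult.commute
          complex_vector.scale_right_diff_distrib)
    moreover have "inner (D x) y = inner x (D y)" for x y by (simp add: D inner_diff sym)
    moreover have "D (T x) = T (D x)" if "T \<in> A" for T x
      using that by (simp add: D comm blinfun.diff_right blinfun.scaleR_right)
    ultimately have "(\<forall>x. inner (D x) x \<ge> 0) \<or> (\<forall>x. inner (D x) x \<le> 0)" by (rule commutant_definite)
    then show ?thesis by (simp add: D inner_diff power2_norm_eq_inner)
  qed
  define L where "L = {r. \<forall>x. inner (S x) x \<ge> r * (norm x)\<^sup>2}"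
  define r where "r = Sup L"
  have "- norm S \<in> L" using bound by (auto simp: L_def abs_le_iff minus_le_iff)
  then have ne: "L \<noteq> {}" by blast
  have "s \<le> norm S" if "s \<in> L" for s
  proof -
    have "s * (norm x0)\<^sup>2 \<le> norm S * (norm x0)\<^sup>2"
      using that bound[of x0] by (auto simp: L_def intro: order_trans)
    then show ?thesis using \<open>x0 \<noteq> 0\<close> by simp
  qed
  then have bdd: "bdd_above L" by (rule bdd_aboveI)
  have "inner (S x) x = r * (norm x)\<^sup>2" for x
  proof (rule antisym)
    show "r * (norm x)\<^sup>2 \<le> inner (S x) x"
    proof (rule field_le_epsilon)
      fix e :: real assume "e > 0"
      define d where "d = e / (1 + (norm x)\<^sup>2)"
      have d: "d > 0" "d * (norm x)\<^sup>2 \<le> e"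
        using \<open>e > 0\<close> by (auto simp: d_def field_simps add_pos_nonneg intro!: divide_pos_pos)
      obtain s where "s \<in> L" "r - d < s"
        using less_cSupD[OF ne, of "r - d"] d(1) by (auto simp: r_def)
      then have "s * (norm x)\<^sup>2 \<le> inner (S x) x" by (simp add: L_def)
      then have "(r - d) * (norm x)\<^sup>2 \<le> inner (S x) x"
        using mult_right_mono[of "r - d" s "(norm x)\<^sup>2"] \<open>r - d < s\<close> by simp
      then show "r * (norm x)\<^sup>2 \<le> inner (S x) x + e" using d(2) by (simp add: algebra_simps)
    qed
    show "inner (S x) x \<le> r * (norm x)\<^sup>2"
    proof (rule field_le_epsilon)
      fix e :: real assume "e > 0"
      define d where "d = e / (1 + (norm x)\<^sup>2)"
      have d: "d > 0" "d * (norm x)\<^sup>2 \<le> e"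
        using \<open>e > 0\<close> by (auto simp: d_def field_simps add_pos_nonneg intro!: divide_pos_pos)
      have "r + d \<notin> L" using cSup_upper[OF _ bdd, of "r + d"] d(1) by (auto simp: r_def)
      then have "inner (S x) x \<le> (r + d) * (norm x)\<^sup>2" using split[of "r + d"] by (auto simp: L_def)
      then show "inner (S x) x \<le> r * (norm x)\<^sup>2 + e" using d(2) by (simp add: algebra_simps)
    qed
  qed
  then have quad: "inner (S x - r *\<^sub>R x) x = 0" for x
    by (simp add: inner_diff power2_norm_eq_inner)
  have "inner (S x - r *\<^sub>R x) y = 0" for x y
    using quad[of "x + y"] quad[of x] quad[of y] sym[of x y]
    by (simp add: blinfun.add_right inner_diff inner_add inner_commute algebra_simps)
  then have "S x = r *\<^sub>R x" for x by (metis eq_iff_diff_eq_0 inner_eq_zero_iff)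
  then show ?thesis by (rule that)
qed

text \<open>\<open>P + Q\<close> and \<open>\<i> (P - Q)\<close> are symmetric and commute with
  \<open>A\<close>, hence are real scalars, and \<open>P\<close> is a combination of them. The
  adjoint \<open>Q\<close> is passed explicitly: in the application both operators are entries of
  one projection matrix.\<close>

lemma schur:
  assumes lin: "clinear (blinfun_apply P)" "clinear (blinfun_apply Q)"
    and adj: "\<And>x y. \<langle>P x, y\<rangle> = \<langle>x, Q y\<rangle>"
    and comm: "\<And>T x. T \<in> A \<Longrightarrow> P (T x) = T (P x)" "\<And>T x. T \<in> A \<Longrightarrow> Q (T x) = T (Q x)"
  obtains c where "\<And>x. P x = c *\<^sub>C x"
proof -
  have adj': "\<langle>Q x, y\<rangle> = \<langle>x, P y\<rangle>" for x y by (metis adj cinner_commute)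
  define S where "S = P + Q"
  define R where "R = \<i> *\<^sub>C (P - Q)"
  have S: "S x = P x + Q x" and R: "R x = \<i> *\<^sub>C (P x - Q x)" for x
    by (simp_all add: S_def R_def blinfun.add_left blinfun.diff_left scaleC_blinfun.rep_eq)
  have "clinear (blinfun_apply S)" "clinear (blinfun_apply R)"
    using lin by (auto simp: clinear_iff S R scaleC_add_right complex_vector.scale_right_diff_distrib
        mult.commute)
  moreover have "inner (S x) y = inner x (S y)" "inner (R x) y = inner x (R y)" for x y
    by (simp_all add: inner_eq_Re_cinner S R cinner.add_left cinner.add_right cinner.diff_left
        cinner.diff_right cinner_scaleC_left cinner_scaleC_right adj adj')
  moreover have "S (T x) = T (S x)" "R (T x) = T (R x)" if "T \<in> A" for T x
    using that by (simp_all add: S R comm blinfun.add_right blinfun.diff_right apply_scaleC)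
  ultimately obtain s r where "\<And>x. S x = s *\<^sub>R x" "\<And>x. R x = r *\<^sub>R x"
    by (metis commutant_symmetric_scalar)
  then have *: "P x + Q x = s *\<^sub>R x" "\<i> *\<^sub>C (P x - Q x) = r *\<^sub>R x" for x
    by (simp_all add: S R)
  have "P x = ((complex_of_real s - \<i> * complex_of_real r) / 2) *\<^sub>C x" for x
  proof -
    have "P x = (1/2) *\<^sub>C ((P x + Q x) + (- \<i>) *\<^sub>C \<i> *\<^sub>C (P x - Q x))"
      by (simp add: scaleC_one scaleC_scaleC flip: scaleC_add_left)
        (simp add: scaleC_one scaleC_add_right flip: scaleC_add_left)
    also have "\<dots> = ((complex_of_real s - \<i> * complex_of_real r) / 2) *\<^sub>C x"
      unfolding * scaleR_scaleC scaleC_scaleC scaleC_add_left[symmetric] by simp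
    finally show ?thesis .
  qed
  then show ?thesis by (rule that)
qed

end

section \<open>Density\<close>

definition sesquilinear :: "('a :: complex_vector \<Rightarrow> 'a \<Rightarrow> complex) \<Rightarrow> bool" where
  "sesquilinear b \<longleftrightarrow>
     (\<forall>x y z. b (x + y) z = b x z + b y z) \<and> (\<forall>c x z. b (c *\<^sub>C x) z = c * b x z) \<and>
     (\<forall>x y z. b z (x + y) = b z x + b z y) \<and> (\<forall>c x z. b z (c *\<^sub>C x) = cnj c * b z x)"

lemma sesquilinear_zero:
  assumes "sesquilinear b" shows "b 0 z = 0" "b z 0 = 0"
  using assms complex_vector.scale_zero_left[of 0] unfolding sesquilinear_def
  by (metis mult_zero_left complex_cnj_zero)+

lemma sesquilinear_sum:
  assumes "sesquilinear b"
  shows "b (\<Sum>i\<in>I. f i) z = (\<Sum>i\<in>I. b (f i) z)" "b z (\<Sum>i\<in>I. f i) = (\<Sum>i\<in>I. b z (f i))"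
  by (induction I rule: infinite_finite_induct;
      use assms sesquilinear_zero[OF assms] in \<open>simp add: sesquilinear_def\<close>)+

lemma sesquilinear_cinner:
  assumes "clinear f" shows "sesquilinear (\<lambda>u v. \<langle>f u, v\<rangle>)"
  using assms by (simp add: sesquilinear_def clinear_iff cinner.add_left cinner.add_right
      cinner_scaleC_left cinner_scaleC_right)

text \<open>Orthogonality passes to coordinatewise limits. A general bilinear map is allowed because
  both the complex and the real inner product occur.\<close>

lemma sum_bilinear_closure_eq_0:
  assumes "bounded_bilinear B" "finite I"
    and near: "\<And>e. e > 0 \<Longrightarrow> \<exists>w\<in>W. \<forall>i\<in>I. norm (q i - w i) < e"
    and orth: "\<And>w. w \<in> W \<Longrightarrow> (\<Sum>i\<in>I. B (w i) (z i)) = 0"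
  shows "(\<Sum>i\<in>I. B (q i) (z i)) = 0"
proof -
  interpret B: bounded_bilinear B by fact
  obtain K where K: "K > 0" "\<And>a b. norm (B a b) \<le> norm a * norm b * K"
    using B.pos_bounded by blast
  define M where "M = K * (\<Sum>i\<in>I. norm (z i)) + 1"
  have M: "M > 0" using K(1) by (auto simp: M_def intro!: add_nonneg_pos mult_nonneg_nonneg sum_nonneg)
  have "norm (\<Sum>i\<in>I. B (q i) (z i)) \<le> e" if "e > 0" for e
  proof -
    obtain w where w: "w \<in> W" "\<forall>i\<in>I. norm (q i - w i) < e / M" using near[of "e / M"] \<open>e > 0\<close> M by auto
    have "(\<Sum>i\<in>I. B (q i) (z i)) = (\<Sum>i\<in>I. B (q i - w i) (z i))"
      using orth[OF w(1)] by (simp add: B.diff_left sum_subtractf)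
    also have "norm \<dots> \<le> (\<Sum>i\<in>I. (e / M) * (K * norm (z i)))"
    proof (rule sum_norm_le)
      fix i assume i: "i \<in> I"
      have "norm (q i - w i) * (K * norm (z i)) \<le> (e / M) * (K * norm (z i))"
        using w(2) i K(1) by (intro mult_right_mono) (auto intro: less_imp_le)
      then show "norm (B (q i - w i) (z i)) \<le> (e / M) * (K * norm (z i))"
        using K(2)[of "q i - w i" "z i"] by (simp add: mult_ac)
    qed
    also have "\<dots> = (e / M) * (M - 1)" by (simp add: M_def sum_distrib_left)
    also have "\<dots> \<le> e" using M \<open>e > 0\<close> by (simp add: field_simps)
    finally show ?thesis .
  qed
  then show ?thesis using field_le_epsilon[of "norm (\<Sum>i\<in>I. B (q i) (z i))" 0] by auto
qed

context irreducible_algebra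
begin

text \<open>Double commutant argument: the matrix entries of the orthogonal projection onto the closure
  of \<open>{(a (x i))\<^sub>i | a \<in> A}\<close> lie in the commutant, hence are scalars \<open>l i j\<close> with \<open>x = l x\<close> and
  \<open>0 = l y\<close>. Stating the conclusion for all sesquilinear forms, bounded or not, says that the tensor
  \<open>\<Sum>i. x i \<otimes> y i\<close> vanishes algebraically.\<close>

lemma density:
  fixes x y :: "'i \<Rightarrow> 'a"
  assumes fin: "finite I" and orth: "\<And>T. T \<in> A \<Longrightarrow> (\<Sum>i\<in>I. \<langle>T (x i), y i\<rangle>) = 0"
    and b: "sesquilinear b"
  shows "(\<Sum>i\<in>I. b (x i) (y i)) = 0"
proof (cases "\<exists>x :: 'a. x \<noteq> 0")
  case False
  then show ?thesis using sesquilinear_zero[OF b] by (intro sum.neutral) metis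
next
  case True
  then obtain e1 :: 'a where e1: "e1 \<noteq> 0" by blast
  define near where "near q \<longleftrightarrow> (\<forall>e>0. \<exists>T\<in>A. \<forall>i\<in>I. norm (q i - T (x i)) < e)" for q
  \<comment> \<open>\<open>C t p\<close> says that, on \<open>I\<close>, \<open>p\<close> is the
    projection of \<open>t\<close> onto the closure of the orbit of \<open>x\<close> under
    \<open>A\<close>. It is a relation because it leaves \<open>p\<close> undetermined outside
    \<open>I\<close>.\<close>
  define C where "C t p \<longleftrightarrow> near p \<and> (\<forall>T\<in>A. (\<Sum>i\<in>I. \<langle>T (x i), t i - p i\<rangle>) = 0)" for t p
  have ex_C: "\<exists>p. C t p" for t
  proof -
    define W where "W = (\<lambda>T i. blinfun_apply T (x i)) ` A"
    have "subspace W"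
      unfolding subspace_def W_def
    proof (intro conjI ballI allI)
      show "0 \<in> (\<lambda>T i. blinfun_apply T (x i)) ` A"
        by (rule image_eqI[OF _ zero]) (simp add: fun_eq_iff)
    next
      fix f g assume "f \<in> (\<lambda>T i. blinfun_apply T (x i)) ` A" "g \<in> (\<lambda>T i. blinfun_apply T (x i)) ` A"
      then obtain S T where "S \<in> A" "T \<in> A" "f = (\<lambda>i. S (x i))" "g = (\<lambda>i. T (x i))" by auto
      then show "f + g \<in> (\<lambda>T i. blinfun_apply T (x i)) ` A"
        by (intro image_eqI[OF _ add[of S T]]) (auto simp: fun_eq_iff blinfun.add_left)
    next
      fix r f assume "f \<in> (\<lambda>T i. blinfun_apply T (x i)) ` A"
      then obtain T where "T \<in> A" "f = (\<lambda>i. T (x i))" by auto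
      then show "r *\<^sub>R f \<in> (\<lambda>T i. blinfun_apply T (x i)) ` A"
        by (intro image_eqI[OF _ scaleR[of T r]]) (auto simp: fun_eq_iff blinfun.scaleR_left scaleR_fun_def)
    qed
    from exists_projection[OF fin this, of t]
    obtain p where p: "\<And>e. e > 0 \<Longrightarrow> \<exists>w\<in>W. \<forall>i\<in>I. norm (p i - w i) < e"
      and o: "\<And>w. w \<in> W \<Longrightarrow> (\<Sum>i\<in>I. inner (w i) (t i - p i)) = 0"
      by blast
    have "near p" using p by (simp add: near_def W_def)
    moreover have "(\<Sum>i\<in>I. \<langle>T (x i), t i - p i\<rangle>) = 0" if "T \<in> A" for T
    proof -
      \<comment> \<open>Replacing \<open>T\<close> by its complex multiples turns real orthogonality
        into complex orthogonality.\<close>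
      have "Re (c * (\<Sum>i\<in>I. \<langle>T (x i), t i - p i\<rangle>)) = 0" for c
      proof -
        have "(\<lambda>i. (c *\<^sub>C T) (x i)) \<in> W" using scaleC[OF that, of c] by (auto simp: W_def)
        from o[OF this] show ?thesis
          by (simp only: inner_eq_Re_cinner scaleC_blinfun.rep_eq cinner_scaleC_left
              sum_distrib_left Re_sum)
      qed
      from this[of 1] this[of \<i>] show ?thesis by (simp add: complex_eq_iff)
    qed
    ultimately show ?thesis by (auto simp: C_def)
  qed
  have near_add: "near (\<lambda>i. p i + q i)" if "near p" "near q" for p q
    unfolding near_def
  proof (intro allI impI)
    fix e :: real assume "e > 0"
    then have "e / 2 > 0" by simp
    with that obtain S T where "S \<in> A" "\<forall>i\<in>I. norm (p i - S (x i)) < e / 2"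
      and "T \<in> A" "\<forall>i\<in>I. norm (q i - T (x i)) < e / 2"
      unfolding near_def by blast
    then have "norm (p i + q i - (S + T) (x i)) < e" if "i \<in> I" for i
    proof -
      have "p i + q i - (S + T) (x i) = (p i - S (x i)) + (q i - T (x i))"
        by (simp add: blinfun.add_left)
      then have "norm (p i + q i - (S + T) (x i)) \<le> norm (p i - S (x i)) + norm (q i - T (x i))"
        by (simp only: norm_triangle_ineq)
      also have "\<dots> < e / 2 + e / 2"
        using \<open>\<forall>i\<in>I. norm (p i - S (x i)) < e / 2\<close> \<open>\<forall>i\<in>I. norm (q i - T (x i)) < e / 2\<close> that
        by (intro add_strict_mono) blast+
      finally show ?thesis by simp
    qed
    then show "\<exists>T\<in>A. \<forall>i\<in>I. norm (p i + q i - T (x i)) < e"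
      using add[OF \<open>S \<in> A\<close> \<open>T \<in> A\<close>] by blast
  qed
  have near_map: "near (\<lambda>i. f (q i))"
    if q: "near q" and f: "bounded_linear f" and comp: "\<And>T. T \<in> A \<Longrightarrow> \<exists>S\<in>A. \<forall>v. S v = f (T v)" for f q
    unfolding near_def
  proof (intro allI impI)
    fix e :: real assume "e > 0"
    interpret f: bounded_linear f by fact
    obtain K where K: "K > 0" "\<And>v. norm (f v) \<le> norm v * K" using f.pos_bounded by blast
    obtain T where T: "T \<in> A" "\<forall>i\<in>I. norm (q i - T (x i)) < e / K"
      using q K(1) \<open>e > 0\<close> unfolding near_def by (metis divide_pos_pos)
    obtain S where S: "S \<in> A" "\<forall>v. S v = f (T v)" using comp[OF T(1)] by blast
    have "norm (f (q i) - S (x i)) < e" if "i \<in> I" for i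
    proof -
      have "norm (f (q i) - S (x i)) \<le> norm (q i - T (x i)) * K" using K(2) S(2) f.diff by metis
      also have "\<dots> < (e / K) * K" using T(2) that K(1) by (intro mult_strict_right_mono) auto
      finally show ?thesis using K(1) by simp
    qed
    then show "\<exists>T\<in>A. \<forall>i\<in>I. norm (f (q i) - T (x i)) < e" using S(1) by blast
  qed
  have near_scale: "near (\<lambda>i. c *\<^sub>C q i)" if "near q" for c q
  proof (rule near_map[OF that])
    have "bounded_linear (blinfun_apply (c *\<^sub>C (id_blinfun :: 'a \<Rightarrow>\<^sub>L 'a)))" by (rule blinfun.bounded_linear_right)
    then show "bounded_linear (\<lambda>v :: 'a. c *\<^sub>C v)" by (simp add: scaleC_blinfun.rep_eq)
    show "\<exists>S\<in>A. \<forall>v. S v = c *\<^sub>C T v" if "T \<in> A" for T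
      by (rule bexI[OF _ scaleC[OF that, of c]]) (simp add: scaleC_blinfun.rep_eq)
  qed
  have near_apply: "near (\<lambda>i. T (q i))" if "T \<in> A" "near q" for T q
  proof (rule near_map[OF that(2)])
    show "bounded_linear (blinfun_apply T)" by (rule blinfun.bounded_linear_right)
    show "\<exists>S'\<in>A. \<forall>v. S' v = T (S v)" if "S \<in> A" for S
      by (rule bexI[OF _ comp[OF \<open>T \<in> A\<close> that]]) simp
  qed
  have near_diff: "near (\<lambda>i. p i - q i)" if "near p" "near q" for p q
    using near_add[OF that(1) near_scale[OF that(2), of "-1"]]
    by (simp add: complex_vector.scale_minus_left scaleC_one)
  have C_orth: "(\<Sum>i\<in>I. \<langle>q i, t i - p i\<rangle>) = 0" if "C t p" "near q" for t p q
    by (rule sum_bilinear_closure_eq_0[OF cinner.bounded_bilinear_axioms fin,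
          of "(\<lambda>T i. blinfun_apply T (x i)) ` A"])
      (use that in \<open>auto simp: C_def near_def\<close>)
  have norm_zero: "d i = 0" if "(\<Sum>i\<in>I. \<langle>d i, d i\<rangle>) = 0" "i \<in> I" for d :: "'i \<Rightarrow> 'a" and i
  proof -
    have "(\<Sum>i\<in>I. (norm (d i))\<^sup>2) = 0"
      using that(1) unfolding cinner_self of_real_sum[symmetric] of_real_eq_0_iff .
    then show ?thesis using that(2) fin by (simp add: sum_nonneg_eq_0_iff)
  qed
  have C_unique: "p i = q i" if "C t p" "C t q" "i \<in> I" for t p q i
  proof -
    have near: "near (\<lambda>i. p i - q i)" using that by (intro near_diff) (auto simp: C_def)
    have "(\<Sum>i\<in>I. \<langle>p i - q i, p i - q i\<rangle>) = 0"
      using C_orth[OF that(1) near] C_orth[OF that(2) near]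
      by (simp add: cinner.diff_right sum_subtractf algebra_simps)
    from norm_zero[OF this that(3)] show ?thesis by simp
  qed
  have C_add: "C (\<lambda>i. s i + t i) (\<lambda>i. p i + q i)" if "C s p" "C t q" for s t p q
    using that near_add by (auto simp: C_def add_diff_add cinner.add_right sum.distrib)
  have C_scale: "C (\<lambda>i. c *\<^sub>C t i) (\<lambda>i. c *\<^sub>C p i)" if "C t p" for c t p
  proof -
    have "c *\<^sub>C t i - c *\<^sub>C p i = c *\<^sub>C (t i - p i)" for i
      by (simp add: complex_vector.scale_right_diff_distrib)
    then show ?thesis
      using that near_scale by (auto simp: C_def cinner_scaleC_right simp flip: sum_distrib_left)
  qed
  have C_apply: "C (\<lambda>i. T (t i)) (\<lambda>i. T (p i))" if "T \<in> A" "C t p" for T t p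
  proof -
    obtain T' where T': "T' \<in> A" "\<And>u v. \<langle>T' u, v\<rangle> = \<langle>u, T v\<rangle>" using adjoint[OF \<open>T \<in> A\<close>] by metis
    have "(\<Sum>i\<in>I. \<langle>S (x i), T (t i) - T (p i)\<rangle>) = 0" if "S \<in> A" for S
    proof -
      have "(\<Sum>i\<in>I. \<langle>(T' o\<^sub>L S) (x i), t i - p i\<rangle>) = 0"
        using \<open>C t p\<close> comp[OF T'(1) that] unfolding C_def by blast
      then show ?thesis by (simp add: T'(2) blinfun.diff_right)
    qed
    then show ?thesis using that near_apply by (auto simp: C_def)
  qed
  have C_cong: "C t p" if "C s p" "\<And>i. i \<in> I \<Longrightarrow> s i = t i" for s t p
    using that by (simp add: C_def)
  \<comment> \<open>\<open>D j v\<close> has \<open>v\<close> in slot \<open>j\<close>, so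
    \<open>P j v i\<close> is the matrix entry \<open>(i, j)\<close> of the projection, applied to
    \<open>v\<close>.\<close>
  define D where "D j v i = (if i = j then v else 0)" for j i :: 'i and v :: 'a
  define P where "P j v = (SOME p. C (D j v) p)" for j v
  have P: "C (D j v) (P j v)" for j v
    unfolding P_def using someI_ex[OF ex_C] .
  have P_add: "P j (u + v) i = P j u i + P j v i" if "i \<in> I" for i j u v
  proof -
    have "D j (u + v) = (\<lambda>i. D j u i + D j v i)" by (auto simp: D_def)
    then show ?thesis using C_unique[OF P[of j "u + v"] _ that] C_add[OF P[of j u] P[of j v]] by simp
  qed
  have P_scale: "P j (c *\<^sub>C v) i = c *\<^sub>C P j v i" if "i \<in> I" for i j c v
  proof -
    have "D j (c *\<^sub>C v) = (\<lambda>i. c *\<^sub>C D j v i)" by (auto simp: D_def)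
    then show ?thesis using C_unique[OF P[of j "c *\<^sub>C v"] _ that] C_scale[OF P[of j v], of c] by simp
  qed
  have P_apply: "P j (T v) i = T (P j v i)" if "i \<in> I" "T \<in> A" for i j T v
  proof -
    have "D j (T v) = (\<lambda>i. T (D j v i))" by (auto simp: D_def blinfun.zero_right)
    then show ?thesis
      using C_unique[OF P[of j "T v"] _ that(1)] C_apply[OF that(2) P[of j v]] by simp
  qed
  have P_adj0: "(\<Sum>k\<in>I. \<langle>P j v k, D i w k\<rangle>) = (\<Sum>k\<in>I. \<langle>P j v k, P i w k\<rangle>)" for i j v w
    using C_orth[OF P[of i w], of "P j v"] P[of j v] by (simp add: C_def cinner.diff_right sum_subtractf)
  have D_sum: "(\<Sum>k\<in>I. \<langle>f k, D i w k\<rangle>) = \<langle>f i, w\<rangle>" if "i \<in> I" for f i w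
  proof -
    have "(\<Sum>k\<in>I. \<langle>f k, D i w k\<rangle>) = (\<Sum>k\<in>I. if k = i then \<langle>f k, w\<rangle> else 0)"
      by (intro sum.cong) (auto simp: D_def cinner.zero_right)
    then show ?thesis using that fin by simp
  qed
  have P_adj: "\<langle>P j v i, w\<rangle> = \<langle>v, P i w j\<rangle>" if "i \<in> I" "j \<in> I" for i j v w
  proof -
    have "\<langle>P j v i, w\<rangle> = (\<Sum>k\<in>I. \<langle>P j v k, P i w k\<rangle>)" using P_adj0 D_sum[OF that(1)] by metis
    also have "\<dots> = cnj (\<Sum>k\<in>I. \<langle>P i w k, P j v k\<rangle>)"
      unfolding cnj_sum by (intro sum.cong refl cinner_commute)
    also have "(\<Sum>k\<in>I. \<langle>P i w k, P j v k\<rangle>) = \<langle>P i w j, v\<rangle>" using P_adj0 D_sum[OF that(2)] by metis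
    finally show ?thesis using cinner_commute by metis
  qed
  have P_bound: "norm (P j v i) \<le> norm v" if "i \<in> I" "j \<in> I" for i j v
  proof -
    have *: "(norm (P j v k))\<^sup>2 \<le> norm (P j v j) * norm v" if k: "k \<in> I" for k
    proof -
      have "complex_of_real (\<Sum>k\<in>I. (norm (P j v k))\<^sup>2) = \<langle>P j v j, v\<rangle>"
        using P_adj0[of j v j v] D_sum[OF \<open>j \<in> I\<close>, of "P j v" v] by (simp add: cinner_self)
      then have "\<bar>\<Sum>k\<in>I. (norm (P j v k))\<^sup>2\<bar> = cmod \<langle>P j v j, v\<rangle>" by (metis norm_of_real)
      moreover have "(norm (P j v k))\<^sup>2 \<le> (\<Sum>k\<in>I. (norm (P j v k))\<^sup>2)"
        using member_le_sum[of k I "\<lambda>k. (norm (P j v k))\<^sup>2"] k fin by simp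
      ultimately show ?thesis using cinner_cauchy_schwarz[of "P j v j" v] by linarith
    qed
    have "norm (P j v j) \<le> norm v"
      using *[OF that(2)] by (cases "norm (P j v j) = 0") (auto simp: power2_eq_square)
    then have "norm (P j v j) * norm v \<le> (norm v)\<^sup>2"
      unfolding power2_eq_square by (intro mult_right_mono) auto
    then show ?thesis using *[OF that(1)] by (meson norm_ge_zero order_trans power2_le_imp_le)
  qed
  have "\<exists>c. \<forall>v. P j v i = c *\<^sub>C v" if ij: "i \<in> I" "j \<in> I" for i j
  proof -
    have bl: "bounded_linear (\<lambda>v. P j v i)" if "i \<in> I" "j \<in> I" for i j
      by (rule bounded_linear_intro[where K = 1])
        (use that P_bound in \<open>simp_all add: P_add P_scale scaleR_scaleC\<close>)
    have ap: "Blinfun (\<lambda>v. P j v i) v = P j v i" if "i \<in> I" "j \<in> I" for i j v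
      by (simp add: bounded_linear_Blinfun_apply[OF bl[OF that]])
    obtain c where "\<And>v. Blinfun (\<lambda>v. P j v i) v = c *\<^sub>C v"
      by (rule schur[of "Blinfun (\<lambda>v. P j v i)" "Blinfun (\<lambda>v. P i v j)"])
        (use ij in \<open>auto simp: ap P_adj P_apply clinear_iff P_add P_scale\<close>)
    then show ?thesis using ap[OF ij] by auto
  qed
  then obtain l where l: "\<And>i j v. i \<in> I \<Longrightarrow> j \<in> I \<Longrightarrow> P j v i = l i j *\<^sub>C v" by metis
  have herm: "l i j = cnj (l j i)" if "i \<in> I" "j \<in> I" for i j
    using P_adj[OF that, of e1 e1] e1
    by (simp add: l that cinner_scaleC_left cinner_scaleC_right cinner_self_eq_0)
  have C_matrix: "C t (\<lambda>i. \<Sum>j\<in>I. P j (t j) i)" for t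
  proof -
    have "C (\<lambda>i. \<Sum>j\<in>J. D j (t j) i) (\<lambda>i. \<Sum>j\<in>J. P j (t j) i)" if "finite J" for J
      using that
    proof (induction J)
      case empty
      have "near (\<lambda>_. 0)" unfolding near_def by (intro allI impI bexI[OF _ zero]) simp
      then show ?case by (simp add: C_def cinner.zero_right)
    next
      case (insert j J)
      then show ?case using C_add[OF P[of j "t j"]] by simp
    qed
    from this[OF fin] show ?thesis
      by (rule C_cong) (use fin in \<open>simp add: D_def\<close>)
  qed
  have x: "x i = (\<Sum>j\<in>I. l i j *\<^sub>C x j)" if "i \<in> I" for i
  proof -
    define p where "p = (\<lambda>i. \<Sum>j\<in>I. P j (x j) i)"
    have Cp: "C x p" unfolding p_def by (rule C_matrix)
    \<comment> \<open>Without a unit, \<open>x\<close> is not visibly in the closure of its own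
      orbit. But \<open>T x\<close> and \<open>T p\<close> are, and \<open>T p\<close> is the
      projection of \<open>T x\<close>, so \<open>T x - T p\<close> is both in the closure and
      orthogonal to it.\<close>
    have "T (x i - p i) = 0" if "T \<in> A" for T
    proof -
      have "near (\<lambda>i. T (x i))" unfolding near_def using \<open>T \<in> A\<close> by (auto intro!: bexI[of _ T])
      moreover have "near (\<lambda>i. T (p i))" using near_apply[OF \<open>T \<in> A\<close>] Cp by (simp add: C_def)
      ultimately have "near (\<lambda>i. T (x i) - T (p i))" by (rule near_diff)
      from norm_zero[OF C_orth[OF C_apply[OF \<open>T \<in> A\<close> Cp] this] \<open>i \<in> I\<close>]
      show ?thesis by (simp add: blinfun.diff_right)
    qed
    then have "x i = p i" using nondegenerate[of "x i - p i"] by simp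
    then show ?thesis using that by (simp add: p_def l)
  qed
  have y: "(\<Sum>j\<in>I. l i j *\<^sub>C y j) = 0" if "i \<in> I" for i
  proof -
    have "near (\<lambda>_. 0)" unfolding near_def by (intro allI impI bexI[OF _ zero]) simp
    then have "C y (\<lambda>_. 0)" using orth by (simp add: C_def)
    from C_unique[OF C_matrix this that] show ?thesis using that by (simp add: l)
  qed
  have "(\<Sum>i\<in>I. b (x i) (y i)) = (\<Sum>i\<in>I. \<Sum>j\<in>I. l i j * b (x j) (y i))"
  proof (rule sum.cong[OF refl])
    fix i assume "i \<in> I"
    have "b (x i) (y i) = b (\<Sum>j\<in>I. l i j *\<^sub>C x j) (y i)" using x[OF \<open>i \<in> I\<close>] by simp
    then show "b (x i) (y i) = (\<Sum>j\<in>I. l i j * b (x j) (y i))"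
      using b by (simp add: sesquilinear_sum[OF b] sesquilinear_def)
  qed
  also have "\<dots> = (\<Sum>j\<in>I. \<Sum>i\<in>I. l i j * b (x j) (y i))" by (rule sum.swap)
  \<comment> \<open>The coefficient \<open>l i j\<close> moves to the second argument as its
    conjugate, which is \<open>l j i\<close> because the projection is self-adjoint.\<close>
  also have "\<dots> = (\<Sum>j\<in>I. b (x j) (\<Sum>i\<in>I. l j i *\<^sub>C y i))"
    using b herm[symmetric] by (intro sum.cong refl) (simp add: sesquilinear_sum[OF b] sesquilinear_def)
  also have "\<dots> = 0" using y by (intro sum.neutral) (simp add: sesquilinear_zero[OF b])
  finally show ?thesis .
qed

end

section \<open>Bounded approximation\<close>

definition selfadjoint :: "('a :: complex_inner \<Rightarrow> 'a) \<Rightarrow> bool" where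
  "selfadjoint S \<longleftrightarrow> (\<forall>u v. \<langle>S u, v\<rangle> = \<langle>u, S v\<rangle>)"

lemma selfadjointD: "selfadjoint S \<Longrightarrow> \<langle>S u, v\<rangle> = \<langle>u, S v\<rangle>"
  by (simp add: selfadjoint_def)

lemma selfadjoint_inner: "selfadjoint S \<Longrightarrow> inner (S u) v = inner u (S v)"
  by (simp add: selfadjoint_def inner_eq_Re_cinner)

context irreducible_algebra
begin

text \<open>The self-adjoint elements form only a real subspace, so \<open>density\<close> does not
  apply to them directly. The residual \<open>z\<close> of the projection yields a complex-linear
  functional that vanishes on them, hence on all of \<open>A\<close>, and \<open>density\<close>
  then evaluates it at \<open>K\<close>.\<close>

lemma selfadjoint_approximation:
  assumes fin: "finite I" and K: "clinear K" "selfadjoint K" and "e > 0"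
  obtains S where "S \<in> A" "selfadjoint (blinfun_apply S)" "\<And>i. i \<in> I \<Longrightarrow> norm (S (v i) - K (v i)) < e"
proof -
  define W where "W = {\<lambda>i. blinfun_apply S (v i) |S. S \<in> A \<and> selfadjoint (blinfun_apply S)}"
  have sa: "selfadjoint (blinfun_apply (0 :: 'a \<Rightarrow>\<^sub>L 'a))"
    "\<And>(S :: 'a \<Rightarrow>\<^sub>L 'a) (T :: 'a \<Rightarrow>\<^sub>L 'a). selfadjoint (blinfun_apply S) \<Longrightarrow> selfadjoint (blinfun_apply T) \<Longrightarrow> selfadjoint (blinfun_apply (S + T))"
    "\<And>(S :: 'a \<Rightarrow>\<^sub>L 'a) r. selfadjoint (blinfun_apply S) \<Longrightarrow> selfadjoint (blinfun_apply (r *\<^sub>R S))"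
    by (simp_all add: selfadjoint_def blinfun.add_left blinfun.scaleR_left cinner.zero_left cinner.zero_right
        cinner.add_left cinner.add_right cinner_scaleR_left cinner_scaleR_right)
  have WI: "(\<lambda>i. S (v i)) \<in> W" if "S \<in> A" "selfadjoint (blinfun_apply S)" for S
    using that by (auto simp: W_def)
  have "subspace W"
    unfolding subspace_def
  proof (intro conjI ballI allI)
    show "0 \<in> W" using WI[OF zero sa(1)] by (simp add: zero_fun_def)
  next
    fix f g assume "f \<in> W" "g \<in> W"
    then obtain S T where "S \<in> A" "selfadjoint S" "f = (\<lambda>i. S (v i))"
      "T \<in> A" "selfadjoint T" "g = (\<lambda>i. T (v i))" by (auto simp: W_def)
    then show "f + g \<in> W" using WI[OF add sa(2), of S T]
      by (simp add: plus_fun_def blinfun.add_left)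
  next
    fix r f assume "f \<in> W"
    then obtain S where "S \<in> A" "selfadjoint S" "f = (\<lambda>i. S (v i))" by (auto simp: W_def)
    then show "r *\<^sub>R f \<in> W" using WI[OF scaleR sa(3), of S r]
      by (simp add: scaleR_fun_def blinfun.scaleR_left)
  qed
  from exists_projection[OF fin this, of "\<lambda>i. K (v i)"]
  obtain p where near: "\<And>e. e > 0 \<Longrightarrow> \<exists>w\<in>W. \<forall>i\<in>I. norm (p i - w i) < e"
    and orth: "\<And>w. w \<in> W \<Longrightarrow> (\<Sum>i\<in>I. inner (w i) (K (v i) - p i)) = 0"
    by blast
  define z where "z i = K (v i) - p i" for i
  \<comment> \<open>On a self-adjoint operator the second sum is the conjugate of the first, so the
    value is twice a real part, which the orthogonality of \<open>z\<close> makes zero.\<close>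
  define \<psi> where "\<psi> T = (\<Sum>i\<in>I. \<langle>T (v i), z i\<rangle>) + (\<Sum>i\<in>I. \<langle>T (z i), v i\<rangle>)" for T :: "'a \<Rightarrow>\<^sub>L 'a"
  have \<psi>_sa: "\<psi> S = 0" if "S \<in> A" "selfadjoint S" for S
  proof -
    have "(\<Sum>i\<in>I. inner (S (v i)) (z i)) = 0" using orth[OF WI[OF that]] by (simp add: z_def)
    then have "Re (\<Sum>i\<in>I. \<langle>S (v i), z i\<rangle>) = 0" by (simp add: inner_eq_Re_cinner)
    moreover have "(\<Sum>i\<in>I. \<langle>S (z i), v i\<rangle>) = cnj (\<Sum>i\<in>I. \<langle>S (v i), z i\<rangle>)"
      unfolding cnj_sum using selfadjointD[OF that(2)] by (intro sum.cong refl) (metis cinner_commute)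
    ultimately show ?thesis by (simp add: \<psi>_def complex_eq_iff sum_negf)
  qed
  have \<psi>: "\<psi> T = 0" if "T \<in> A" for T
  proof -
    obtain T' where T': "T' \<in> A" "\<And>u v. \<langle>T u, v\<rangle> = \<langle>u, T' v\<rangle>" "\<And>u v. \<langle>T' u, v\<rangle> = \<langle>u, T v\<rangle>"
      using adjoint[OF \<open>T \<in> A\<close>] by blast
    have "selfadjoint (blinfun_apply (T + T'))" "selfadjoint (blinfun_apply (\<i> *\<^sub>C (T - T')))"
      by (simp_all add: selfadjoint_def T' blinfun.add_left blinfun.diff_left scaleC_blinfun.rep_eq
          cinner.add_left cinner.add_right cinner.diff_left cinner.diff_right
          cinner_scaleC_left cinner_scaleC_right right_diff_distrib)
    then have "\<psi> (T + T') = 0" "\<psi> (\<i> *\<^sub>C (T - T')) = 0"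
      using T' that by (auto intro!: \<psi>_sa add diff scaleC)
    moreover have "\<psi> (T + T') = \<psi> T + \<psi> T'" "\<psi> (\<i> *\<^sub>C (T - T')) = \<i> * (\<psi> T - \<psi> T')"
      by (simp_all add: \<psi>_def blinfun.add_left blinfun.diff_left scaleC_blinfun.rep_eq
          cinner.add_left cinner.diff_left cinner_scaleC_left sum.distrib sum_subtractf
          sum_distrib_left algebra_simps)
    ultimately show ?thesis by simp
  qed
  \<comment> \<open>The two sums become one over \<open>I <+> I\<close>, with pairs
    \<open>(v i, z i)\<close> and \<open>(z i, v i)\<close>. The outcome is that \<open>K v\<close>
    is real-orthogonal to its own residual \<open>z\<close>.\<close>
  have "(\<Sum>i\<in>I <+> I. \<langle>K (case_sum v z i), case_sum z v i\<rangle>) = 0"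
  proof (rule density[where b = "\<lambda>u w. \<langle>K u, w\<rangle>"])
    show "(\<Sum>i\<in>I <+> I. \<langle>T (case_sum v z i), case_sum z v i\<rangle>) = 0" if "T \<in> A" for T
      using \<psi>[OF that] fin by (simp add: \<psi>_def sum.Plus)
  qed (use fin sesquilinear_cinner[OF K(1)] in auto)
  then have "(\<Sum>i\<in>I. \<langle>K (v i), z i\<rangle>) + (\<Sum>i\<in>I. \<langle>K (z i), v i\<rangle>) = 0"
    using fin by (simp add: sum.Plus)
  moreover have "(\<Sum>i\<in>I. \<langle>K (z i), v i\<rangle>) = cnj (\<Sum>i\<in>I. \<langle>K (v i), z i\<rangle>)"
    unfolding cnj_sum using selfadjointD[OF K(2)] by (intro sum.cong refl) (metis cinner_commute)
  ultimately have "Re (\<Sum>i\<in>I. \<langle>K (v i), z i\<rangle>) = 0" by (simp add: complex_eq_iff)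
  then have "(\<Sum>i\<in>I. inner (K (v i)) (z i)) = 0" by (simp add: inner_eq_Re_cinner)
  moreover have "(\<Sum>i\<in>I. inner (p i) (z i)) = 0"
    by (rule sum_bilinear_closure_eq_0[OF bounded_bilinear_inner fin near]) (simp_all add: orth z_def)
  ultimately have "(\<Sum>i\<in>I. (norm (z i))\<^sup>2) = 0"
    by (simp add: z_def power2_norm_eq_inner inner_diff_left sum_subtractf)
  then have "K (v i) = p i" if "i \<in> I" for i
    using that fin by (simp add: sum_nonneg_eq_0_iff z_def)
  moreover obtain w where "w \<in> W" "\<forall>i\<in>I. norm (p i - w i) < e" using near[OF \<open>e > 0\<close>] by blast
  ultimately show ?thesis using that by (force simp: W_def norm_minus_commute)
qed

text \<open>The resolvent \<open>R = (1 + S\<^sup>2)\<^sup>-\<^sup>1\<close> is the fixed point of a contraction that preserves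
  \<open>{X. S X \<in> A}\<close>, where \<open>R\<close> itself need not be in the algebra when \<open>A\<close> has no unit.\<close>

lemma resolvent:
  assumes S: "S \<in> A" "selfadjoint (blinfun_apply S)"
  obtains R :: "'a \<Rightarrow>\<^sub>L 'a" where "\<And>v. R v + S (S (R v)) = v" "\<And>v. R (v + S (S v)) = v" "S o\<^sub>L R \<in> A"
proof -
  \<comment> \<open>This value satisfies \<open>k * (norm S)^2 = 1 - k\<close>, so
    \<open>k S^2\<close> lies between \<open>0\<close> and \<open>1 - k\<close>, and the linear part
    \<open>(1 - k) - k S^2\<close> of the iteration \<open>F\<close> has norm at most
    \<open>1 - k\<close>.\<close>
  define k where "k = 1 / (1 + (norm S)\<^sup>2)"
  have pos: "1 + (norm S)\<^sup>2 > 0" by (simp add: add_pos_nonneg)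
  have k: "k > 0" "k \<le> 1" "k * (norm S)\<^sup>2 = 1 - k"
    using pos by (auto simp: k_def field_simps)
  define F where "F X = X - k *\<^sub>R (X + (S o\<^sub>L (S o\<^sub>L X)) - id_blinfun)" for X :: "'a \<Rightarrow>\<^sub>L 'a"
  define s where "s = {X. S o\<^sub>L X \<in> A}"
  have "closed s"
    using closed_vimage[OF closed_A, of "\<lambda>X. S o\<^sub>L X"]
    by (simp add: s_def vimage_def) (metis linear_continuous_on blinfun_compose.bounded_linear_right)
  then have "complete s" by (simp add: complete_eq_closed)
  moreover have "s \<noteq> {}" using zero by (auto simp: s_def intro!: exI[of _ 0])
  moreover have "0 \<le> 1 - k" "1 - k < 1" using k by auto
  moreover have "F X \<in> s" if "X \<in> s" for X
  proof -
    have "S o\<^sub>L F X = (S o\<^sub>L X) - k *\<^sub>R ((S o\<^sub>L X) + (S o\<^sub>L (S o\<^sub>L (S o\<^sub>L X))) - S)"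
      by (rule blinfun_eqI)
        (simp add: F_def blinfun.diff_left blinfun.diff_right blinfun.scaleR_left blinfun.scaleR_right
          blinfun.add_left blinfun.add_right)
    moreover have "\<dots> \<in> A"
      using that S(1) by (auto simp: s_def intro!: add diff scaleR comp)
    ultimately show ?thesis by (simp add: s_def)
  qed
  moreover have "dist (F X) (F Y) \<le> (1 - k) * dist X Y" for X Y
  proof -
    define E where "E = (1 - k) *\<^sub>R id_blinfun - k *\<^sub>R (S o\<^sub>L S)"
    have E: "E v = (1 - k) *\<^sub>R v - k *\<^sub>R S (S v)" for v
      by (simp add: E_def blinfun.diff_left blinfun.scaleR_left)
    have "norm E \<le> 1 - k"
    proof (rule norm_blinfun_bound)
      fix v
      have "(norm (S (S v)))\<^sup>2 \<le> (norm S)\<^sup>2 * (norm (S v))\<^sup>2"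
        using power_mono[OF norm_blinfun[of S "S v"] norm_ge_zero, of 2] by (simp add: power_mult_distrib)
      then have "k * (k * (norm (S (S v)))\<^sup>2) \<le> k * (k * ((norm S)\<^sup>2 * (norm (S v))\<^sup>2))"
        using k(1) by (intro mult_left_mono) auto
      then have *: "k\<^sup>2 * (norm (S (S v)))\<^sup>2 \<le> k * (1 - k) * (norm (S v))\<^sup>2"
        using k(3) by (simp add: power2_eq_square[of k] mult.assoc flip: k(3))
      have "(norm (E v))\<^sup>2 = (1 - k)\<^sup>2 * (norm v)\<^sup>2 - 2 * (k * (1 - k) * (norm (S v))\<^sup>2)
          + k\<^sup>2 * (norm (S (S v)))\<^sup>2"
        unfolding power2_norm_eq_inner E inner_diff inner_scaleR_left inner_scaleR_right
          selfadjoint_inner[OF S(2), of v, symmetric] selfadjoint_inner[OF S(2), of "S v" v]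
        by (simp add: power2_eq_square algebra_simps)
      also have "\<dots> \<le> (1 - k)\<^sup>2 * (norm v)\<^sup>2"
        using * k by (simp add: zero_le_mult_iff) (smt (verit) mult_nonneg_nonneg zero_le_power2)
      finally have "(norm (E v))\<^sup>2 \<le> ((1 - k) * norm v)\<^sup>2" by (simp add: power_mult_distrib)
      then show "norm (E v) \<le> (1 - k) * norm v"
        by (rule power2_le_imp_le) (use k in auto)
    qed (use k in auto)
    moreover have "F X - F Y = E o\<^sub>L (X - Y)"
      by (rule blinfun_eqI)
        (simp add: F_def E blinfun.diff_left blinfun.diff_right blinfun.scaleR_left blinfun.add_left
          algebra_simps)
    ultimately show ?thesis
      using norm_blinfun_compose[of E "X - Y"]
      by (simp add: dist_norm) (meson mult_right_mono norm_ge_zero order_trans)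
  qed
  ultimately have "\<exists>!X\<in>s. F X = X" by (intro Banach_fix[of s "1 - k" F]) auto
  then obtain R where R: "R \<in> s" "F R = R" by blast
  have "R v + S (S (R v)) = v" for v
    using arg_cong[OF R(2), of "\<lambda>X. X v"] k(1)
    by (simp add: F_def blinfun.diff_left blinfun.scaleR_left blinfun.add_left)
  moreover have "R (v + S (S v)) = v" for v
  proof -
    define d where "d = R (v + S (S v)) - v"
    have "d + S (S d) = 0"
      using calculation[of "v + S (S v)"] unfolding d_def blinfun.diff_right by (simp add: algebra_simps)
    then have "inner (d + S (S d)) d = 0" by simp
    then have "(norm d)\<^sup>2 + (norm (S d))\<^sup>2 = 0"
      by (simp add: inner_add power2_norm_eq_inner selfadjoint_inner[OF S(2)])
    then show ?thesis by (simp add: d_def sum_power2_eq_zero_iff)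
  qed
  ultimately show ?thesis using R(1) that by (auto simp: s_def)
qed

text \<open>Kaplansky's density theorem for the symmetric partial isometry exchanging \<open>x\<close> and \<open>y\<close> and
  killing \<open>u\<close>: the function \<open>2 t / (1 + t\<^sup>2)\<close> is bounded by \<open>1\<close> and fixes \<open>-1, 0, 1\<close>.\<close>

lemma kaplansky_exchange:
  assumes xy: "norm x = 1" "norm y = 1" "Im \<langle>x, y\<rangle> = 0" and u: "\<langle>u, x\<rangle> = 0" "\<langle>u, y\<rangle> = 0" and "e > 0"
  obtains q where "q \<in> A" "selfadjoint (blinfun_apply q)" "norm q \<le> 1" "norm (q x - y) \<le> e" "norm (q u) \<le> e"
proof -
  \<comment> \<open>\<open>P w\<close> is the orthogonal projection onto the line through
    \<open>w\<close>, and zero for \<open>w = 0\<close>, so \<open>x = y\<close> and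
    \<open>x = - y\<close> are covered. As \<open>\<langle>x, y\<rangle>\<close> is real,
    \<open>x + y\<close> and \<open>x - y\<close> are orthogonal; \<open>K\<close> is
    \<open>1\<close> on the one and \<open>-1\<close> on the other, hence exchanges \<open>x\<close>
    and \<open>y\<close>.\<close>
  define P where "P w v = (\<langle>v, w\<rangle> / \<langle>w, w\<rangle>) *\<^sub>C w" for w v :: 'a
  define K where "K v = P (x + y) v - P (x - y) v" for v
  have self: "cnj \<langle>w, w\<rangle> = \<langle>w, w\<rangle>" for w :: 'a by (metis cinner_commute)
  have "clinear K"
    by (simp add: clinear_iff K_def P_def cinner_add_left cinner_scaleC_left add_divide_distrib
        scaleC_add_left scaleC_scaleC complex_vector.scale_right_diff_distrib)
  have "\<langle>P w a, b\<rangle> = \<langle>a, P w b\<rangle>" for w a b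
    unfolding P_def cinner_scaleC_left cinner_scaleC_right complex_cnj_divide self
    by (simp add: cinner_commute[of w b])
  then have K: "selfadjoint K"
    by (simp add: selfadjoint_def K_def cinner.diff_left cinner.diff_right)
  have half: "P w v = (1/2) *\<^sub>C w" if "2 * \<langle>v, w\<rangle> = \<langle>w, w\<rangle>" for v w
  proof (cases "w = 0")
    case False
    then have "\<langle>v, w\<rangle> / \<langle>w, w\<rangle> = 1 / 2" using that by (simp add: cinner_self_eq_0 field_simps)
    then show ?thesis by (simp add: P_def)
  qed (simp add: P_def)
  have yx: "\<langle>y, x\<rangle> = \<langle>x, y\<rangle>"
    using xy(3) cinner_commute[of y x] by (simp add: complex_eq_iff)
  have n: "\<langle>x, x\<rangle> = 1" "\<langle>y, y\<rangle> = 1" using xy by (simp_all add: cinner_self)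
  note bil = cinner.add_left cinner.add_right cinner.diff_left cinner.diff_right
    cinner.minus_left cinner.minus_right
  have two: "(1/2) *\<^sub>C v + (1/2) *\<^sub>C v = v" for v :: 'a
    by (simp add: scaleC_one flip: scaleC_add_left)
  have Px: "P (x + y) x = (1/2) *\<^sub>C (x + y)" "P (x - y) x = (1/2) *\<^sub>C (x - y)"
    "P (x + y) y = (1/2) *\<^sub>C (x + y)"
    by (rule half; simp add: bil n yx)+
  have Py: "P (x - y) y = - ((1/2) *\<^sub>C (x - y))"
  proof -
    have "P (x - y) (- y) = - P (x - y) y" by (simp add: P_def cinner.minus_left complex_vector.scale_minus_left)
    moreover have "P (x - y) (- y) = (1/2) *\<^sub>C (x - y)" by (rule half) (simp add: bil n yx)
    ultimately show ?thesis by (metis minus_minus)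
  qed
  have "K x = (1/2) *\<^sub>C y + (1/2) *\<^sub>C y" "K y = (1/2) *\<^sub>C x + (1/2) *\<^sub>C x"
    unfolding K_def Px Py scaleC_add_right complex_vector.scale_right_diff_distrib by simp_all
  then have Kx: "K x = y" "K y = x" by (simp_all only: two)
  have Ku: "K u = 0" by (simp add: K_def P_def bil u)
  obtain S where S: "S \<in> A" "selfadjoint (blinfun_apply S)"
    and near: "\<And>v. v \<in> {x, y, u} \<Longrightarrow> norm (S v - K v) < e / 2"
    by (rule selfadjoint_approximation[of "{x, y, u}" K "e / 2" "\<lambda>v. v"])
      (use \<open>clinear K\<close> K \<open>e > 0\<close> in simp_all)
  obtain R :: "'a \<Rightarrow>\<^sub>L 'a" where R: "\<And>v. R v + S (S (R v)) = v" "\<And>v. R (v + S (S v)) = v" "S o\<^sub>L R \<in> A"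
    by (rule resolvent[OF S]) blast
  have SR: "S (R v) = R (S v)" for v
  proof -
    have "S (R v) + S (S (S (R v))) = S v"
      using arg_cong[OF R(1)[of v], of S] by (simp only: blinfun.add_right)
    then show ?thesis using R(2)[of "S (R v)"] by simp
  qed
  have size: "(norm v)\<^sup>2 = (norm (R v))\<^sup>2 + 2 * (norm (S (R v)))\<^sup>2 + (norm (S (S (R v))))\<^sup>2" for v
  proof -
    have "(norm (w + S (S w)))\<^sup>2 = (norm w)\<^sup>2 + 2 * (norm (S w))\<^sup>2 + (norm (S (S w)))\<^sup>2" for w
      unfolding power2_norm_eq_inner inner_add selfadjoint_inner[OF S(2), of w, symmetric]
        selfadjoint_inner[OF S(2), of "S w" w] by simp
    from this[of "R v"] show ?thesis by (simp add: R(1))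
  qed
  have Rn: "norm (R v) \<le> norm v" for v
    by (rule power2_le_imp_le) (simp_all add: size[of v])
  have SRn: "2 * norm (S (R v)) \<le> norm v" for v
  proof -
    define w where "w = R v"
    have "(norm (S w))\<^sup>2 = inner w (S (S w))"
      by (simp add: power2_norm_eq_inner selfadjoint_inner[OF S(2)])
    also have "\<dots> \<le> norm w * norm (S (S w))" by (rule norm_cauchy_schwarz)
    finally have "2 * (norm (S w))\<^sup>2 \<le> (norm w)\<^sup>2 + (norm (S (S w)))\<^sup>2"
      using sum_squares_bound[of "norm w" "norm (S (S w))"] by simp
    then have "(2 * norm (S w))\<^sup>2 \<le> (norm v)\<^sup>2" using size[of v] by (simp add: w_def power_mult_distrib)
    then show ?thesis unfolding w_def by (rule power2_le_imp_le) simp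
  qed
  define q where "q = 2 *\<^sub>R (S o\<^sub>L R)"
  have q: "q v = 2 *\<^sub>R S (R v)" for v by (simp add: q_def blinfun.scaleR_left)
  show ?thesis
  proof
    show "q \<in> A" unfolding q_def by (intro scaleR R)
    have Rsa: "\<langle>R a, b\<rangle> = \<langle>a, R b\<rangle>" for a b
    proof -
      have "\<langle>R a, b\<rangle> = \<langle>R a, R b + S (S (R b))\<rangle>" by (simp add: R(1))
      also have "\<dots> = \<langle>R a + S (S (R a)), R b\<rangle>"
        by (simp add: cinner.add_left cinner.add_right selfadjointD[OF S(2)])
      finally show ?thesis by (simp add: R(1))
    qed
    then show "selfadjoint (blinfun_apply q)"
      by (simp add: selfadjoint_def q cinner_scaleR_left cinner_scaleR_right selfadjointD[OF S(2)] SR)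
    show "norm q \<le> 1"
      by (rule norm_blinfun_bound) (use SRn in \<open>simp_all add: q\<close>)
    \<comment> \<open>Writing \<open>y\<close> as \<open>R (y + S (S y))\<close> expresses the error
      of \<open>q\<close> through the errors \<open>S x - y\<close> and
      \<open>x - S y\<close>.\<close>
    have "q x - y = R (S x - y) + S (R (x - S y)) "
      using R(2)[of y] by (simp add: q SR blinfun.diff_right blinfun.add_right scaleR_2 algebra_simps)
    then have "norm (q x - y) \<le> norm (R (S x - y)) + norm (S (R (x - S y)))"
      by (simp only: norm_triangle_ineq)
    also have "\<dots> \<le> norm (S x - y) + norm (S y - x) / 2"
      using Rn[of "S x - y"] SRn[of "x - S y"] by (simp add: norm_minus_commute)
    finally show "norm (q x - y) \<le> e" using near[of x] near[of y] \<open>e > 0\<close> by (simp add: Kx)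
    have "norm (q u) = 2 * norm (R (S u))" by (simp add: q SR)
    also have "\<dots> \<le> 2 * norm (S u)" using Rn[of "S u"] by simp
    finally show "norm (q u) \<le> e" using near[of u] by (simp add: Ku)
  qed
qed

end

section \<open>Vector functionals are extreme\<close>

lemma norm_scaleC_blinfun_le: "norm (c *\<^sub>C T) \<le> cmod c * norm T"
  for T :: "'a :: real_normed_vector \<Rightarrow>\<^sub>L 'b :: complex_inner"
  by (rule norm_blinfun_bound)
    (simp_all add: scaleC_blinfun.rep_eq norm_scaleC mult.assoc mult_left_mono norm_blinfun)

lemma norm_blinfun_le:
  assumes "norm T \<le> 1" shows "norm (blinfun_apply T v) \<le> norm v"
  using norm_blinfun[of T v] mult_right_mono[OF assms norm_ge_zero[of v]] by linarith

lemma exists_phase: "\<exists>t. cmod t = 1 \<and> t * z = complex_of_real (cmod z)"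
proof (cases "z = 0")
  case False
  then show ?thesis
    using complex_norm_square[of z]
    by (intro exI[of _ "cnj z / of_real (cmod z)"]) (simp add: norm_divide field_simps power2_eq_square)
qed (auto intro: exI[of _ 1])

context irreducible_algebra
begin

definition adj :: "('a \<Rightarrow>\<^sub>L 'a) \<Rightarrow> ('a \<Rightarrow>\<^sub>L 'a)" where
  "adj T = (SOME T'. T' \<in> A \<and> (\<forall>u v. \<langle>T u, v\<rangle> = \<langle>u, T' v\<rangle>))"

lemma adj: "T \<in> A \<Longrightarrow> adj T \<in> A \<and> (\<forall>u v. \<langle>T u, v\<rangle> = \<langle>u, adj T v\<rangle>)"
  unfolding adj_def by (rule someI_ex) (metis adjoint)

lemma adj_in: "T \<in> A \<Longrightarrow> adj T \<in> A" and cinner_adj: "T \<in> A \<Longrightarrow> \<langle>T u, v\<rangle> = \<langle>u, adj T v\<rangle>"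
  using adj by blast+

lemma cinner_adj': "T \<in> A \<Longrightarrow> \<langle>adj T u, v\<rangle> = \<langle>u, T v\<rangle>"
  by (metis cinner_adj cinner_commute)

lemma adj_eqI: "T \<in> A \<Longrightarrow> (\<And>u v. \<langle>T u, v\<rangle> = \<langle>u, blinfun_apply T' v\<rangle>) \<Longrightarrow> adj T = T'"
  by (rule blinfun_eqI, rule cinner_ext_left) (metis cinner_adj)

lemma norm_adj: assumes "T \<in> A" shows "norm (adj T) \<le> norm T"
proof (rule norm_blinfun_bound)
  fix v
  have "complex_of_real ((norm (adj T v))\<^sup>2) = \<langle>v, T (adj T v)\<rangle>"
    using cinner_adj'[OF assms, of v "adj T v"] by (simp add: cinner_self)
  then have "(norm (adj T v))\<^sup>2 = cmod \<langle>v, T (adj T v)\<rangle>"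
    by (metis norm_of_real abs_of_nonneg zero_le_power2)
  also have "\<dots> \<le> norm v * (norm T * norm (adj T v))"
    by (rule order_trans[OF cinner_cauchy_schwarz]) (intro mult_left_mono norm_blinfun norm_ge_zero)
  finally show "norm (adj T v) \<le> norm T * norm v"
    by (cases "norm (adj T v) = 0") (simp_all add: power2_eq_square mult_ac)
qed simp

text \<open>The exchange lemma asks for a real inner product, so \<open>y\<close> is first rotated
  by a phase, which is undone on \<open>q\<close>. With \<open>u = 0\<close> its last condition is
  empty.\<close>

lemma exists_transport:
  assumes x: "norm x = 1" and y: "norm y = 1" and "d > 0"
  obtains a where "a \<in> A" "norm a \<le> 1" "norm (a x - y) \<le> d"
proof -
  obtain t where t: "cmod t = 1" "t * \<langle>x, y\<rangle> = of_real (cmod \<langle>x, y\<rangle>)"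
    using exists_phase by blast
  have "norm (cnj t *\<^sub>C y) = 1" "Im \<langle>x, cnj t *\<^sub>C y\<rangle> = 0"
    using t y by (simp_all add: norm_scaleC cinner_scaleC_right)
  then obtain q where q: "q \<in> A" "norm q \<le> 1" "norm (q x - cnj t *\<^sub>C y) \<le> d"
    using kaplansky_exchange[OF x, of "cnj t *\<^sub>C y" 0 d] \<open>d > 0\<close> by (auto simp: cinner.zero_left)
  have "t * cnj t = 1" using t(1) complex_norm_square[of t] by simp
  then have "(t *\<^sub>C q) x - y = t *\<^sub>C (q x - cnj t *\<^sub>C y)"
    by (simp add: scaleC_blinfun.rep_eq complex_vector.scale_right_diff_distrib scaleC_scaleC scaleC_one)
  then have "norm ((t *\<^sub>C q) x - y) \<le> d" using q(3) t(1) by (simp add: norm_scaleC)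
  moreover have "norm (t *\<^sub>C q) \<le> 1" using norm_scaleC_blinfun_le[of t q] q(2) t(1) by simp
  ultimately show ?thesis using that scaleC[OF q(1)] by blast
qed

text \<open>The witnesses are \<open>E n = (1 - b\<^sup>* b)\<^sup>n\<close>: they almost fix the vectors that \<open>b\<close> almost kills,
  while \<open>b (E n)\<close> has norm at most \<open>1 / sqrt n\<close>.\<close>

lemma exists_cutoff:
  assumes b: "b \<in> A" "norm b \<le> 1"
  obtains E :: "nat \<Rightarrow> 'a \<Rightarrow>\<^sub>L 'a" where
    "\<And>n a. a \<in> A \<Longrightarrow> a o\<^sub>L E n \<in> A"
    "\<And>n. selfadjoint (blinfun_apply (E n))"
    "\<And>n v. norm (E n v) \<le> norm v"
    "\<And>n v. norm (E n v - v) \<le> real n * norm (b v)"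
    "\<And>n v. real n * (norm (b (E n v)))\<^sup>2 \<le> (norm v)\<^sup>2"
proof -
  define b' where "b' = adj b"
  have b': "b' \<in> A" "norm b' \<le> 1" using b adj_in norm_adj[of b] by (auto simp: b'_def)
  have ad: "\<langle>b u, v\<rangle> = \<langle>u, b' v\<rangle>" "\<langle>b' u, v\<rangle> = \<langle>u, b v\<rangle>" for u v
    using b(1) by (simp_all add: b'_def cinner_adj cinner_adj')
  then have adi: "inner (b u) v = inner u (b' v)" "inner (b' u) v = inner u (b v)" for u v
    by (simp_all add: inner_eq_Re_cinner)
  have contr: "(norm (v - c' (c v)))\<^sup>2 \<le> (norm v)\<^sup>2 - (norm (c v))\<^sup>2"
    if c': "\<And>u v. inner (c u) v = inner u (c' v)" "norm c' \<le> 1" for c c' :: "'a \<Rightarrow>\<^sub>L 'a" and v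
  proof -
    have "(norm (v - c' (c v)))\<^sup>2 = (norm v)\<^sup>2 - 2 * (norm (c v))\<^sup>2 + (norm (c' (c v)))\<^sup>2"
      unfolding power2_norm_eq_inner by (simp add: inner_diff inner_commute c'(1))
    then show ?thesis using power_mono[OF norm_blinfun_le[OF c'(2), of "c v"] norm_ge_zero, of 2] by simp
  qed
  define R where "R = id_blinfun - (b' o\<^sub>L b)"
  have R: "R v = v - b' (b v)" for v by (simp add: R_def blinfun.diff_left)
  have R1: "(norm (R v))\<^sup>2 \<le> (norm v)\<^sup>2 - (norm (b v))\<^sup>2" for v
    unfolding R by (rule contr) (simp_all add: adi b')
  have bR: "(norm (b (R v)))\<^sup>2 \<le> (norm (b v))\<^sup>2" for v
  proof -
    have "(norm (b (R v)))\<^sup>2 \<le> (norm (b v))\<^sup>2 - (norm (b' (b v)))\<^sup>2"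
      unfolding R blinfun.diff_right by (rule contr) (simp_all add: adi b)
    then show ?thesis by (smt (verit) zero_le_power2)
  qed
  define E where "E = rec_nat id_blinfun (\<lambda>_ Z. R o\<^sub>L Z)"
  have E: "E 0 = id_blinfun" "E (Suc n) = R o\<^sub>L E n" for n by (simp_all add: E_def)
  have ER: "R (E n v) = E n (R v)" for n v by (induction n arbitrary: v) (simp_all add: E)
  \<comment> \<open>Passing from \<open>n\<close> to \<open>n + 1\<close> costs at least
    \<open>(norm (b (E n v)))^2\<close> of the squared norm of \<open>E n v\<close>. By
    \<open>bR\<close> these losses do not increase, so \<open>n\<close> times the latest one fits
    into the squared norm of \<open>v\<close>.\<close>
  have key: "real n * (norm (b (E n v)))\<^sup>2 + (norm (E n v))\<^sup>2 \<le> (norm v)\<^sup>2" for n v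
  proof (induction n)
    case (Suc n)
    have "real (Suc n) * (norm (b (E (Suc n) v)))\<^sup>2 \<le> real (Suc n) * (norm (b (E n v)))\<^sup>2"
      using bR[of "E n v"] by (intro mult_left_mono) (auto simp: E)
    moreover have "(norm (E (Suc n) v))\<^sup>2 \<le> (norm (E n v))\<^sup>2 - (norm (b (E n v)))\<^sup>2"
      using R1[of "E n v"] by (simp add: E)
    ultimately show ?case using Suc by (simp add: distrib_right)
  qed (simp add: E)
  show ?thesis
  proof
    show "a o\<^sub>L E n \<in> A" if "a \<in> A" for a n
      using that
    proof (induction n arbitrary: a)
      case 0
      have "a o\<^sub>L id_blinfun = a" by (rule blinfun_eqI) simp
      then show ?case using 0 by (simp add: E)
    next
      case (Suc n)
      \<comment> \<open>The factor \<open>1 - b' b\<close> is absorbed into \<open>a\<close>, so the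
        product stays in \<open>A\<close> although \<open>E\<close> itself may not.\<close>
      have "a o\<^sub>L E (Suc n) = (a - ((a o\<^sub>L b') o\<^sub>L b)) o\<^sub>L E n"
        by (rule blinfun_eqI) (simp add: E R blinfun.diff_left blinfun.diff_right)
      then show ?case using Suc b b' by (simp add: diff comp)
    qed
    have Rsa: "\<langle>R u, v\<rangle> = \<langle>u, R v\<rangle>" for u v
      by (simp add: R cinner.diff_left cinner.diff_right ad)
    show "selfadjoint (blinfun_apply (E n))" for n
      by (induction n) (simp_all add: selfadjoint_def E Rsa ER)
    show "norm (E n v) \<le> norm v" for n v
    proof (rule power2_le_imp_le)
      have "0 \<le> real n * (norm (b (E n v)))\<^sup>2" by simp
      then show "(norm (E n v))\<^sup>2 \<le> (norm v)\<^sup>2" using key[of n v] by linarith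
    qed simp
    show "real n * (norm (b (E n v)))\<^sup>2 \<le> (norm v)\<^sup>2" for n v
      using key[of n v] zero_le_power2[of "norm (E n v)"] by linarith
    show "norm (E n v - v) \<le> real n * norm (b v)" for n v
    proof (induction n)
      case (Suc n)
      have "E (Suc n) v - v = R (E n v - v) - b' (b v)"
        by (simp add: E R blinfun.diff_right)
      then have "norm (E (Suc n) v - v) \<le> norm (R (E n v - v)) + norm (b' (b v))"
        by (simp only: norm_triangle_ineq4)
      also have "norm (R (E n v - v)) \<le> norm (E n v - v)"
      proof (rule power2_le_imp_le)
        show "(norm (R (E n v - v)))\<^sup>2 \<le> (norm (E n v - v))\<^sup>2"
          using R1[of "E n v - v"] zero_le_power2[of "norm (b (E n v - v))"] by linarith
      qed simp
      also have "norm (b' (b v)) \<le> norm (b v)" by (rule norm_blinfun_le[OF b'(2)])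
      finally show ?case using Suc by (simp add: distrib_right)
    qed (simp add: E)
  qed
qed

text \<open>The last clause comes from convex combinations: if
  \<open>\<omega> x y = s f + (1 - s) g\<close> on \<open>A\<close> with \<open>0 < s < 1\<close>
  and \<open>g\<close> in the dual ball, then \<open>Re (g T) \<le> 1\<close> for contractions gives
  it with \<open>C = 1 / s\<close>.\<close>

definition dominated :: "'a \<Rightarrow> 'a \<Rightarrow> real \<Rightarrow> (('a \<Rightarrow>\<^sub>L 'a) \<Rightarrow> complex) \<Rightarrow> bool" where
  "dominated x y C f \<longleftrightarrow>
     (\<forall>S\<in>A. \<forall>T\<in>A. f (S + T) = f S + f T) \<and> (\<forall>c. \<forall>T\<in>A. f (c *\<^sub>C T) = c * f T) \<and>
     (\<forall>T\<in>A. cmod (f T) \<le> norm T) \<and>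
     (\<forall>T\<in>A. norm T \<le> 1 \<longrightarrow> 1 - Re (f T) \<le> C * (1 - Re \<langle>T x, y\<rangle>))"

text \<open>If \<open>a x\<close> is close to \<open>y\<close> and \<open>b\<close> almost kills \<open>x\<close>, then \<open>f (a (E n))\<close> is almost \<open>1\<close>, while
  \<open>a (E n) + c b\<close> has norm at most \<open>1 + |c| / sqrt n + |c|\<^sup>2 / 2\<close>; so \<open>f b\<close> must be small.\<close>

lemma dominated_le:
  assumes f: "dominated x y C f" and x: "norm x = 1" and y: "norm y = 1" and C: "C \<ge> 0"
    and b: "b \<in> A" "norm b \<le> 1" and n: "n > 0" and z: "z > 0"
  shows "cmod (f b) \<le> C * (real n * norm (b x)) / z + 1 / sqrt (real n) + z / 2"
proof (rule field_le_epsilon)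
  fix e :: real assume e: "e > 0"
  \<comment> \<open>The transport error enters the final bound as \<open>C * d / z\<close>, which
    this makes at most \<open>e\<close>; the \<open>+ 1\<close> covers \<open>C = 0\<close>.\<close>
  define d where "d = e * z / (C + 1)"
  have "d > 0" using e z C by (auto simp: d_def intro!: divide_pos_pos)
  moreover have "(C + 1) * d = e * z" using C by (simp add: d_def)
  ultimately have d: "d > 0" "C * d / z \<le> e" using z by (simp_all add: divide_le_eq distrib_right)
  obtain a where a: "a \<in> A" "norm a \<le> 1" "norm (a x - y) \<le> d"
    by (rule exists_transport[OF x y d(1)])
  obtain E where E: "\<And>n a. a \<in> A \<Longrightarrow> a o\<^sub>L E n \<in> A"
    "\<And>n. selfadjoint (blinfun_apply (E n))" "\<And>n v. norm (E n v) \<le> norm v"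
    "\<And>n v. norm (E n v - v) \<le> real n * norm (b v)"
    "\<And>n v. real n * (norm (b (E n v)))\<^sup>2 \<le> (norm v)\<^sup>2"
    by (rule exists_cutoff[OF b]) blast
  have norm_aE: "norm (a o\<^sub>L E n) \<le> 1"
    using norm_blinfun_le[OF a(2)] E(3) by (intro norm_blinfun_bound) (auto intro: order_trans)
  have "\<langle>(a o\<^sub>L E n) x, y\<rangle> = 1 + \<langle>(a x - y) + a (E n x - x), y\<rangle>"
    using y by (simp add: cinner.add_left cinner.diff_left blinfun.diff_right cinner_self)
  moreover have "cmod \<langle>(a x - y) + a (E n x - x), y\<rangle> \<le> d + real n * norm (b x)"
  proof -
    have "cmod \<langle>(a x - y) + a (E n x - x), y\<rangle> \<le> norm ((a x - y) + a (E n x - x))"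
      using cinner_cauchy_schwarz[of _ y] y by (metis mult.right_neutral)
    also have "\<dots> \<le> d + real n * norm (b x)"
      using a(3) norm_blinfun_le[OF a(2), of "E n x - x"] E(4)[of n x]
      by (intro order_trans[OF norm_triangle_ineq] add_mono) auto
    finally show ?thesis .
  qed
  ultimately have "1 - Re \<langle>(a o\<^sub>L E n) x, y\<rangle> \<le> d + real n * norm (b x)"
    using abs_Re_le_cmod[of "\<langle>(a x - y) + a (E n x - x), y\<rangle>"] by simp
  then have "C * (1 - Re \<langle>(a o\<^sub>L E n) x, y\<rangle>) \<le> C * (d + real n * norm (b x))"
    by (rule mult_left_mono) (rule C)
  then have lower: "1 - Re (f (a o\<^sub>L E n)) \<le> C * (d + real n * norm (b x))"
    using f E(1)[OF a(1), of n] norm_aE unfolding dominated_def by fastforce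
  obtain t where t: "cmod t = 1" "t * f b = of_real (cmod (f b))" using exists_phase by blast
  \<comment> \<open>The phase turns \<open>c * f b\<close> into \<open>z\<close> times the modulus
    of \<open>f b\<close>; the step size \<open>z\<close> stays free until the bound is
    used.\<close>
  define c where "c = of_real z * t"
  have c: "cmod c = z" using t z by (simp add: c_def norm_mult)
  define T where "T = (a o\<^sub>L E n) + c *\<^sub>C b"
  have T: "T \<in> A" unfolding T_def by (intro add scaleC E a b)
  \<comment> \<open>With \<open>w = z / sqrt n + z^2 / 2\<close>, the squared norm of
    \<open>T\<close> will be at most \<open>1 + 2 w\<close>, and \<open>L = 1 + w\<close> bounds its
    root.\<close>
  define L where "L = 1 + z / sqrt (real n) + z\<^sup>2 / 2"
  have L1: "L \<ge> 1" using z by (simp add: L_def)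
  \<comment> \<open>The adjoint is easier to bound: there \<open>E n\<close> and
    \<open>adj b\<close> stand on the left, and the cross term of the two summands is
    \<open>c\<close> times \<open>\<langle>b (E n (adj a v)), v\<rangle>\<close>, which the cutoff
    makes small.\<close>
  have adjT: "adj T v = E n (adj a v) + cnj c *\<^sub>C adj b v" for v
    by (rule cinner_ext_left, unfold cinner_adj[OF T, symmetric])
      (simp add: T_def blinfun.add_left scaleC_blinfun.rep_eq
        cinner.add_left cinner.add_right cinner_scaleC_left cinner_scaleC_right
        cinner_adj[OF a(1)] cinner_adj[OF b(1)] selfadjointD[OF E(2)])
  have "norm (adj T v) \<le> L * norm v" for v
  proof (rule power2_le_imp_le)
    have n1: "norm (E n (adj a v)) \<le> norm v" and n2: "norm (adj b v) \<le> norm v"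
      using E(3)[of n "adj a v"] norm_blinfun_le[of "adj a" v] norm_blinfun_le[of "adj b" v]
        norm_adj[OF a(1)] norm_adj[OF b(1)] a(2) b(2) by auto
    have bE: "norm (b (E n (adj a v))) \<le> norm v / sqrt (real n)"
    proof (rule power2_le_imp_le)
      have "real n * (norm (b (E n (adj a v))))\<^sup>2 \<le> (norm (adj a v))\<^sup>2" by (rule E(5))
      also have "\<dots> \<le> (norm v)\<^sup>2"
        using norm_blinfun_le[of "adj a" v] norm_adj[OF a(1)] a(2) by (intro power_mono) auto
      finally show "(norm (b (E n (adj a v))))\<^sup>2 \<le> (norm v / sqrt (real n))\<^sup>2"
        using n by (simp add: power_divide field_simps)
    qed simp
    have "\<langle>E n (adj a v), cnj c *\<^sub>C adj b v\<rangle> = c * \<langle>b (E n (adj a v)), v\<rangle>"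
      by (simp add: cinner_scaleC_right cinner_adj[OF b(1)])
    then have "inner (E n (adj a v)) (cnj c *\<^sub>C adj b v) \<le> cmod (c * \<langle>b (E n (adj a v)), v\<rangle>)"
      unfolding inner_eq_Re_cinner by (metis complex_Re_le_cmod)
    also have "\<dots> \<le> z * (norm v / sqrt (real n) * norm v)"
      unfolding norm_mult c using z bE
      by (intro mult_left_mono order_trans[OF cinner_cauchy_schwarz] mult_right_mono) auto
    finally have i: "inner (E n (adj a v)) (cnj c *\<^sub>C adj b v) \<le> z / sqrt (real n) * (norm v)\<^sup>2"
      by (simp add: power2_eq_square mult_ac)
    have "(norm (adj T v))\<^sup>2 = (norm (E n (adj a v)))\<^sup>2 + 2 * inner (E n (adj a v)) (cnj c *\<^sub>C adj b v)
        + (norm (cnj c *\<^sub>C adj b v))\<^sup>2"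
      unfolding adjT power2_norm_eq_inner by (simp add: inner_add inner_commute)
    also have "\<dots> \<le> (norm v)\<^sup>2 + 2 * (z / sqrt (real n) * (norm v)\<^sup>2) + z\<^sup>2 * (norm v)\<^sup>2"
      using n1 n2 i c by (intro add_mono mult_left_mono)
        (auto simp: norm_scaleC power_mult_distrib intro!: power_mono mult_left_mono)
    also have "\<dots> = (1 + 2 * (z / sqrt (real n)) + z\<^sup>2) * (norm v)\<^sup>2" by (simp add: algebra_simps)
    also have "\<dots> \<le> L\<^sup>2 * (norm v)\<^sup>2"
    proof (rule mult_right_mono)
      define w where "w = z / sqrt (real n) + z\<^sup>2 / 2"
      have "L\<^sup>2 = 1 + 2 * w + w\<^sup>2" by (simp add: L_def w_def power2_eq_square algebra_simps)
      then show "1 + 2 * (z / sqrt (real n)) + z\<^sup>2 \<le> L\<^sup>2" using zero_le_power2[of w] by (simp add: w_def)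
    qed simp
    finally show "(norm (adj T v))\<^sup>2 \<le> (L * norm v)\<^sup>2" by (simp add: power_mult_distrib)
  qed (use L1 in simp)
  then have "norm (adj T) \<le> L" using L1 by (intro norm_blinfun_bound) auto
  moreover have "adj (adj T) = T" by (rule adj_eqI[OF adj_in[OF T]]) (simp add: cinner_adj'[OF T])
  ultimately have "norm T \<le> L" using norm_adj[OF adj_in[OF T]] by simp
  moreover have "f T = f (a o\<^sub>L E n) + of_real (z * cmod (f b))"
    using f E(1)[OF a(1), of n] b(1) scaleC[OF b(1), of c] t(2)
    by (simp add: dominated_def T_def c_def mult.assoc)
  moreover have "cmod (f T) \<le> norm T" using f T by (simp add: dominated_def)
  ultimately have "z * cmod (f b) \<le> L - Re (f (a o\<^sub>L E n))"
    using complex_Re_le_cmod[of "f T"] by simp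
  also have "\<dots> \<le> z / sqrt (real n) + z\<^sup>2 / 2 + C * (d + real n * norm (b x))"
    using lower by (simp add: L_def)
  finally have "cmod (f b) \<le> (z / sqrt (real n) + z\<^sup>2 / 2 + C * (d + real n * norm (b x))) / z"
    using z by (simp add: field_simps)
  also have "\<dots> = C * (real n * norm (b x)) / z + 1 / sqrt (real n) + z / 2 + C * d / z"
    using z by (simp add: add_divide_distrib distrib_left power2_eq_square)
  finally show "cmod (f b) \<le> C * (real n * norm (b x)) / z + 1 / sqrt (real n) + z / 2 + e"
    using d(2) by simp
qed

text \<open>In \<open>dominated_le\<close>, \<open>z = e\<close> uses up half of \<open>e\<close>
  and a large \<open>n\<close> a quarter; only then is \<open>h\<close> chosen, so that the term
  with \<open>norm (b x)\<close> takes the last quarter.\<close>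

lemma dominated_small:
  assumes f: "dominated x y C f" and x: "norm x = 1" and y: "norm y = 1" and C: "C \<ge> 0" and e: "e > 0"
  obtains h where "h > 0" "\<And>b. \<lbrakk>b \<in> A; norm b \<le> 1; norm (b x) \<le> h\<rbrakk> \<Longrightarrow> cmod (f b) \<le> e"
proof -
  obtain m where m: "1 / real (Suc m) < (e / 4)\<^sup>2"
    using nat_approx_posE[of "(e / 4)\<^sup>2"] e by auto
  define n where "n = Suc m"
  have n: "n > 0" by (simp add: n_def)
  have "1 / sqrt (real n) = sqrt (1 / real n)" by (simp add: real_sqrt_divide)
  also have "\<dots> \<le> sqrt ((e / 4)\<^sup>2)" using m by (intro real_sqrt_le_mono) (simp add: n_def)
  finally have sq: "1 / sqrt (real n) \<le> e / 4" using e by simp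
  define h where "h = e\<^sup>2 / (4 * (C * real n + 1))"
  have pos: "C * real n + 1 > 0" using C by (simp add: add_nonneg_pos)
  have h: "h > 0" using e pos by (simp add: h_def)
  show ?thesis
  proof (rule that[OF h])
    fix b assume b: "b \<in> A" "norm b \<le> 1" "norm (b x) \<le> h"
    have "C * (real n * norm (b x)) \<le> C * (real n * h)" using b C by (intro mult_left_mono) auto
    also have "\<dots> = (C * real n) * h" by simp
    also have "\<dots> \<le> (C * real n + 1) * h" using h by (intro mult_right_mono) auto
    also have "\<dots> = e * e / 4"
    proof -
      have "w * (e\<^sup>2 / (4 * w)) = e * e / 4" if "w > 0" for w :: real
        using that by (simp add: power2_eq_square)
      from this[OF pos] show ?thesis by (simp only: h_def)
    qed
    finally have "C * (real n * norm (b x)) / e \<le> e / 4" using e by (simp add: field_simps)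
    then show "cmod (f b) \<le> e" using dominated_le[OF f x y C b(1,2) n e] sq by linarith
  qed
qed

text \<open>Adjoints exchange \<open>x\<close> and \<open>y\<close>, so the estimate for elements
  small at \<open>x\<close> also serves elements whose adjoint is small at \<open>y\<close>.\<close>

lemma dominated_adj:
  assumes f: "dominated x y C f"
  shows "dominated y x C (\<lambda>T. cnj (f (adj T)))"
  unfolding dominated_def
proof (intro conjI ballI allI impI)
  fix S T c assume S: "S \<in> A" and T: "T \<in> A"
  have "adj (S + T) = adj S + adj T"
    by (rule adj_eqI[OF add[OF S T]])
      (simp add: blinfun.add_left cinner.add_left cinner.add_right cinner_adj S T)
  then show "cnj (f (adj (S + T))) = cnj (f (adj S)) + cnj (f (adj T))"
    using f adj_in S T by (simp add: dominated_def)
next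
  fix T c assume T: "T \<in> A"
  have "adj (c *\<^sub>C T) = cnj c *\<^sub>C adj T"
    by (rule adj_eqI[OF scaleC[OF T]])
      (simp add: scaleC_blinfun.rep_eq cinner_scaleC_left cinner_scaleC_right cinner_adj T)
  then show "cnj (f (adj (c *\<^sub>C T))) = c * cnj (f (adj T))"
    using f adj_in T by (simp add: dominated_def)
next
  fix T assume T: "T \<in> A"
  have "cmod (f (adj T)) \<le> norm (adj T)" using f adj_in[OF T] by (simp add: dominated_def)
  then show "cmod (cnj (f (adj T))) \<le> norm T" using norm_adj[OF T] by simp
next
  fix T assume T: "T \<in> A" "norm T \<le> 1"
  have "Re \<langle>adj T x, y\<rangle> = Re \<langle>T y, x\<rangle>"
    unfolding cinner_adj'[OF T(1)] by (subst cinner_commute) simp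
  moreover have "norm (adj T) \<le> 1" using norm_adj[OF T(1)] T(2) by simp
  ultimately show "1 - Re (cnj (f (adj T))) \<le> C * (1 - Re \<langle>T y, x\<rangle>)"
    using f adj_in[OF T(1)] unfolding dominated_def by fastforce
qed

text \<open>Split \<open>b = q b + (b - q b)\<close>, where \<open>q\<close> is close to the projection onto \<open>y\<close>: the first summand
  almost kills \<open>x\<close>, the adjoint of the second almost kills \<open>y\<close>.\<close>

lemma dominated_kernel:
  assumes f: "dominated x y C f" and x: "norm x = 1" and y: "norm y = 1" and C: "C \<ge> 0"
    and b: "b \<in> A" "\<langle>b x, y\<rangle> = 0"
  shows "f b = 0"
proof -
  \<comment> \<open>Norm at most \<open>1 / 2\<close> leaves room for the splitting:
    \<open>q g\<close> and \<open>g - q g\<close> both remain contractions. The \<open>+ 1\<close>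
    covers \<open>b = 0\<close>.\<close>
  define k where "k = 1 / (2 * (norm b + 1))"
  have k: "k > 0" by (simp add: k_def add_nonneg_pos)
  define g where "g = k *\<^sub>R b"
  have g: "g \<in> A" "\<langle>g x, y\<rangle> = 0"
    using b by (simp_all add: g_def scaleR blinfun.scaleR_left cinner_scaleR_left)
  have "norm g = norm b / (2 * (norm b + 1))" using k by (simp add: g_def) (simp add: k_def)
  also have "\<dots> \<le> 1 / 2" by (simp add: divide_le_eq add_nonneg_pos)
  finally have ng: "norm g \<le> 1 / 2" .
  have "cmod (f g) \<le> e" if e: "e > 0" for e
  proof -
    have e2: "e / 2 > 0" using e by simp
    obtain h1 where h1: "h1 > 0" "\<And>b. \<lbrakk>b \<in> A; norm b \<le> 1; norm (b x) \<le> h1\<rbrakk> \<Longrightarrow> cmod (f b) \<le> e / 2"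
      by (rule dominated_small[OF f x y C e2]) blast
    obtain h2 where h2: "h2 > 0"
      "\<And>b. \<lbrakk>b \<in> A; norm b \<le> 1; norm (b y) \<le> h2\<rbrakk> \<Longrightarrow> cmod (cnj (f (adj b))) \<le> e / 2"
      by (rule dominated_small[OF dominated_adj[OF f] y x C e2]) blast
    \<comment> \<open>Exchanging \<open>y\<close> with itself gives the approximate projection; it
      can be made to almost kill \<open>g x\<close> because that vector is orthogonal to
      \<open>y\<close>.\<close>
    obtain q where q: "q \<in> A" "selfadjoint (blinfun_apply q)" "norm q \<le> 1"
      "norm (q y - y) \<le> min h1 h2" "norm (q (g x)) \<le> min h1 h2"
      by (rule kaplansky_exchange[OF y y _ g(2) g(2), of "min h1 h2"])
        (use h1 h2 y in \<open>simp_all add: cinner_self\<close>)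
    have nqg: "norm (q o\<^sub>L g) \<le> 1 / 2"
      using norm_blinfun_compose[of q g] mult_mono[OF q(3) ng] by simp
    have qg: "q o\<^sub>L g \<in> A" by (intro comp q g)
    have f1: "cmod (f (q o\<^sub>L g)) \<le> e / 2" using q nqg by (intro h1 qg) auto
    define r where "r = g - (q o\<^sub>L g)"
    have r: "r \<in> A" unfolding r_def by (intro diff g qg)
    have nr: "norm r \<le> 1" unfolding r_def using norm_triangle_ineq4[of g "q o\<^sub>L g"] ng nqg by simp
    have "adj r v = adj g (v - q v)" for v
      by (rule cinner_ext_left, unfold cinner_adj[OF r, symmetric])
        (simp add: r_def blinfun.diff_left blinfun.diff_right
          cinner.diff_left cinner.diff_right cinner_adj[OF g(1)] selfadjointD[OF q(2)])
    then have "norm (adj r y) \<le> norm (y - q y)"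
      using norm_blinfun_le[of "adj g" "y - q y"] norm_adj[OF g(1)] ng by simp
    also have "\<dots> \<le> h2" using q(4) by (simp add: norm_minus_commute)
    finally have "cmod (cnj (f (adj (adj r)))) \<le> e / 2"
      using norm_adj[OF r] nr by (intro h2 adj_in r) auto
    moreover have "adj (adj r) = r" by (rule adj_eqI[OF adj_in[OF r]]) (simp add: cinner_adj'[OF r])
    ultimately have f2: "cmod (f r) \<le> e / 2" by simp
    have "g = (q o\<^sub>L g) + r" by (simp add: r_def)
    then have "f g = f (q o\<^sub>L g) + f r" using f qg r unfolding dominated_def by metis
    then show ?thesis using f1 f2 norm_triangle_ineq[of "f (q o\<^sub>L g)" "f r"] by simp
  qed
  then have "f g = 0" using field_le_epsilon[of "cmod (f g)" 0] by auto
  moreover have "f g = of_real k * f b"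
    using f b by (simp add: g_def scaleR_scaleC dominated_def)
  ultimately show ?thesis using k by simp
qed

text \<open>By \<open>dominated_kernel\<close>, \<open>f\<close> is a multiple \<open>k\<close> of
  \<open>\<omega> x y\<close> on \<open>A\<close>. Along contractions \<open>a n\<close> with
  \<open>a n x\<close> tending to \<open>y\<close>, the norm bound gives
  \<open>cmod k \<le> 1\<close> and the domination \<open>Re k \<ge> 1\<close>.\<close>

lemma dominated_eq:
  assumes f: "dominated x y C f" and x: "norm x = 1" and y: "norm y = 1" and C: "C \<ge> 0"
    and T: "T \<in> A"
  shows "f T = \<langle>T x, y\<rangle>"
proof -
  have "\<exists>a\<in>A. norm a \<le> 1 \<and> norm (blinfun_apply a x - y) \<le> 1 / real (Suc n)" for n
    using exists_transport[OF x y, of "1 / real (Suc n)"] by auto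
  then obtain a where a: "\<And>n. a n \<in> A" "\<And>n. norm (a n) \<le> 1" "\<And>n. norm (blinfun_apply (a n) x - y) \<le> 1 / real (Suc n)"
    by metis
  have "(\<lambda>n. a n x - y) \<longlonglongrightarrow> 0"
    by (rule Lim_null_comparison[OF _ LIMSEQ_Suc[OF lim_1_over_n]]) (use a(3) in auto)
  from cinner.tendsto[OF this tendsto_const[of y]]
  have lim: "(\<lambda>n. \<langle>a n x, y\<rangle>) \<longlonglongrightarrow> 1"
    using y by (simp add: cinner.diff_left cinner.zero_left cinner_self LIM_zero_iff)
  then have "\<forall>\<^sub>F n in sequentially. \<langle>a n x, y\<rangle> \<noteq> 0"
    by (rule tendsto_imp_eventually_ne) simp
  then obtain m where m: "\<langle>a m x, y\<rangle> \<noteq> 0"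
    using eventually_happens'[OF sequentially_bot] by blast
  define k where "k = f (a m) / \<langle>a m x, y\<rangle>"
  have k: "f S = k * \<langle>S x, y\<rangle>" if S: "S \<in> A" for S
  proof -
    define s where "s = \<langle>S x, y\<rangle> / \<langle>a m x, y\<rangle>"
    have "f (S + (- s) *\<^sub>C a m) = 0"
      by (rule dominated_kernel[OF f x y C])
        (use S a m in \<open>auto simp: s_def blinfun.diff_left scaleC_blinfun.rep_eq cinner.diff_left
          cinner_scaleC_left intro!: diff scaleC\<close>)
    moreover have "f (S + (- s) *\<^sub>C a m) = f S + (- s) * f (a m)"
      using f S a(1)[of m] scaleC[OF a(1), of "- s" m] unfolding dominated_def by metis
    ultimately show ?thesis using m by (simp add: s_def k_def field_simps)
  qed
  have lim_f: "(\<lambda>n. f (a n)) \<longlonglongrightarrow> k"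
    using tendsto_mult[OF tendsto_const[of k] lim] k[OF a(1)] by simp
  have "cmod k \<le> 1"
  proof (rule LIMSEQ_le_const2[OF tendsto_norm[OF lim_f]], intro exI allI impI)
    show "cmod (f (a n)) \<le> 1" for n
      using f a(1,2)[of n] unfolding dominated_def by (meson order_trans)
  qed
  moreover have "1 - Re k \<le> C * (1 - Re 1)"
  proof (rule LIMSEQ_le)
    show "(\<lambda>n. 1 - Re (f (a n))) \<longlonglongrightarrow> 1 - Re k" by (intro tendsto_intros lim_f)
    show "(\<lambda>n. C * (1 - Re \<langle>a n x, y\<rangle>)) \<longlonglongrightarrow> C * (1 - Re 1)" by (intro tendsto_intros lim)
    show "\<exists>N. \<forall>n\<ge>N. 1 - Re (f (a n)) \<le> C * (1 - Re \<langle>a n x, y\<rangle>)"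
      using f a(1,2) unfolding dominated_def by blast
  qed
  ultimately have "Re k = 1" "cmod k = 1" using complex_Re_le_cmod[of k] by auto
  then have "k = 1" by (simp add: complex_eq_iff cmod_def)
  then show ?thesis using k[OF T] by simp
qed

text \<open>Passing to unit vectors rescales the functional by a positive number and keeps its
  kernel. If it lies strictly between two members of the dual ball, both are dominated by it and so
  equal to it on \<open>A\<close>; outside \<open>A\<close> all members of the ball are
  zero.\<close>

lemma normal_part_subset: "normal_part A \<subseteq> structure_space A"
proof
  fix I assume "I \<in> normal_part A"
  then obtain x0 y0 where I: "I = ker_on A (\<omega> x0 y0)" and 0: "x0 \<noteq> 0" "y0 \<noteq> 0"
    by (auto simp: normal_part_def)
  define x where "x = sgn x0"
  define y where "y = sgn y0"
  have x: "norm x = 1" and y: "norm y = 1" using 0 by (simp_all add: x_def y_def norm_sgn)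
  define \<rho> where "\<rho> = (\<lambda>T. if T \<in> A then \<langle>blinfun_apply T x, y\<rangle> else 0)"
  have "\<langle>T x, y\<rangle> = of_real (inverse (norm x0) * inverse (norm y0)) * \<langle>T x0, y0\<rangle>" for T :: "'a \<Rightarrow>\<^sub>L 'a"
    by (simp add: x_def y_def sgn_div_norm blinfun.scaleR_right cinner_scaleR_left cinner_scaleR_right)
  then have ker: "I = ker_on A \<rho>"
    using 0 by (auto simp: I ker_on_def \<rho>_def vector_functional_def)
  have bound: "cmod \<langle>T x, y\<rangle> \<le> norm T" for T :: "'a \<Rightarrow>\<^sub>L 'a"
    using cinner_cauchy_schwarz[of "T x" y] norm_blinfun[of T x] x y by simp
  have mem: "\<rho> \<in> dual_ball A"
    using bound by (auto simp: dual_ball_def \<rho>_def add scaleC blinfun.add_left cinner.add_left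
        scaleC_blinfun.rep_eq cinner_scaleC_left)
  have dom: "f T = \<langle>T x, y\<rangle>"
    if f: "f \<in> dual_ball A" and g: "g \<in> dual_ball A" and s: "0 < s" "s < 1"
      and \<rho>: "\<rho> = s *\<^sub>R f + (1 - s) *\<^sub>R g" and T: "T \<in> A" for f g s T
  proof (rule dominated_eq[OF _ x y _ T])
    show "0 \<le> 1 / s" using s by simp
    have "1 - Re (f S) \<le> 1 / s * (1 - Re \<langle>S x, y\<rangle>)" if S: "S \<in> A" "norm S \<le> 1" for S
    proof -
      have "\<langle>S x, y\<rangle> = s *\<^sub>R f S + (1 - s) *\<^sub>R g S"
        using arg_cong[OF \<rho>, of "\<lambda>h. h S"] S(1) by (simp add: \<rho>_def scaleR_fun_def)
      then have "Re \<langle>S x, y\<rangle> = s * Re (f S) + (1 - s) * Re (g S)" by simp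
      moreover have "(1 - s) * Re (g S) \<le> (1 - s) * 1"
      proof (rule mult_left_mono)
        have "cmod (g S) \<le> 1" using g S by (auto simp: dual_ball_def intro: order_trans)
        then show "Re (g S) \<le> 1" using complex_Re_le_cmod[of "g S"] by simp
      qed (use s in simp)
      ultimately have "s * (1 - Re (f S)) \<le> 1 - Re \<langle>S x, y\<rangle>" by (simp add: right_diff_distrib)
      then show ?thesis using s by (simp add: field_simps)
    qed
    then show "dominated x y (1 / s) f" using f by (auto simp: dominated_def dual_ball_def)
  qed
  have "\<rho> \<notin> open_segment f g" if f: "f \<in> dual_ball A" and g: "g \<in> dual_ball A" for f g
  proof
    assume "\<rho> \<in> open_segment f g"
    then obtain u where u: "f \<noteq> g" "0 < u" "u < 1" "\<rho> = (1 - u) *\<^sub>R f + u *\<^sub>R g"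
      by (auto simp: in_segment)
    have "f T = g T" for T
    proof (cases "T \<in> A")
      case True
      then show ?thesis
        using dom[OF f g, of "1 - u" T] dom[OF g f, of u T] u by (simp add: add.commute)
    next
      case False
      then show ?thesis using f g by (simp add: dual_ball_def)
    qed
    then show False using u(1) by auto
  qed
  then have "\<rho> extreme_point_of dual_ball A" using mem by (auto simp: extreme_point_of_def)
  then show "I \<in> structure_space A" using ker by (auto simp: structure_space_def)
qed

end

section \<open>Transport of kernels\<close>

text \<open>Either \<open>g j\<close> already vanishes on the common kernel of the others, or some
  \<open>S\<close> in that kernel has \<open>g j S \<noteq> 0\<close>, and subtracting the multiple
  of \<open>g j\<close> that agrees with \<open>f\<close> at \<open>S\<close> leaves a functional
  for the smaller index set.\<close>

lemma finite_kernel_combination: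
  fixes A :: "'v :: complex_vector set"
  assumes "finite I" and A: "complex_vector.subspace A"
    and g: "\<And>i S T. \<lbrakk>S \<in> A; T \<in> A\<rbrakk> \<Longrightarrow> g i (S + T) = g i S + g i T"
      "\<And>i c T. T \<in> A \<Longrightarrow> g i (c *\<^sub>C T) = c * g i T"
    and f: "\<And>S T. \<lbrakk>S \<in> A; T \<in> A\<rbrakk> \<Longrightarrow> f (S + T) = f S + f T"
      "\<And>c T. T \<in> A \<Longrightarrow> f (c *\<^sub>C T) = c * (f T :: complex)"
    and ker: "\<And>T. \<lbrakk>T \<in> A; \<And>i. i \<in> I \<Longrightarrow> g i T = 0\<rbrakk> \<Longrightarrow> f T = 0"
  shows "\<exists>c. \<forall>T\<in>A. f T = (\<Sum>i\<in>I. c i * g i T)"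
  using assms(1) f ker
proof (induction I arbitrary: f)
  case empty
  then show ?case by simp
next
  case (insert j I)
  show ?case
  proof (cases "\<exists>S\<in>A. (\<forall>i\<in>I. g i S = 0) \<and> g j S \<noteq> 0")
    case False
    then have "\<exists>c. \<forall>T\<in>A. f T = (\<Sum>i\<in>I. c i * g i T)" by (intro insert) auto
    then obtain c where c: "\<forall>T\<in>A. f T = (\<Sum>i\<in>I. c i * g i T)" ..
    have "(\<Sum>i\<in>insert j I. (c(j := 0)) i * g i T) = (\<Sum>i\<in>I. c i * g i T)" for T
      using insert.hyps by (auto intro!: sum.cong)
    then show ?thesis using c by metis
  next
    case True
    then obtain S where S: "S \<in> A" "\<And>i. i \<in> I \<Longrightarrow> g i S = 0" "g j S \<noteq> 0" by blast
    define k where "k = f S / g j S"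
    define h where "h T = f T - k * g j T" for T
    have "\<exists>c. \<forall>T\<in>A. h T = (\<Sum>i\<in>I. c i * g i T)"
    proof (rule insert.IH)
      show "h (R + T) = h R + h T" if "R \<in> A" "T \<in> A" for R T
        using that by (simp add: h_def insert.prems g algebra_simps)
      show "h (c *\<^sub>C T) = c * h T" if "T \<in> A" for c T
        using that by (simp add: h_def insert.prems g algebra_simps)
      show "h T = 0" if T: "T \<in> A" "\<And>i. i \<in> I \<Longrightarrow> g i T = 0" for T
      proof -
        define s where "s = - (g j T / g j S)"
        have sS: "s *\<^sub>C S \<in> A" using S(1) A complex_vector.subspace_scale by blast
        have "f (T + s *\<^sub>C S) = 0"
        proof (rule insert.prems(3))
          show "T + s *\<^sub>C S \<in> A" using T(1) sS A complex_vector.subspace_add by blast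
          show "g i (T + s *\<^sub>C S) = 0" if "i \<in> insert j I" for i
          proof -
            have "g i (T + s *\<^sub>C S) = g i T + s * g i S" by (simp only: g(1)[OF T(1) sS] g(2)[OF S(1)])
            then show ?thesis using that S T by (auto simp: s_def)
          qed
        qed
        then have "f T + s * f S = 0" using insert.prems S(1) T(1) sS by simp
        then show ?thesis by (simp add: h_def k_def s_def)
      qed
    qed
    then obtain c where c: "\<forall>T\<in>A. h T = (\<Sum>i\<in>I. c i * g i T)" ..
    have "f T = (\<Sum>i\<in>insert j I. (c(j := k)) i * g i T)" if "T \<in> A" for T
    proof -
      have "(\<Sum>i\<in>I. (c(j := k)) i * g i T) = (\<Sum>i\<in>I. c i * g i T)"
        using insert.hyps by (auto intro!: sum.cong)
      then show ?thesis using c that insert.hyps by (simp add: h_def algebra_simps)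
    qed
    then show ?thesis by blast
  qed
qed

lemma mem_ker_vector: "T \<in> ker_on A (\<omega> x y) \<longleftrightarrow> T \<in> A \<and> \<langle>T x, y\<rangle> = 0"
  by (simp add: ker_on_def vector_functional_def)

context irreducible_algebra
begin

lemma mem_normal_closure: "I \<in> normal_closure A S \<longleftrightarrow> I \<in> normal_part A \<and> A \<inter> \<Inter>S \<subseteq> I"
  using normal_part_subset by (auto simp: normal_closure_def subspace_closure_def structure_closure_def)

text \<open>The inclusion of kernels is a linear relation between vector functionals on
  \<open>A\<close>, and \<open>density\<close> carries this relation over to the form
  \<open>b\<close>.\<close>

lemma sesquilinear_transport:
  fixes x y :: "'i \<Rightarrow> 'a"
  assumes fin: "finite I"
    and ker: "\<And>T. \<lbrakk>T \<in> A; \<And>i. i \<in> I \<Longrightarrow> \<langle>T (x i), y i\<rangle> = 0\<rbrakk> \<Longrightarrow> \<langle>T x0, y0\<rangle> = 0"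
    and b: "sesquilinear b" and zero: "\<And>i. i \<in> I \<Longrightarrow> b (x i) (y i) = 0"
  shows "b x0 y0 = 0"
proof -
  have "\<exists>c. \<forall>T\<in>A. \<langle>T x0, y0\<rangle> = (\<Sum>i\<in>I. c i * \<langle>T (x i), y i\<rangle>)"
    by (rule finite_kernel_combination[OF fin subsp])
      (use ker in \<open>auto simp: blinfun.add_left cinner.add_left scaleC_blinfun.rep_eq cinner_scaleC_left\<close>)
  then obtain c where c: "\<And>T. T \<in> A \<Longrightarrow> \<langle>T x0, y0\<rangle> = (\<Sum>i\<in>I. c i * \<langle>T (x i), y i\<rangle>)" by blast
  \<comment> \<open>\<open>None\<close> carries the pair \<open>(x0, y0)\<close>; the coefficients
    go with a minus sign into the first vectors, so that the relation becomes one vanishing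
    sum.\<close>
  define u where "u = case_option x0 (\<lambda>i. (- c i) *\<^sub>C x i)"
  define v where "v = case_option y0 y"
  have split: "(\<Sum>i\<in>insert None (Some ` I). g i) = g None + (\<Sum>i\<in>I. g (Some i))" for g :: "_ \<Rightarrow> complex"
    using fin by (subst sum.insert) (auto simp: sum.reindex)
  have "(\<Sum>i\<in>insert None (Some ` I). b (u i) (v i)) = 0"
  proof (rule density[OF _ _ b])
    show "(\<Sum>i\<in>insert None (Some ` I). \<langle>T (u i), v i\<rangle>) = 0" if "T \<in> A" for T
      unfolding split
      by (simp add: u_def v_def apply_scaleC[OF that] cinner_scaleC_left c[OF that] sum_negf
          complex_vector.scale_minus_left blinfun.minus_right cinner.minus_left)
  qed (use fin in simp)
  moreover have "b ((- c i) *\<^sub>C x i) (y i) = 0" if "i \<in> I" for i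
    using b zero[OF that] unfolding sesquilinear_def by (metis mult_zero_right)
  ultimately show ?thesis unfolding split by (simp add: u_def v_def)
qed

end

section \<open>Pairs of bijections of the same kind, and the induced map on kernels\<close>

definition colinear :: "('a :: complex_vector \<Rightarrow> 'b :: complex_vector) \<Rightarrow> ('a \<Rightarrow> 'b) \<Rightarrow> bool" where
  "colinear U V \<longleftrightarrow> clinear U \<and> clinear V \<or> antilinear U \<and> antilinear V"

lemma clinear_inv:
  assumes "bij U" "clinear U" shows "clinear (inv U)"
  unfolding clinear_iff
proof (intro conjI allI)
  show "inv U (x + y) = inv U x + inv U y" for x y
    by (rule inv_f_eq[OF bij_is_inj[OF assms(1)]])
      (use assms in \<open>simp add: clinear_iff surj_f_inv_f bij_is_surj\<close>)
  show "inv U (c *\<^sub>C x) = c *\<^sub>C inv U x" for c x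
    by (rule inv_f_eq[OF bij_is_inj[OF assms(1)]])
      (use assms in \<open>simp add: clinear_iff surj_f_inv_f bij_is_surj\<close>)
qed

lemma antilinear_inv:
  assumes "bij U" "antilinear U" shows "antilinear (inv U)"
  unfolding antilinear_def
proof (intro conjI allI)
  show "inv U (x + y) = inv U x + inv U y" for x y
    by (rule inv_f_eq[OF bij_is_inj[OF assms(1)]])
      (use assms in \<open>simp add: antilinear_def surj_f_inv_f bij_is_surj\<close>)
  show "inv U (c *\<^sub>C x) = cnj c *\<^sub>C inv U x" for c x
    by (rule inv_f_eq[OF bij_is_inj[OF assms(1)]])
      (use assms in \<open>simp add: antilinear_def surj_f_inv_f bij_is_surj\<close>)
qed

lemma colinear_inv: "colinear U V \<Longrightarrow> bij U \<Longrightarrow> bij V \<Longrightarrow> colinear (inv U) (inv V)"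
  by (auto simp: colinear_def clinear_inv antilinear_inv)

lemma colinear_zero:
  assumes "colinear U V" shows "U 0 = 0" "V 0 = 0"
proof -
  have "F 0 = 0" if "clinear F \<or> antilinear F" for F :: "'a \<Rightarrow> 'b"
    using that unfolding clinear_iff antilinear_def by (metis add_cancel_left_left)
  then show "U 0 = 0" "V 0 = 0" using assms by (auto simp: colinear_def)
qed

lemma colinear_nonzero:
  assumes "colinear U V" "bij U" "bij V" "x \<noteq> 0" shows "U x \<noteq> 0" "V x \<noteq> 0"
  using assms(2-4) colinear_zero[OF assms(1)] by (metis bij_is_inj injD)+

text \<open>For conjugate-linear \<open>U\<close> and \<open>V\<close> the form is linear in the
  wrong argument; its complex conjugate has the right type and the same zeros, which is all that
  kernels see.\<close>

lemma sesquilinear_pullback: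
  assumes "colinear U V" "clinear T"
  obtains b where "sesquilinear b" "\<And>x y. b x y = 0 \<longleftrightarrow> \<langle>T (U x), V y\<rangle> = 0"
proof (cases "clinear U \<and> clinear V")
  case True
  then have "sesquilinear (\<lambda>x y. \<langle>T (U x), V y\<rangle>)"
    using assms(2) by (simp add: sesquilinear_def clinear_iff cinner.add_left cinner.add_right
        cinner_scaleC_left cinner_scaleC_right)
  then show ?thesis by (rule that) simp
next
  case False
  then have "antilinear U" "antilinear V" using assms(1) by (auto simp: colinear_def)
  then have "sesquilinear (\<lambda>x y. cnj \<langle>T (U x), V y\<rangle>)"
    using assms(2) by (simp add: sesquilinear_def clinear_iff antilinear_def cinner.add_left
        cinner.add_right cinner_scaleC_left cinner_scaleC_right)
  then show ?thesis by (rule that) simp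
qed

lemma kernel_transport:
  fixes x y :: "'i \<Rightarrow> 'a :: complex_hilbert_space"
    and A :: "('a \<Rightarrow>\<^sub>L 'a) set" and B :: "('b :: complex_hilbert_space \<Rightarrow>\<^sub>L 'b) set"
  assumes A: "irreducible_algebra A" and B: "irreducible_algebra B"
    and UV: "colinear U V" and fin: "finite I"
    and sub: "A \<inter> (\<Inter>i\<in>I. ker_on A (\<omega> (x i) (y i))) \<subseteq> ker_on A (\<omega> x0 y0)"
  shows "B \<inter> (\<Inter>i\<in>I. ker_on B (\<omega> (U (x i)) (V (y i)))) \<subseteq> ker_on B (\<omega> (U x0) (V y0))"
proof
  interpret A: irreducible_algebra A by fact
  interpret B: irreducible_algebra B by fact
  fix T assume T: "T \<in> B \<inter> (\<Inter>i\<in>I. ker_on B (\<omega> (U (x i)) (V (y i))))"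
  then have TB: "T \<in> B" and T0: "\<And>i. i \<in> I \<Longrightarrow> \<langle>T (U (x i)), V (y i)\<rangle> = 0"
    by (auto simp: mem_ker_vector)
  obtain b where b: "sesquilinear b" "\<And>x y. b x y = 0 \<longleftrightarrow> \<langle>T (U x), V y\<rangle> = 0"
    by (rule sesquilinear_pullback[OF UV B.clinear_A[OF TB]]) blast
  have "b x0 y0 = 0"
    by (rule A.sesquilinear_transport[OF fin _ b(1), of x y])
      (use sub b(2) T0 in \<open>auto simp: mem_ker_vector\<close>)
  then show "T \<in> ker_on B (\<omega> (U x0) (V y0))" using TB b(2) by (simp add: mem_ker_vector)
qed

text \<open>A kernel does not determine its vectors, so a representing pair is chosen;
  \<open>kernel_cong\<close> shows that the choice is immaterial.\<close>

definition kernel_map ::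
    "('a :: complex_hilbert_space \<Rightarrow>\<^sub>L 'a) set \<Rightarrow> ('b :: complex_hilbert_space \<Rightarrow>\<^sub>L 'b) set \<Rightarrow>
      ('a \<Rightarrow> 'b) \<Rightarrow> ('a \<Rightarrow> 'b) \<Rightarrow> ('a \<Rightarrow>\<^sub>L 'a) set \<Rightarrow> ('b \<Rightarrow>\<^sub>L 'b) set" where
  "kernel_map A B U V I =
     (SOME J. \<exists>x y. x \<noteq> 0 \<and> y \<noteq> 0 \<and> I = ker_on A (\<omega> x y) \<and> J = ker_on B (\<omega> (U x) (V y)))"

locale algebra_pair = A: irreducible_algebra A + B: irreducible_algebra B
  for A :: "('a :: complex_hilbert_space \<Rightarrow>\<^sub>L 'a) set"
    and B :: "('b :: complex_hilbert_space \<Rightarrow>\<^sub>L 'b) set" +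
  fixes U V :: "'a \<Rightarrow> 'b"
  assumes colinear: "colinear U V" and bij: "bij U" "bij V"
begin

lemma nonzero: "x \<noteq> 0 \<Longrightarrow> U x \<noteq> 0" "x \<noteq> 0 \<Longrightarrow> V x \<noteq> 0"
  using colinear_nonzero[OF colinear bij] by blast+

text \<open>Well-definedness is the case of a single kernel in \<open>kernel_transport\<close>,
  applied in both directions.\<close>

lemma kernel_cong:
  assumes "ker_on A (\<omega> x y) = ker_on A (\<omega> x' y')"
  shows "ker_on B (\<omega> (U x) (V y)) = ker_on B (\<omega> (U x') (V y'))"
proof -
  have "ker_on B (\<omega> (U x) (V y)) \<subseteq> ker_on B (\<omega> (U x') (V y'))"
    if "ker_on A (\<omega> x y) = ker_on A (\<omega> x' y')" for x y x' y'
    using kernel_transport[OF A.irreducible_algebra_axioms B.irreducible_algebra_axioms colinear,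
        of "{()}" "\<lambda>_. x" "\<lambda>_. y" x' y'] that
    by (auto simp: ker_on_def)
  then show ?thesis using assms by blast
qed

lemma kernel_map:
  assumes "x \<noteq> 0" "y \<noteq> 0"
  shows "kernel_map A B U V (ker_on A (\<omega> x y)) = ker_on B (\<omega> (U x) (V y))"
  unfolding kernel_map_def by (rule some_equality) (use assms kernel_cong in blast)+

lemma normal_partE:
  assumes "I \<in> normal_part A"
  obtains x y where "x \<noteq> 0" "y \<noteq> 0" "I = ker_on A (\<omega> x y)"
    "kernel_map A B U V I = ker_on B (\<omega> (U x) (V y))"
proof -
  obtain x y where "x \<noteq> 0" "y \<noteq> 0" "I = ker_on A (\<omega> x y)"
    using assms unfolding normal_part_def by blast
  then show ?thesis using kernel_map that by blast
qed

lemma kernel_map_in: "kernel_map A B U V \<in> normal_part A \<rightarrow> normal_part B"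
proof
  fix I assume "I \<in> normal_part A"
  then obtain x y where "x \<noteq> 0" "y \<noteq> 0" "kernel_map A B U V I = ker_on B (\<omega> (U x) (V y))"
    by (rule normal_partE)
  then show "kernel_map A B U V I \<in> normal_part B" using nonzero unfolding normal_part_def by blast
qed

lemma finitely_continuous_kernel_map:
  "finitely_continuous (normal_part A) (normal_closure A) (normal_part B) (normal_closure B)
    (kernel_map A B U V)"
  unfolding finitely_continuous_def
proof (intro conjI allI impI kernel_map_in image_subsetI)
  fix S I assume S: "S \<subseteq> normal_part A" "finite S" and I: "I \<in> normal_closure A S"
  then have IN: "I \<in> normal_part A" and IS: "A \<inter> \<Inter>S \<subseteq> I" by (auto simp: A.mem_normal_closure)
  obtain x0 y0 where 0: "I = ker_on A (\<omega> x0 y0)" "kernel_map A B U V I = ker_on B (\<omega> (U x0) (V y0))"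
    using IN by (rule normal_partE)
  have "\<exists>p. s = ker_on A (\<omega> (fst p) (snd p)) \<and>
      kernel_map A B U V s = ker_on B (\<omega> (U (fst p)) (V (snd p)))" if "s \<in> S" for s
    using subsetD[OF S(1) that] by (rule normal_partE) (rule exI[of _ "(_, _)"], simp)
  then obtain p where p: "\<And>s. s \<in> S \<Longrightarrow> ker_on A (\<omega> (fst (p s)) (snd (p s))) = s"
    "\<And>s. s \<in> S \<Longrightarrow> ker_on B (\<omega> (U (fst (p s))) (V (snd (p s)))) = kernel_map A B U V s" by metis
  have "A \<inter> (\<Inter>s\<in>S. ker_on A (\<omega> (fst (p s)) (snd (p s)))) \<subseteq> ker_on A (\<omega> x0 y0)"
    using IS by (simp add: p(1) flip: 0(1))
  from kernel_transport[OF A.irreducible_algebra_axioms B.irreducible_algebra_axioms colinear S(2) this]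
  have "B \<inter> \<Inter>(kernel_map A B U V ` S) \<subseteq> kernel_map A B U V I"
    by (simp add: p(2) 0(2))
  then show "kernel_map A B U V I \<in> normal_closure B (kernel_map A B U V ` S)"
    using kernel_map_in IN by (auto simp: B.mem_normal_closure)
qed

text \<open>The hypothesis compares zero sets only, so that it also serves the inverse map, where no
  adjoint of \<open>inv V\<close> is formed.\<close>

lemma continuous_kernel_mapI:
  assumes "\<And>T. T \<in> B \<Longrightarrow> \<exists>a\<in>A. \<forall>x y. \<langle>a x, y\<rangle> = 0 \<longleftrightarrow> \<langle>T (U x), V y\<rangle> = 0"
  shows "closure_continuous (normal_part A) (normal_closure A) (normal_part B) (normal_closure B)
    (kernel_map A B U V)"
  unfolding closure_continuous_def
proof (intro conjI allI impI kernel_map_in image_subsetI)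
  fix S I assume S: "S \<subseteq> normal_part A" and I: "I \<in> normal_closure A S"
  then have IN: "I \<in> normal_part A" and IS: "A \<inter> \<Inter>S \<subseteq> I" by (auto simp: A.mem_normal_closure)
  have iff: "a \<in> J \<longleftrightarrow> T \<in> kernel_map A B U V J"
    if "J \<in> normal_part A" "a \<in> A" "T \<in> B" "\<forall>x y. \<langle>a x, y\<rangle> = 0 \<longleftrightarrow> \<langle>T (U x), V y\<rangle> = 0" for J a T
    using that(1) by (rule normal_partE) (use that in \<open>simp add: mem_ker_vector\<close>)
  have "T \<in> kernel_map A B U V I" if T: "T \<in> B" "T \<in> \<Inter>(kernel_map A B U V ` S)" for T
  proof -
    obtain a where a: "a \<in> A" "\<forall>x y. \<langle>a x, y\<rangle> = 0 \<longleftrightarrow> \<langle>T (U x), V y\<rangle> = 0"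
      using assms[OF T(1)] by blast
    have "a \<in> s" if "s \<in> S" for s using iff[OF _ a(1) T(1) a(2)] S T(2) that by blast
    then have "a \<in> I" using IS a(1) by blast
    then show ?thesis using iff[OF IN a(1) T(1) a(2)] by blast
  qed
  then show "kernel_map A B U V I \<in> normal_closure B (kernel_map A B U V ` S)"
    using kernel_map_in IN by (auto simp: B.mem_normal_closure)
qed

lemma continuous_kernel_mapD:
  assumes cont: "closure_continuous (normal_part A) (normal_closure A) (normal_part B) (normal_closure B)
      (kernel_map A B U V)"
    and T: "T \<in> B" and ne: "\<langle>T (U x0), V y0\<rangle> \<noteq> 0"
  obtains a where "a \<in> A" "\<And>x y. \<langle>T (U x), V y\<rangle> = 0 \<Longrightarrow> \<langle>a x, y\<rangle> = 0" "\<langle>a x0, y0\<rangle> \<noteq> 0"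
proof -
  have 0: "x0 \<noteq> 0" "y0 \<noteq> 0"
    using ne colinear_zero[OF colinear] by (auto simp: blinfun.zero_right cinner.zero_left cinner.zero_right)
  define S where "S = {ker_on A (\<omega> x y) |x y. x \<noteq> 0 \<and> y \<noteq> 0 \<and> \<langle>T (U x), V y\<rangle> = 0}"
  define I where "I = ker_on A (\<omega> x0 y0)"
  have SN: "S \<subseteq> normal_part A" by (auto simp: S_def normal_part_def)
  have IN: "I \<in> normal_part A" using 0 by (auto simp: I_def normal_part_def)
  have "T \<in> kernel_map A B U V s" if "s \<in> S" for s
    using that T kernel_map by (auto simp: S_def mem_ker_vector)
  moreover have "T \<notin> kernel_map A B U V I" using ne 0 kernel_map by (simp add: I_def mem_ker_vector)
  ultimately have "kernel_map A B U V I \<notin> normal_closure B (kernel_map A B U V ` S)"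
    using T by (auto simp: B.mem_normal_closure)
  then have "I \<notin> normal_closure A S" using cont SN unfolding closure_continuous_def by blast
  then obtain a where a: "a \<in> A" "a \<in> \<Inter>S" "a \<notin> I" using IN by (auto simp: A.mem_normal_closure)
  \<comment> \<open>Pairs containing the zero vector do not occur in \<open>S\<close> and are
    settled directly.\<close>
  have "\<langle>a x, y\<rangle> = 0" if "\<langle>T (U x), V y\<rangle> = 0" for x y
  proof (cases "x = 0 \<or> y = 0")
    case True
    then show ?thesis by (auto simp: blinfun.zero_right cinner.zero_left cinner.zero_right)
  next
    case False
    then have "ker_on A (\<omega> x y) \<in> S" using that by (auto simp: S_def)
    then show ?thesis using a(2) by (auto simp: mem_ker_vector)
  qed
  moreover have "\<langle>a x0, y0\<rangle> \<noteq> 0" using a by (simp add: I_def mem_ker_vector)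
  ultimately show ?thesis using that a(1) by blast
qed

end

section \<open>Proportional sesquilinear forms\<close>

text \<open>The difference \<open>b\<close> of \<open>a\<close> and \<open>c * r\<close> vanishes at
  the zeros of \<open>r\<close> and at \<open>(x0, y0)\<close>. Shifting an argument along
  \<open>x0\<close> or \<open>y0\<close> reaches a zero of \<open>r\<close>, which kills
  \<open>b\<close> first on the row \<open>x0\<close> and the column \<open>y0\<close>, then
  everywhere.\<close>

lemma sesquilinear_proportional:
  assumes r: "sesquilinear r" and a: "sesquilinear a"
    and zero: "\<And>x y. r x y = 0 \<Longrightarrow> a x y = 0" and ne: "r x0 y0 \<noteq> 0"
  obtains c where "\<And>x y. a x y = c * r x y"
proof
  define c where "c = a x0 y0 / r x0 y0"
  define b where "b x y = a x y - c * r x y" for x y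
  have b: "sesquilinear b" using r a by (simp add: sesquilinear_def b_def algebra_simps)
  have r_lin: "r (x + s *\<^sub>C z) w = r x w + s * r z w" "r w (x + s *\<^sub>C z) = r w x + cnj s * r w z"
    and b_lin: "b (x + s *\<^sub>C z) w = b x w + s * b z w" "b w (x + s *\<^sub>C z) = b w x + cnj s * b w z"
    for x z w s
    using r b by (simp_all add: sesquilinear_def)
  have b0: "b x y = 0" if "r x y = 0" for x y using that zero by (simp add: b_def)
  have b00: "b x0 y0 = 0" using ne by (simp add: b_def c_def)
  have b_left: "b x0 w = 0" for w
  proof -
    define s where "s = - cnj (r x0 w / r x0 y0)"
    have "r x0 w + cnj s * r x0 y0 = 0" using ne by (simp add: s_def)
    then have "b x0 (w + s *\<^sub>C y0) = 0" using b0 by (simp only: r_lin)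
    then show ?thesis by (simp add: b_lin b00)
  qed
  have b_right: "b v y0 = 0" for v
  proof -
    define s where "s = - (r v y0 / r x0 y0)"
    have "r v y0 + s * r x0 y0 = 0" using ne by (simp add: s_def)
    then have "b (v + s *\<^sub>C x0) y0 = 0" using b0 by (simp only: r_lin)
    then show ?thesis by (simp add: b_lin b00)
  qed
  fix x y
  \<comment> \<open>A nonzero \<open>r x0 w\<close> allows \<open>x\<close> to be shifted along
    \<open>x0\<close> to a zero of \<open>r\<close>; replacing \<open>y\<close> by \<open>w\<close>
    is harmless because \<open>b\<close> vanishes on the column \<open>y0\<close>.\<close>
  obtain t where t: "r x0 (y + t *\<^sub>C y0) \<noteq> 0"
  proof (cases "r x0 y = 0")
    case True
    then have "r x0 (y + 1 *\<^sub>C y0) \<noteq> 0" using ne unfolding r_lin by simp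
    then show ?thesis by (rule that)
  next
    case False
    then have "r x0 (y + 0 *\<^sub>C y0) \<noteq> 0" unfolding r_lin by simp
    then show ?thesis by (rule that)
  qed
  define w where "w = y + t *\<^sub>C y0"
  define s where "s = - (r x w / r x0 w)"
  have "r x w + s * r x0 w = 0" using t by (simp add: s_def w_def)
  then have "b (x + s *\<^sub>C x0) w = 0" using b0 by (simp only: r_lin)
  then have "b x w = 0" by (simp add: b_lin b_left)
  then have "b x y = 0" by (simp add: w_def b_lin b_right)
  then show "a x y = c * r x y" by (simp add: b_def)
qed

section \<open>Continuity of the kernel map\<close>

context algebra_pair
begin

definition pullback :: "('b \<Rightarrow>\<^sub>L 'b) \<Rightarrow> ('a \<Rightarrow>\<^sub>L 'a)" where
  "pullback T = Blinfun (hadjoint V \<circ> blinfun_apply T \<circ> U)"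

lemma sandwich_eq: "sandwich V U B = pullback ` B"
  by (simp add: sandwich_def pullback_def)

lemma cinner_pullback:
  assumes "bounded_linear U" "bounded_linear V"
  shows "clinear U \<Longrightarrow> clinear V \<Longrightarrow> \<langle>pullback T x, y\<rangle> = \<langle>T (U x), V y\<rangle>"
    and "antilinear U \<Longrightarrow> antilinear V \<Longrightarrow> \<langle>pullback T x, y\<rangle> = cnj \<langle>T (U x), V y\<rangle>"
proof -
  have "bounded_linear (hadjoint V)"
    using colinear assms(2) by (intro bounded_linear_hadjoint) (auto simp: colinear_def)
  then have "bounded_linear (hadjoint V \<circ> blinfun_apply T \<circ> U)"
    unfolding comp_def
    by (intro bounded_linear_compose[OF _ bounded_linear_compose[OF blinfun.bounded_linear_right assms(1)]])
  then have "pullback T x = hadjoint V (T (U x))"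
    by (simp add: pullback_def bounded_linear_Blinfun_apply)
  then show "clinear U \<Longrightarrow> clinear V \<Longrightarrow> \<langle>pullback T x, y\<rangle> = \<langle>T (U x), V y\<rangle>"
    and "antilinear U \<Longrightarrow> antilinear V \<Longrightarrow> \<langle>pullback T x, y\<rangle> = cnj \<langle>T (U x), V y\<rangle>"
    using assms(2) by (auto simp: hadjoint_linear hadjoint_antilinear simp flip: cinner_commute)
qed

context
  assumes bounded: "bounded_linear U" "bounded_linear V"
begin

lemma cinner_pullback_eq_0_iff: "\<langle>pullback T x, y\<rangle> = 0 \<longleftrightarrow> \<langle>T (U x), V y\<rangle> = 0"
  using colinear cinner_pullback[OF bounded, of T x y] by (auto simp: colinear_def)

lemma sesquilinear_cinner_pullback:
  assumes "T \<in> B" shows "sesquilinear (\<lambda>x y. \<langle>pullback T x, y\<rangle>)"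
proof (cases "clinear U \<and> clinear V")
  case True
  then show ?thesis
    using B.clinear_A[OF assms]
    by (simp add: cinner_pullback[OF bounded] sesquilinear_def clinear_iff cinner.add_left cinner.add_right
        cinner_scaleC_left cinner_scaleC_right)
next
  case False
  then have "antilinear U" "antilinear V" using colinear by (auto simp: colinear_def)
  then show ?thesis
    using B.clinear_A[OF assms]
    by (simp add: cinner_pullback(2)[OF bounded] sesquilinear_def clinear_iff antilinear_def
        cinner.add_left cinner.add_right cinner_scaleC_left cinner_scaleC_right)
qed

text \<open>The pullback depends linearly or conjugate-linearly on \<open>T\<close>; either way the
  sandwich is closed under scalars, as the homeomorphism criterion requires.\<close>

lemma pullback_scaleC: "c *\<^sub>C pullback T = pullback (c *\<^sub>C T) \<or> c *\<^sub>C pullback T = pullback (cnj c *\<^sub>C T)"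
proof (cases "clinear U \<and> clinear V")
  case True
  then have "c *\<^sub>C pullback T = pullback (c *\<^sub>C T)"
    by (intro blinfun_eqI cinner_ext_right)
      (simp add: cinner_pullback[OF bounded] scaleC_blinfun.rep_eq cinner_scaleC_left)
  then show ?thesis ..
next
  case False
  then have "antilinear U" "antilinear V" using colinear by (auto simp: colinear_def)
  then have "c *\<^sub>C pullback T = pullback (cnj c *\<^sub>C T)"
    by (intro blinfun_eqI cinner_ext_right)
      (simp add: cinner_pullback(2)[OF bounded] scaleC_blinfun.rep_eq cinner_scaleC_left)
  then show ?thesis ..
qed

text \<open>Testing continuity on all rank-one kernels that contain \<open>T\<close> produces a nonzero \<open>a \<in> A\<close> with
  \<open>\<langle>a x, y\<rangle> = 0\<close> whenever \<open>\<langle>T (U x), V y\<rangle> = 0\<close>; such an \<open>a\<close> is a multiple of \<open>pullback T\<close>.\<close>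

lemma continuous_kernel_map_iff:
  "closure_continuous (normal_part A) (normal_closure A) (normal_part B) (normal_closure B)
    (kernel_map A B U V) \<longleftrightarrow> sandwich V U B \<subseteq> A"
proof
  assume cont: "closure_continuous (normal_part A) (normal_closure A) (normal_part B) (normal_closure B)
    (kernel_map A B U V)"
  have "pullback T \<in> A" if T: "T \<in> B" for T
  proof (cases "\<exists>x y. \<langle>T (U x), V y\<rangle> \<noteq> 0")
    case False
    then have "pullback T = 0"
      by (intro blinfun_eqI cinner_ext_right) (simp add: cinner_pullback_eq_0_iff cinner.zero_left)
    then show ?thesis using A.zero by simp
  next
    case True
    then obtain x0 y0 where 0: "\<langle>T (U x0), V y0\<rangle> \<noteq> 0" by blast
    obtain a where a: "a \<in> A" "\<And>x y. \<langle>T (U x), V y\<rangle> = 0 \<Longrightarrow> \<langle>a x, y\<rangle> = 0" "\<langle>a x0, y0\<rangle> \<noteq> 0"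
      by (rule continuous_kernel_mapD[OF cont T 0]) blast
    obtain c where c: "\<And>x y. \<langle>a x, y\<rangle> = c * \<langle>pullback T x, y\<rangle>"
      by (rule sesquilinear_proportional[OF sesquilinear_cinner_pullback[OF T]
            sesquilinear_cinner[OF A.clinear_A[OF a(1)]], of x0 y0])
        (use a(2) 0 in \<open>auto simp: cinner_pullback_eq_0_iff\<close>)
    then have "c \<noteq> 0" using a(3) by auto
    then have "pullback T = inverse c *\<^sub>C a"
      by (intro blinfun_eqI cinner_ext_right) (simp add: scaleC_blinfun.rep_eq cinner_scaleC_left c)
    then show ?thesis using A.scaleC[OF a(1)] by simp
  qed
  then show "sandwich V U B \<subseteq> A" by (auto simp: sandwich_eq)
next
  assume "sandwich V U B \<subseteq> A"
  then have "pullback T \<in> A" if "T \<in> B" for T using that by (auto simp: sandwich_eq)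
  then show "closure_continuous (normal_part A) (normal_closure A) (normal_part B) (normal_closure B)
    (kernel_map A B U V)"
    using cinner_pullback_eq_0_iff by (intro continuous_kernel_mapI) blast
qed

end

section \<open>The inverse map and the homeomorphism criterion\<close>

lemma algebra_pair_inv: "algebra_pair B A (inv U) (inv V)"
  using colinear_inv[OF colinear bij] bij
  by unfold_locales (simp_all add: bij_imp_bij_inv)

lemma inv_simps: "inv U (U x) = x" "inv V (V y) = y" "U (inv U u) = u" "V (inv V v) = v"
  using bij by (simp_all add: bij_is_inj bij_is_surj surj_f_inv_f)

lemma kernel_map_inv:
  assumes "I \<in> normal_part A"
  shows "kernel_map B A (inv U) (inv V) (kernel_map A B U V I) = I"
  using assms
proof (rule normal_partE)
  fix x y assume *: "x \<noteq> 0" "y \<noteq> 0" "I = ker_on A (\<omega> x y)" "kernel_map A B U V I = ker_on B (\<omega> (U x) (V y))"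
  then show ?thesis
    using algebra_pair.kernel_map[OF algebra_pair_inv, of "U x" "V y"] nonzero by (simp add: inv_simps)
qed

lemma kernel_map_inv':
  assumes "J \<in> normal_part B"
  shows "kernel_map A B U V (kernel_map B A (inv U) (inv V) J) = J"
  using algebra_pair.kernel_map_inv[OF algebra_pair_inv assms] bij by (simp add: inv_inv_eq)

lemma bij_betw_kernel_map: "bij_betw (kernel_map A B U V) (normal_part A) (normal_part B)"
  by (rule bij_betw_byWitness[where f' = "kernel_map B A (inv U) (inv V)"])
    (use kernel_map_inv kernel_map_inv' kernel_map_in algebra_pair.kernel_map_in[OF algebra_pair_inv] in auto)

text \<open>The two maps need agree only on \<open>normal_part B\<close>, so continuity is carried
  over later through images of its subsets and not by an equality of functions.\<close>

lemma inv_into_kernel_map: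
  assumes "J \<in> normal_part B"
  shows "inv_into (normal_part A) (kernel_map A B U V) J = kernel_map B A (inv U) (inv V) J"
  by (rule inv_into_f_eq)
    (use assms kernel_map_inv' bij_betw_kernel_map algebra_pair.kernel_map_in[OF algebra_pair_inv]
      in \<open>auto simp: bij_betw_def\<close>)

lemma image_inv_into_kernel_map:
  assumes "S \<subseteq> normal_part B"
  shows "inv_into (normal_part A) (kernel_map A B U V) ` S = kernel_map B A (inv U) (inv V) ` S"
  using assms inv_into_kernel_map by (intro image_cong) auto

lemma normal_closure_subset: "normal_closure B S \<subseteq> normal_part B"
  by (auto simp: B.mem_normal_closure)

lemma finite_homeomorphism_kernel_map:
  "finite_homeomorphism (normal_part A) (normal_closure A) (normal_part B) (normal_closure B)
    (kernel_map A B U V)"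
  using bij_betw_kernel_map finitely_continuous_kernel_map
    algebra_pair.finitely_continuous_kernel_map[OF algebra_pair_inv]
  by (auto simp: finite_homeomorphism_def finitely_continuous_def inv_into_kernel_map
      image_inv_into_kernel_map[OF normal_closure_subset] image_inv_into_kernel_map Pi_iff)

lemma closure_continuous_inv_iff:
  "closure_continuous (normal_part B) (normal_closure B) (normal_part A) (normal_closure A)
      (inv_into (normal_part A) (kernel_map A B U V)) \<longleftrightarrow>
   closure_continuous (normal_part B) (normal_closure B) (normal_part A) (normal_closure A)
      (kernel_map B A (inv U) (inv V))"
  by (auto simp: closure_continuous_def inv_into_kernel_map
      image_inv_into_kernel_map[OF normal_closure_subset] image_inv_into_kernel_map Pi_iff)

text \<open>Applying \<open>continuous_kernel_map_iff\<close> to the inverse would call for bounds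
  on \<open>inv U\<close> and \<open>inv V\<close> and speak of their sandwich. Instead, continuity
  of the inverse is matched with \<open>A \<subseteq> sandwich V U B\<close> by comparing the forms
  of \<open>a\<close> and \<open>pullback T\<close>.\<close>

lemma homeomorphism_kernel_map_iff:
  assumes bounded: "bounded_linear U" "bounded_linear V"
  shows "closure_homeomorphism (normal_part A) (normal_closure A) (normal_part B) (normal_closure B)
    (kernel_map A B U V) \<longleftrightarrow> sandwich V U B = A"
proof -
  let ?inv = "closure_continuous (normal_part B) (normal_closure B) (normal_part A) (normal_closure A)
      (kernel_map B A (inv U) (inv V))"
  interpret inv: algebra_pair B A "inv U" "inv V" by (rule algebra_pair_inv)
  have "closure_homeomorphism (normal_part A) (normal_closure A) (normal_part B) (normal_closure B)
    (kernel_map A B U V) \<longleftrightarrow> sandwich V U B \<subseteq> A \<and> ?inv"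
    using bij_betw_kernel_map continuous_kernel_map_iff[OF bounded]
    by (simp add: closure_homeomorphism_def closure_continuous_inv_iff)
  moreover have ?inv if sub: "A \<subseteq> sandwich V U B"
  proof (rule inv.continuous_kernel_mapI)
    fix a assume "a \<in> A"
    then obtain T where "T \<in> B" "a = pullback T" using sub by (auto simp: sandwich_eq)
    then show "\<exists>T\<in>B. \<forall>x y. \<langle>T x, y\<rangle> = 0 \<longleftrightarrow> \<langle>a (inv U x), inv V y\<rangle> = 0"
      by (intro bexI[of _ T]) (simp_all add: cinner_pullback_eq_0_iff[OF bounded] inv_simps)
  qed
  moreover have "A \<subseteq> sandwich V U B" if ?inv
  proof
    fix a assume a: "a \<in> A"
    show "a \<in> sandwich V U B"
    proof (cases "a = 0")
      case True
      have "pullback 0 = 0"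
        by (intro blinfun_eqI cinner_ext_right)
          (simp add: cinner_pullback_eq_0_iff[OF bounded] cinner.zero_left)
      then show ?thesis using True B.zero by (auto simp: sandwich_eq intro!: image_eqI[of _ _ 0])
    next
      case False
      then obtain x0 where "a x0 \<noteq> 0" by (metis blinfun_eqI zero_blinfun.rep_eq)
      \<comment> \<open>Testing \<open>a x0\<close> against itself provides the nonzero value that
        the separation argument asks for.\<close>
      then have ne: "\<langle>a x0, a x0\<rangle> \<noteq> 0" by (simp add: cinner_self_eq_0)
      then have "\<langle>a (inv U (U x0)), inv V (V (a x0))\<rangle> \<noteq> 0" by (simp add: inv_simps)
      then obtain T where T: "T \<in> B" "\<And>x y. \<langle>a (inv U x), inv V y\<rangle> = 0 \<Longrightarrow> \<langle>T x, y\<rangle> = 0"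
        "\<langle>T (U x0), V (a x0)\<rangle> \<noteq> 0"
        by (rule inv.continuous_kernel_mapD[OF \<open>?inv\<close> a]) blast
      \<comment> \<open>Here \<open>a\<close> is the form known not to vanish and
        \<open>pullback T\<close> the multiple; \<open>c\<close> turns out nonzero, so the relation
        can be reversed.\<close>
      obtain c where c: "\<And>x y. \<langle>pullback T x, y\<rangle> = c * \<langle>a x, y\<rangle>"
        by (rule sesquilinear_proportional[OF sesquilinear_cinner[OF A.clinear_A[OF a]]
              sesquilinear_cinner_pullback[OF bounded T(1)], of x0 "a x0"])
          (use T(2) ne in \<open>auto simp: cinner_pullback_eq_0_iff[OF bounded] inv_simps
            dest: T(2)[of "U _" "V _", unfolded inv_simps]\<close>)
      have "c \<noteq> 0" using T(3) c[of x0 "a x0"] cinner_pullback_eq_0_iff[OF bounded] by auto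
      have scale: "d *\<^sub>C pullback T \<in> sandwich V U B" for d
        using pullback_scaleC[OF bounded, of d T] B.scaleC[OF T(1)] by (auto simp: sandwich_eq)
      have "a = inverse c *\<^sub>C pullback T"
        using \<open>c \<noteq> 0\<close> by (intro blinfun_eqI cinner_ext_right)
          (simp add: scaleC_blinfun.rep_eq cinner_scaleC_left c)
      then show ?thesis using scale by simp
    qed
  qed
  ultimately show ?thesis by blast
qed

end

theorem theorem6p9:
  fixes A :: "('h :: complex_hilbert_space \<Rightarrow>\<^sub>L 'h) set"
    and B :: "('k :: complex_hilbert_space \<Rightarrow>\<^sub>L 'k) set"
    and U V :: "'h \<Rightarrow> 'k"
  assumes "irreducible_cstar A" and "irreducible_cstar B"
    and "clinear U \<and> clinear V \<or> antilinear U \<and> antilinear V"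
    and "bij U" and "bij V"
  shows "\<exists>\<Phi> \<in> normal_part A \<rightarrow> normal_part B.
    (\<forall>x y. x \<noteq> 0 \<longrightarrow> y \<noteq> 0 \<longrightarrow> \<Phi> (ker_on A (\<omega> x y)) = ker_on B (\<omega> (U x) (V y))) \<and>
    finite_homeomorphism (normal_part A) (normal_closure A) (normal_part B) (normal_closure B) \<Phi> \<and>
    (bounded_linear U \<and> bounded_linear V \<longrightarrow>
      (closure_continuous (normal_part A) (normal_closure A) (normal_part B) (normal_closure B) \<Phi>
        \<longleftrightarrow> sandwich V U B \<subseteq> A) \<and>
      (closure_homeomorphism (normal_part A) (normal_closure A) (normal_part B) (normal_closure B) \<Phi>
        \<longleftrightarrow> sandwich V U B = A))"
proof -
  interpret algebra_pair A B U V
    using assms by unfold_locales (simp_all add: colinear_def)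
  show ?thesis
    using kernel_map_in kernel_map finite_homeomorphism_kernel_map continuous_kernel_map_iff
      homeomorphism_kernel_map_iff
    by (intro bexI[of _ "kernel_map A B U V"]) blast+
qed

end
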